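(* Consider the MSSA sequences of the context for $k\in[K]$. Suppose that Assumptions 1--4 and 6 of the context hold. If the step sizes are chosen as $\alpha^k=\Theta\left(\frac{1}{\sqrt{K}}\right)$ and $\beta^k_n=\Theta\left(\frac{1}{\sqrt{K}}\right)$, then it holds that $$\frac{1}{K}\sum_{k=1}^K\mathbb{E}\|v(x^k,y^\diamond_{1:N}(x^k))\|^2=\mathcal{O}\left(\frac{1}{\sqrt{K}}\right),$$ $$\frac{1}{K}\sum_{k=1}^K\sum_{n=1}^N\mathbb{E}\|y_n^k-y_n^\ast(x^k,y_{1:n-1}^k)\|^2=\mathcal{O}\left(\frac{1}{\sqrt{K}}\right).$$
   Context: Setting (multi-sequence stochastic approximation, MSSA). $[N]=\{1,\dots,N\}$, $[K]=\{1,\dots,K\}$ with $K$ the total number of iterations, $y_{1:n}=(y_1,\dots,y_n)$, $\|\cdot\|$ is the $\ell_2$-norm. $v:\mathbb{R}^{d_0}\times\mathbb{R}^{d_1}\times\cdots\times\mathbb{R}^{d_N}\to\mathbb{R}^{d_0}$ and $h_n:\mathbb{R}^{d_0}\times\mathbb{R}^{d_1}\times\cdots\times\mathbb{R}^{d_n}\to\mathbb{R}^{d_n}$, $n\in[N]$. The MSSA updates are $$y_n^{k+1}=y_n^k-\beta_n^k\big(h_n(x^k,y_{1:n}^k)+\psi_n^k\big)\ (n\in[N]),\qquad x^{k+1}=x^k-\alpha^k\big(v(x^k,y_{1:N}^k)+\xi^k\big),$$ with positive step sizes $\alpha^k,\beta_n^k$ and random noise $\xi^k,\psi_n^k$. $\mathcal{F}^k=\sigma\big(\bigcup_{l=0}^k\{x^l,y_1^l,\dots,y_N^l\}\big)$.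 Assumption 1. For each $n\in[N]$, given $x$ and $y_{1:n-1}$, there is a constant $\mu_n>0$ such that for all $\hat y_n,\bar y_n$: $\langle h_n(x,y_{1:n-1},\hat y_n)-h_n(x,y_{1:n-1},\bar y_n),\hat y_n-\bar y_n\rangle\ge\mu_n\|\hat y_n-\bar y_n\|^2$. Assumption 2. For each $n\in[N]$ one of the following holds: (a) $h_n(x,y_{1:n})$ is $\ell_n$-Lipschitz continuous w.r.t. any variable among $x$ and $y_{1:n}$; (b) $h_n(x,y_{1:n})=A_n(x,y_{1:n-1})y_n+b_n(x,y_{1:n-1})$, where the matrix-valued map $A_n$ (values in $\mathbb{R}^{d_n\times d_n}$) is $\ell_{A,n}$-Lipschitz continuous w.r.t. any variable among $x$ and $y_{1:n-1}$ and bounded by $\ell_{A,n}'$ in spectral norm, and $b_n$ (values in $\mathbb{R}^{d_n}$) is $\ell_{b,n}$-Lipschitz continuous w.r.t. any variable among $x$ and $y_{1:n-1}$ and bounded by $\ell_{b,n}'$ in $\ell_2$-norm. Under Assumptions 1--2, for given $x,y_{1:n-1}$ there is a unique $y_n^\ast(x,y_{1:n-1})$ with $h_n(x,y_{1:n-1},y_n^\ast(x,y_{1:n-1}))=0$. Define $y_1^\diamond(x)=y_1^\ast(x)$ and $y_n^\diamond(x)=y_n^\ast(x,y_1^\diamond(x),\dots,y_{n-1}^\diamond(x))$; $y_{1:N}^\diamond(x)=(y_1^\diamond(x),\dots,y_N^\diamond(x))$. Assumption 3. There is $\ell_0>0$ such that for all $\hat x,\bar x,y_{1:N}$: $\|v(\hat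 x,y^\diamond_{1:N}(\hat x))-v(\bar x,y_{1:N})\|\le\ell_0\big(\|\hat x-\bar x\|+\sum_{n=1}^N\|y_n-y_n^\diamond(\hat x)\|\big)$. Assumption 4. $\{\xi^k\}_k$ and $\{\psi_n^k\}_k$ ($n\in[N]$) are martingale difference sequences (zero mean conditionally on $\mathcal{F}^k$), and for positive constants $\omega_0,\omega_1,\omega_2,\sigma$: $\operatorname{Var}[\psi_n^k|\mathcal{F}^k]\le\omega_0\|h_n(x^k,y_{1:n}^k)\|^2+\sigma^2$ for all $n\in[N]$, and $\operatorname{Var}[\xi^k|\mathcal{F}^k]\le\omega_1\|v(x^k,y_{1:N}^k)\|^2+\sigma^2+\omega_2\sum_{n=1}^N\|h_n(x^k,y_{1:n}^k)\|^2$. Here the variance of a random vector is its expected squared $\ell_2$-distance to its mean. Assumption 6. There exists a function $\Phi:\mathbb{R}^{d_0}\to\mathbb{R}$, lower-bounded by $C_F$, such that $\nabla\Phi(x)=v(x,y_{1:N}^\diamond(x))$. Asymptotic notation (in $K$): $f=\mathcal{O}(g)$ if there are constants $c<\infty$, $M>0$ with $f(K)\le c\,g(K)$ for all $K\ge M$; $f=\Omega(g)$ if there are $c>0$, $M>0$ with $f(K)\ge c\,g(K)$ for all $K\ge M$; $f=\Theta(g)$ if both hold.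
   Formalization: The constants in the step sizes are not arbitrary: for any choice of β_n^k = Θ(1/√K), the α^k = Θ(1/√K) must satisfy α^k ≤ ρ/√K for some ρ > 0 depending on the β_n (the claim fails otherwise); the initial points are the same for all K and have finite second moments. *)

theory Defs
  imports "HOL-Probability.Probability" "HOL-Library.Landau_Symbols"
begin

text \<open>
  The dimensions \<open>d\<^sub>1, \<dots>, d\<^sub>N\<close> may all differ, so the space of the \<open>n\<close>-th sequence is a linear
  subspace \<open>V n\<close> of one Euclidean type \<open>'b\<close>, carrying the inherited inner product. It is
  isometric to \<open>\<real>\<^sup>d\<close> for \<open>d = dim (V n)\<close>, and every list of dimensions arises by taking
  \<open>DIM('b)\<close> large enough. The space of \<open>x\<close> is the whole Euclidean type \<open>'a\<close>.

  A partial tuple \<open>(y\<^sub>1, \<dots>, y\<^sub>n)\<close> is an extensional function on \<open>{1..n}\<close>; hence a function of such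
  a tuple cannot depend on later components.
\<close>

definition tuples :: "(nat \<Rightarrow> 'b set) \<Rightarrow> nat \<Rightarrow> (nat \<Rightarrow> 'b) set" where
  "tuples V n = (\<Pi>\<^sub>E i\<in>{1..n}. V i)"


subsection \<open>Operators and fixed points\<close>

definition strongly_monotone ::
  "nat \<Rightarrow> (nat \<Rightarrow> 'b::euclidean_space set) \<Rightarrow> (nat \<Rightarrow> 'a \<Rightarrow> (nat \<Rightarrow> 'b) \<Rightarrow> 'b) \<Rightarrow> (nat \<Rightarrow> real) \<Rightarrow> bool"
where
  "strongly_monotone N V h \<mu> \<longleftrightarrow>
     (\<forall>n\<in>{1..N}. 0 < \<mu> n \<and>
        (\<forall>x. \<forall>u\<in>tuples V (n - 1). \<forall>y\<in>V n. \<forall>y'\<in>V n.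
           (h n x (u(n := y)) - h n x (u(n := y'))) \<bullet> (y - y') \<ge> \<mu> n * (norm (y - y'))\<^sup>2))"

definition lipschitz_each_var ::
  "real \<Rightarrow> (nat \<Rightarrow> 'b::metric_space set) \<Rightarrow> nat \<Rightarrow> ('a::metric_space \<Rightarrow> (nat \<Rightarrow> 'b) \<Rightarrow> 'c::metric_space) \<Rightarrow> bool"
where
  "lipschitz_each_var L V n f \<longleftrightarrow>
     (\<forall>u\<in>tuples V n. L-lipschitz_on UNIV (\<lambda>x. f x u)) \<and>
     (\<forall>x. \<forall>u\<in>tuples V n. \<forall>m\<in>{1..n}. L-lipschitz_on (V m) (\<lambda>y. f x (u(m := y))))"

text \<open>
  The norm on \<open>'b \<Rightarrow>\<^sub>L 'b\<close> is the operator norm, i.e. the spectral norm. A linear map on \<open>V n\<close> is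
  represented by an extension to \<open>'b\<close>; precomposing with the orthogonal projection onto \<open>V n\<close>
  gives an extension of the same norm, so bounding the norm on all of \<open>'b\<close> is no restriction.
\<close>

definition affine_regular ::
  "(nat \<Rightarrow> 'b::euclidean_space set) \<Rightarrow> nat \<Rightarrow> ('a::euclidean_space \<Rightarrow> (nat \<Rightarrow> 'b) \<Rightarrow> 'b) \<Rightarrow>
   real \<Rightarrow> real \<Rightarrow> real \<Rightarrow> real \<Rightarrow> bool"
where
  "affine_regular V n g lA lA' lb lb' \<longleftrightarrow>
     (\<exists>(A :: 'a \<Rightarrow> (nat \<Rightarrow> 'b) \<Rightarrow> 'b \<Rightarrow>\<^sub>L 'b) (b :: 'a \<Rightarrow> (nat \<Rightarrow> 'b) \<Rightarrow> 'b).
        (\<forall>x. \<forall>u\<in>tuples V (n - 1). blinfun_apply (A x u) ` V n \<subseteq> V n \<and> b x u \<in> V n) \<and>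
        (\<forall>x. \<forall>u\<in>tuples V (n - 1). \<forall>y\<in>V n. g x (u(n := y)) = blinfun_apply (A x u) y + b x u) \<and>
        lipschitz_each_var lA V (n - 1) A \<and>
        (\<forall>x. \<forall>u\<in>tuples V (n - 1). norm (A x u) \<le> lA') \<and>
        lipschitz_each_var lb V (n - 1) b \<and>
        (\<forall>x. \<forall>u\<in>tuples V (n - 1). norm (b x u) \<le> lb'))"

definition ystar ::
  "(nat \<Rightarrow> 'b::zero set) \<Rightarrow> (nat \<Rightarrow> 'a \<Rightarrow> (nat \<Rightarrow> 'b) \<Rightarrow> 'b) \<Rightarrow> nat \<Rightarrow> 'a \<Rightarrow> (nat \<Rightarrow> 'b) \<Rightarrow> 'b"
where
  "ystar V h n x u = (THE y. y \<in> V n \<and> h n x (u(n := y)) = 0)"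

text \<open>\<open>ydiamond V h n x\<close> is the tuple \<open>(y\<^sub>1\<^sup>\<diamond>(x), \<dots>, y\<^sub>n\<^sup>\<diamond>(x))\<close>.\<close>

primrec ydiamond ::
  "(nat \<Rightarrow> 'b::zero set) \<Rightarrow> (nat \<Rightarrow> 'a \<Rightarrow> (nat \<Rightarrow> 'b) \<Rightarrow> 'b) \<Rightarrow> nat \<Rightarrow> 'a \<Rightarrow> nat \<Rightarrow> 'b"
where
  "ydiamond V h 0 x = (\<lambda>_. undefined)"
| "ydiamond V h (Suc n) x = (ydiamond V h n x)(Suc n := ystar V h (Suc n) x (ydiamond V h n x))"

definition main_lipschitz ::
  "nat \<Rightarrow> (nat \<Rightarrow> 'b::euclidean_space set) \<Rightarrow> ('a::euclidean_space \<Rightarrow> (nat \<Rightarrow> 'b) \<Rightarrow> 'a) \<Rightarrow>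
   (nat \<Rightarrow> 'a \<Rightarrow> (nat \<Rightarrow> 'b) \<Rightarrow> 'b) \<Rightarrow> real \<Rightarrow> bool"
where
  "main_lipschitz N V v h l0 \<longleftrightarrow>
     (\<forall>x x'. \<forall>u\<in>tuples V N.
        norm (v x (ydiamond V h N x) - v x' u)
          \<le> l0 * (norm (x - x') + (\<Sum>n=1..N. norm (u n - ydiamond V h N x n))))"


subsection \<open>The stochastic iteration\<close>

definition generated_by ::
  "'w measure \<Rightarrow> nat \<Rightarrow> (nat \<Rightarrow> 'w \<Rightarrow> 'a::topological_space) \<Rightarrow>
   (nat \<Rightarrow> nat \<Rightarrow> 'w \<Rightarrow> 'b::topological_space) \<Rightarrow> nat \<Rightarrow> 'w measure"
where
  "generated_by M N x y k =
     sigma (space M)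
       ({x l -` B \<inter> space M | l B. l \<le> k \<and> B \<in> sets borel} \<union>
        {y n l -` B \<inter> space M | n l B. n \<in> {1..N} \<and> l \<le> k \<and> B \<in> sets borel})"

definition cond_mean ::
  "'w measure \<Rightarrow> 'w measure \<Rightarrow> ('w \<Rightarrow> 'c::euclidean_space) \<Rightarrow> 'w \<Rightarrow> 'c"
where
  "cond_mean M F X w = (\<Sum>b\<in>Basis. real_cond_exp M F (\<lambda>w. X w \<bullet> b) w *\<^sub>R b)"

text \<open>
  The conditional variance is extended-real valued: \<open>real_cond_exp\<close> would silently return \<open>0\<close>
  where the conditional second moment is infinite.
\<close>

definition cond_var ::
  "'w measure \<Rightarrow> 'w measure \<Rightarrow> ('w \<Rightarrow> 'c::euclidean_space) \<Rightarrow> 'w \<Rightarrow> ennreal"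
where
  "cond_var M F X = nn_cond_exp M F (\<lambda>w. ennreal ((norm (X w - cond_mean M F X w))\<^sup>2))"

definition centered_given ::
  "'w measure \<Rightarrow> 'w measure \<Rightarrow> ('w \<Rightarrow> 'c::euclidean_space) \<Rightarrow> bool"
where
  "centered_given M F X \<longleftrightarrow> integrable M X \<and> (AE w in M. cond_mean M F X w = 0)"

text \<open>
  One run with horizon \<open>K\<close>: the updates \<open>k = 0, \<dots>, K\<close>, starting from \<open>x 0\<close>, \<open>y n 0\<close>.
  The sequence index \<open>n\<close> comes before the iteration index \<open>k\<close> in \<open>y n k\<close>, \<open>\<psi> n k\<close> and \<open>\<beta> n k\<close>.
\<close>

definition mssa_run ::
  "'w measure \<Rightarrow> nat \<Rightarrow> (nat \<Rightarrow> 'b::euclidean_space set) \<Rightarrow> ('a::euclidean_space \<Rightarrow> (nat \<Rightarrow> 'b) \<Rightarrow> 'a) \<Rightarrow>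
   (nat \<Rightarrow> 'a \<Rightarrow> (nat \<Rightarrow> 'b) \<Rightarrow> 'b) \<Rightarrow> (nat \<Rightarrow> real) \<Rightarrow> (nat \<Rightarrow> nat \<Rightarrow> real) \<Rightarrow> nat \<Rightarrow>
   (nat \<Rightarrow> 'w \<Rightarrow> 'a) \<Rightarrow> (nat \<Rightarrow> nat \<Rightarrow> 'w \<Rightarrow> 'b) \<Rightarrow> (nat \<Rightarrow> 'w \<Rightarrow> 'a) \<Rightarrow> (nat \<Rightarrow> nat \<Rightarrow> 'w \<Rightarrow> 'b) \<Rightarrow> bool"
where
  "mssa_run M N V v h \<alpha> \<beta> K x y \<xi> \<psi> \<longleftrightarrow>
     (\<forall>k\<le>Suc K. x k \<in> borel_measurable M \<and>
        (\<forall>n\<in>{1..N}. y n k \<in> borel_measurable M \<and> (\<forall>w\<in>space M. y n k w \<in> V n))) \<and>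
     (\<forall>k\<le>K. \<xi> k \<in> borel_measurable M \<and>
        (\<forall>n\<in>{1..N}. \<psi> n k \<in> borel_measurable M \<and> (\<forall>w\<in>space M. \<psi> n k w \<in> V n))) \<and>
     (\<forall>k\<le>K. \<forall>w\<in>space M.
        (\<forall>n\<in>{1..N}. y n (Suc k) w =
           y n k w - \<beta> n k *\<^sub>R (h n (x k w) (\<lambda>i\<in>{1..n}. y i k w) + \<psi> n k w)) \<and>
        x (Suc k) w = x k w - \<alpha> k *\<^sub>R (v (x k w) (\<lambda>i\<in>{1..N}. y i k w) + \<xi> k w))"

definition noise_bounded ::
  "'w measure \<Rightarrow> nat \<Rightarrow> ('a::euclidean_space \<Rightarrow> (nat \<Rightarrow> 'b::euclidean_space) \<Rightarrow> 'a) \<Rightarrow>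
   (nat \<Rightarrow> 'a \<Rightarrow> (nat \<Rightarrow> 'b) \<Rightarrow> 'b) \<Rightarrow> real \<Rightarrow> real \<Rightarrow> real \<Rightarrow> real \<Rightarrow> nat \<Rightarrow>
   (nat \<Rightarrow> 'w \<Rightarrow> 'a) \<Rightarrow> (nat \<Rightarrow> nat \<Rightarrow> 'w \<Rightarrow> 'b) \<Rightarrow> (nat \<Rightarrow> 'w \<Rightarrow> 'a) \<Rightarrow> (nat \<Rightarrow> nat \<Rightarrow> 'w \<Rightarrow> 'b) \<Rightarrow> bool"
where
  "noise_bounded M N v h \<omega>0 \<omega>1 \<omega>2 \<sigma> K x y \<xi> \<psi> \<longleftrightarrow>
     (\<forall>k\<le>K. let F = generated_by M N x y k in
        centered_given M F (\<xi> k) \<and>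
        (\<forall>n\<in>{1..N}. centered_given M F (\<psi> n k)) \<and>
        (\<forall>n\<in>{1..N}. AE w in M. cond_var M F (\<psi> n k) w
           \<le> ennreal (\<omega>0 * (norm (h n (x k w) (\<lambda>i\<in>{1..n}. y i k w)))\<^sup>2 + \<sigma>\<^sup>2)) \<and>
        (AE w in M. cond_var M F (\<xi> k) w
           \<le> ennreal (\<omega>1 * (norm (v (x k w) (\<lambda>i\<in>{1..N}. y i k w)))\<^sup>2 + \<sigma>\<^sup>2
               + \<omega>2 * (\<Sum>n=1..N. (norm (h n (x k w) (\<lambda>i\<in>{1..n}. y i k w)))\<^sup>2))))"


subsection \<open>Step sizes\<close>

text \<open>
  \<open>s K k\<close> is the \<open>k\<close>-th step size of the run with horizon \<open>K\<close>. The constants hidden in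
  \<open>\<Theta>(1/\<surd>K)\<close> are uniform in \<open>k\<close>.
\<close>

definition step_Theta :: "(nat \<Rightarrow> nat \<Rightarrow> real) \<Rightarrow> bool" where
  "step_Theta s \<longleftrightarrow>
     (\<forall>K\<ge>1. \<forall>k\<le>K. 0 < s K k) \<and>
     (\<exists>c>0. \<exists>C. \<exists>K0. \<forall>K\<ge>K0. \<forall>k\<le>K. c / sqrt (real K) \<le> s K k \<and> s K k \<le> C / sqrt (real K))"

end

theory Submission
  imports Defs "HOL-Real_Asymp.Real_Asymp"
begin

text \<open>
  Since \<open>y\<^sub>n\<^sup>*\<close> is only Lipschitz, the noise in \<open>x\<close> makes \<open>y\<^sub>n\<^sup>*(x, y\<^sub>1, \<dots>)\<close> move by order \<open>\<alpha>\<close> even in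
  conditional mean, which is too much for the tracking error itself to be a Lyapunov function.
  Therefore \<open>x\<close> and the \<open>y\<^sub>n\<close> are accompanied by exponential averages with rate \<open>\<epsilon> = 1/\<surd>K\<close>, and the
  tracking error of \<open>y\<^sub>n\<close> is measured against \<open>y\<^sub>n\<^sup>*\<close> at the averaged point. This target is
  predictable and moves by at most \<open>\<epsilon>\<close> times the lags (iterate minus average), whereas each lag
  contracts with rate \<open>\<epsilon>\<close> and sees the martingale noise only to second order. Because \<open>h\<^sub>n\<close> depends
  on \<open>y\<^sub>1, \<dots>, y\<^sub>n\<close> only, lags and tracking errors form a triangular system, and a combination with
  geometrically decreasing weights, added to \<open>\<Phi>(x)\<close>, decreases up to \<open>O(\<epsilon>\<^sup>2)\<close> per step once
  \<open>\<alpha>/\<epsilon>\<close> is small.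
\<close>

subsection \<open>Square-integrable functions and centred noise\<close>

text \<open>The orders are balanced as follows. With \<epsilon>^2 = 1/K, a remainder of order
  \<epsilon>^2 per step adds up to a constant over the horizon, whereas the decrease carries a
  factor \<epsilon>; so the sums of second moments are O(\<surd>K), and division by K gives the
  rate. Hence a disturbance of order \<epsilon> must be paid for by a decrease, and the variance
  \<sigma>^2 may enter with factor \<epsilon>^2 only.

  Within the y-system the couplings are of order \<epsilon>, like the contraction itself, and their
  constants are not small; only the triangular shape helps there. It leaves one cycle: the lag of x
  disturbs every y_n, and all errors, together with the gradient, return to the lag of x through the
  drift v. This return has the factor \<alpha>^2/\<epsilon>, which is (\<alpha>/\<epsilon>) \<alpha>
  when compared with the decrease \<alpha> of the gradient term and (\<alpha>/\<epsilon>)^2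
  \<epsilon> when compared with the decrease \<epsilon> of the errors. A small ratio
  \<alpha>/\<epsilon> closes the cycle, and this is the origin of the threshold \<rho>. It is
  determined by the constants of the problem and the bounds on \<beta>, before any run is
  considered.\<close>

definition sq_integrable :: "'w measure \<Rightarrow> ('w \<Rightarrow> 'c::euclidean_space) \<Rightarrow> bool" where
  "sq_integrable M f \<longleftrightarrow> f \<in> borel_measurable M \<and> integrable M (\<lambda>w. (norm (f w))\<^sup>2)"

lemma sq_integrableD:
  assumes "sq_integrable M f"
  shows "f \<in> borel_measurable M" "integrable M (\<lambda>w. (norm (f w))\<^sup>2)"
  using assms by (auto simp: sq_integrable_def)

lemma sq_integrable_bound:
  assumes "f \<in> borel_measurable M" "sq_integrable M g"
    and "\<And>w. w \<in> space M \<Longrightarrow> norm (f w) \<le> c * norm (g w)"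
  shows "sq_integrable M f"
proof -
  have "integrable M (\<lambda>w. (norm (f w))\<^sup>2)"
  proof (rule Bochner_Integration.integrable_bound)
    show "integrable M (\<lambda>w. c\<^sup>2 * (norm (g w))\<^sup>2)"
      using assms(2) by (auto simp: sq_integrable_def)
    have "(norm (f w))\<^sup>2 \<le> c\<^sup>2 * (norm (g w))\<^sup>2" if "w \<in> space M" for w
      using power_mono[OF assms(3)[OF that], of 2] by (simp add: power_mult_distrib)
    then show "AE w in M. norm ((norm (f w))\<^sup>2) \<le> norm (c\<^sup>2 * (norm (g w))\<^sup>2)"
      by (intro AE_I2) auto
  qed (use assms(1) in measurable)
  then show ?thesis using assms(1) by (simp add: sq_integrable_def)
qed

lemma sq_integrable_norm:
  "sq_integrable M f \<Longrightarrow> sq_integrable M (\<lambda>w. norm (f w))"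
  by (auto simp: sq_integrable_def)

lemma sq_integrable_scaleR:
  "sq_integrable M f \<Longrightarrow> sq_integrable M (\<lambda>w. c *\<^sub>R f w)"
  by (rule sq_integrable_bound[where g = f and c = "\<bar>c\<bar>"]) (auto simp: sq_integrable_def)

lemma sq_integrable_add:
  assumes "sq_integrable M f" "sq_integrable M g"
  shows "sq_integrable M (\<lambda>w. f w + g w)"
proof -
  have "integrable M (\<lambda>w. (norm (f w + g w))\<^sup>2)"
  proof (rule Bochner_Integration.integrable_bound)
    show "integrable M (\<lambda>w. 2 * (norm (f w))\<^sup>2 + 2 * (norm (g w))\<^sup>2)"
      using assms by (auto simp: sq_integrable_def)
    have "(norm (f w + g w))\<^sup>2 \<le> 2 * (norm (f w))\<^sup>2 + 2 * (norm (g w))\<^sup>2" for w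
    proof -
      have "(norm (f w + g w))\<^sup>2 \<le> (norm (f w) + norm (g w))\<^sup>2"
        by (intro power_mono norm_triangle_ineq norm_ge_zero)
      also have "\<dots> \<le> 2 * (norm (f w))\<^sup>2 + 2 * (norm (g w))\<^sup>2"
        by (smt (verit) sum_squares_bound power2_sum)
      finally show ?thesis .
    qed
    then show "AE w in M. norm ((norm (f w + g w))\<^sup>2) \<le> norm (2 * (norm (f w))\<^sup>2 + 2 * (norm (g w))\<^sup>2)"
      by (intro AE_I2) auto
  qed (use assms in \<open>auto simp: sq_integrable_def\<close>)
  then show ?thesis using assms by (auto simp: sq_integrable_def)
qed

lemma sq_integrable_diff:
  assumes "sq_integrable M f" "sq_integrable M g"
  shows "sq_integrable M (\<lambda>w. f w - g w)"
  using sq_integrable_add[OF assms(1) sq_integrable_scaleR[OF assms(2), of "-1"]] by simp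

lemma sq_integrable_sum:
  assumes "\<And>i. i \<in> I \<Longrightarrow> sq_integrable M (f i)"
  shows "sq_integrable M (\<lambda>w. \<Sum>i\<in>I. f i w)"
  using assms
proof (induction I rule: infinite_finite_induct)
  case (insert i I)
  then show ?case by (simp add: sq_integrable_add)
qed (simp_all add: sq_integrable_def)

lemma (in finite_measure) sq_integrable_const: "sq_integrable M (\<lambda>w. c)"
  by (simp add: sq_integrable_def)

lemma sq_integrable_inner:
  assumes "sq_integrable M f" "sq_integrable M g"
  shows "integrable M (\<lambda>w. f w \<bullet> g w)"
proof (rule Bochner_Integration.integrable_bound)
  show "integrable M (\<lambda>w. (norm (f w))\<^sup>2 + (norm (g w))\<^sup>2)"
    using assms by (auto simp: sq_integrable_def)
  have "\<bar>f w \<bullet> g w\<bar> \<le> (norm (f w))\<^sup>2 + (norm (g w))\<^sup>2" for w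
  proof -
    have "\<bar>f w \<bullet> g w\<bar> \<le> norm (f w) * norm (g w)" by (rule Cauchy_Schwarz_ineq2)
    moreover have "0 \<le> norm (f w) * norm (g w)" by simp
    ultimately show ?thesis
      using sum_squares_bound[of "norm (f w)" "norm (g w)"] by linarith
  qed
  then show "AE w in M. norm (f w \<bullet> g w) \<le> norm ((norm (f w))\<^sup>2 + (norm (g w))\<^sup>2)"
    by (intro AE_I2) auto
qed (use assms in \<open>auto simp: sq_integrable_def\<close>)

text \<open>\<open>cond_mean\<close> is built coordinatewise, so the pull-out property of
  conditional expectation is applied in each basis direction: \<open>g\<close> is
  \<open>F\<close>-measurable, and the coordinate of \<open>X\<close> is replaced by its conditional
  mean, which vanishes. Square integrability of both factors makes the products integrable.\<close>

lemma (in prob_space) centered_given_orthogonal: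
  assumes F: "subalgebra M F" and X: "centered_given M F X" "sq_integrable M X"
    and g: "g \<in> borel_measurable F" "sq_integrable M g"
  shows "(\<integral>w. g w \<bullet> X w \<partial>M) = 0"
proof -
  interpret finite_measure_subalgebra M F using F by unfold_locales
  have int: "integrable M (\<lambda>w. (g w \<bullet> b) * (X w \<bullet> b))" if "b \<in> Basis" for b
  proof -
    have "sq_integrable M (\<lambda>w. f w \<bullet> b)" if "sq_integrable M f" for f :: "'a \<Rightarrow> 'b"
      by (rule sq_integrable_bound[where c = 1, OF _ that])
        (use \<open>b \<in> Basis\<close> that in \<open>auto simp: sq_integrable_def Basis_le_norm\<close>)
    from this[OF g(2)] this[OF X(2)]
    have "sq_integrable M (\<lambda>w. g w \<bullet> b)" "sq_integrable M (\<lambda>w. X w \<bullet> b)" by simp_all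
    from sq_integrable_inner[OF this] show ?thesis by simp
  qed
  have "(\<integral>w. (g w \<bullet> b) * (X w \<bullet> b) \<partial>M) = 0" if b: "b \<in> Basis" for b
  proof -
    have [measurable]: "(\<lambda>w. X w \<bullet> b) \<in> borel_measurable M" using X(2) by (auto simp: sq_integrable_def)
    have gm: "(\<lambda>w. g w \<bullet> b) \<in> borel_measurable F" using g(1) by measurable
    have "(\<integral>w. (g w \<bullet> b) * (X w \<bullet> b) \<partial>M) = (\<integral>w. (g w \<bullet> b) * real_cond_exp M F (\<lambda>w. X w \<bullet> b) w \<partial>M)"
      using real_cond_exp_intg(2)[OF int[OF b] gm] by simp
    also have "\<dots> = (\<integral>w. 0 \<partial>M)"
    proof (rule integral_cong_AE)
      have "AE w in M. cond_mean M F X w = 0" using X(1) by (simp add: centered_given_def)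
      then show "AE w in M. (g w \<bullet> b) * real_cond_exp M F (\<lambda>w. X w \<bullet> b) w = 0"
      proof eventually_elim
        case (elim w)
        then have "cond_mean M F X w \<bullet> b = 0" by simp
        moreover have "cond_mean M F X w \<bullet> b = real_cond_exp M F (\<lambda>w. X w \<bullet> b) w"
            unfolding cond_mean_def by (rule inner_sum_left_Basis[OF b])
          ultimately show ?case by simp
      qed
    qed (use measurable_from_subalg[OF F gm] in auto)
    finally show ?thesis by simp
  qed
  then show ?thesis
    using int by (subst euclidean_inner) (simp add: Bochner_Integration.integral_sum)
qed

text \<open>Finiteness of the second moment is an outcome here. As the conditional mean vanishes
  almost everywhere, the conditional variance is the conditional second moment; being extended-real
  valued, it can be handled by nonnegative integrals, which require no integrability, and the return
  to Bochner integrals comes at the end.\<close>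

lemma (in prob_space) centered_given_second_moment:
  assumes F: "subalgebra M F" and X: "centered_given M F X"
    and var: "AE w in M. cond_var M F X w \<le> ennreal (b w)"
    and b: "integrable M b" "\<And>w. w \<in> space M \<Longrightarrow> 0 \<le> b w"
  shows "sq_integrable M X" "(\<integral>w. (norm (X w))\<^sup>2 \<partial>M) \<le> (\<integral>w. b w \<partial>M)"
proof -
  interpret finite_measure_subalgebra M F using F by unfold_locales
  have Xm [measurable]: "X \<in> borel_measurable M" using X by (auto simp: centered_given_def)
  have cm: "cond_mean M F X \<in> borel_measurable M"
  proof -
    have "(\<lambda>w. \<Sum>b\<in>Basis. real_cond_exp M F (\<lambda>w. X w \<bullet> b) w *\<^sub>R b) \<in> borel_measurable M" by measurable
    then show ?thesis by (simp add: cond_mean_def[abs_def])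
  qed
  have "(\<integral>\<^sup>+w. ennreal ((norm (X w))\<^sup>2) \<partial>M) = (\<integral>\<^sup>+w. ennreal ((norm (X w - cond_mean M F X w))\<^sup>2) \<partial>M)"
  proof (rule nn_integral_cong_AE)
    have "AE w in M. cond_mean M F X w = 0" using X(1) by (simp add: centered_given_def)
    then show "AE w in M. ennreal ((norm (X w))\<^sup>2) = ennreal ((norm (X w - cond_mean M F X w))\<^sup>2)"
      by eventually_elim simp
  qed
  \<comment> \<open>The factor 1 makes the tower property an instance of
    \<open>nn_cond_exp_intg\<close>.\<close>
  also have "\<dots> = (\<integral>\<^sup>+w. 1 * cond_var M F X w \<partial>M)"
    unfolding cond_var_def
    by (subst nn_cond_exp_intg) (use cm in measurable)
  also have "\<dots> \<le> (\<integral>\<^sup>+w. ennreal (b w) \<partial>M)"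
    using var by (intro nn_integral_mono_AE) auto
  also have "\<dots> = ennreal (\<integral>w. b w \<partial>M)"
    using b by (intro nn_integral_eq_integral AE_I2) auto
  finally have le: "(\<integral>\<^sup>+w. ennreal ((norm (X w))\<^sup>2) \<partial>M) \<le> ennreal (\<integral>w. b w \<partial>M)" .
  have int: "integrable M (\<lambda>w. (norm (X w))\<^sup>2)"
    by (rule integrableI_bounded) (use le in \<open>auto simp: less_top[symmetric] top_unique\<close>)
  then show "sq_integrable M X" by (simp add: sq_integrable_def)
  have "ennreal (\<integral>w. (norm (X w))\<^sup>2 \<partial>M) \<le> ennreal (\<integral>w. b w \<partial>M)"
    using le by (subst (asm) nn_integral_eq_integral[OF int]) auto
  then show "(\<integral>w. (norm (X w))\<^sup>2 \<partial>M) \<le> (\<integral>w. b w \<partial>M)"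
    using b by (subst (asm) ennreal_le_iff) (auto intro!: integral_nonneg_AE AE_I2)
qed

text \<open>Only \<open>P\<close> has to be measurable with respect to \<open>F\<close>: the drift \<open>v\<close> need not be, since
  Assumption 3 says nothing about its regularity away from the fixed point.\<close>

lemma (in prob_space) noisy_step_second_moment:
  assumes F: "subalgebra M F" and X: "centered_given M F X" "sq_integrable M X"
    and P: "P \<in> borel_measurable F" "sq_integrable M P" and q: "sq_integrable M q"
  shows "(\<integral>w. (norm (P w - c *\<^sub>R (q w + X w)))\<^sup>2 \<partial>M)
    \<le> (\<integral>w. (norm (P w - c *\<^sub>R q w))\<^sup>2 \<partial>M)
      + c\<^sup>2 * ((\<integral>w. (norm (q w))\<^sup>2 \<partial>M) + 2 * (\<integral>w. (norm (X w))\<^sup>2 \<partial>M))"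
proof -
  have i1: "integrable M (\<lambda>w. (norm (P w - c *\<^sub>R (q w + X w)))\<^sup>2)"
    using sq_integrable_diff[OF P(2) sq_integrable_scaleR[OF sq_integrable_add[OF q X(2)]]]
    by (auto simp: sq_integrable_def)
  have i2: "integrable M (\<lambda>w. (norm (P w - c *\<^sub>R q w))\<^sup>2)"
    using sq_integrable_diff[OF P(2) sq_integrable_scaleR[OF q]] by (auto simp: sq_integrable_def)
  note i3 = sq_integrableD(2)[OF q] sq_integrableD(2)[OF X(2)] sq_integrable_inner[OF P(2) X(2)]
  have "(\<integral>w. (norm (P w - c *\<^sub>R (q w + X w)))\<^sup>2 \<partial>M)
    \<le> (\<integral>w. (norm (P w - c *\<^sub>R q w))\<^sup>2 - 2 * c * (P w \<bullet> X w)
          + c\<^sup>2 * ((norm (q w))\<^sup>2 + 2 * (norm (X w))\<^sup>2) \<partial>M)"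
  proof (rule integral_mono)
    fix w
    \<comment> \<open>The product of \<open>P\<close> with the noise is linear in \<open>c\<close>
      and has to vanish exactly in the mean. The product of \<open>q\<close> with the noise already
      carries \<open>c\<^sup>2\<close>, so Young's inequality is enough; it doubles the noise term
      and adds one squared norm of \<open>q\<close>.\<close>
    have "2 * (q w \<bullet> X w) \<le> (norm (q w))\<^sup>2 + (norm (X w))\<^sup>2"
      using norm_cauchy_schwarz[of "q w" "X w"] sum_squares_bound[of "norm (q w)" "norm (X w)"] by simp
    from mult_left_mono[OF this, of "c\<^sup>2"]
    show "(norm (P w - c *\<^sub>R (q w + X w)))\<^sup>2 \<le> (norm (P w - c *\<^sub>R q w))\<^sup>2 - 2 * c * (P w \<bullet> X w)
          + c\<^sup>2 * ((norm (q w))\<^sup>2 + 2 * (norm (X w))\<^sup>2)"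
      unfolding power2_norm_eq_inner
      by (simp add: algebra_simps inner_commute power2_eq_square)
  qed (use i1 i2 i3 in auto)
  also have "\<dots> = (\<integral>w. (norm (P w - c *\<^sub>R q w))\<^sup>2 \<partial>M) - 2 * c * (\<integral>w. P w \<bullet> X w \<partial>M)
      + c\<^sup>2 * ((\<integral>w. (norm (q w))\<^sup>2 \<partial>M) + 2 * (\<integral>w. (norm (X w))\<^sup>2 \<partial>M))"
    using i2 i3 by simp
  finally show ?thesis using centered_given_orthogonal[OF F X P] by simp
qed

text \<open>The Lipschitz bound involves finitely many coordinates, each continuous in the product
  topology, so the uncurried map is continuous on \<open>UNIV \<times> tuples V n\<close>. This
  gives measurability for the Borel algebra restricted to that set, and the process takes its values
  in the set.\<close>

lemma measurable_tuple_function: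
  fixes g :: "'a::euclidean_space \<Rightarrow> (nat \<Rightarrow> 'b::euclidean_space) \<Rightarrow> 'c::euclidean_space"
  assumes lip: "\<And>x x' u u'. u \<in> tuples V n \<Longrightarrow> u' \<in> tuples V n \<Longrightarrow>
      norm (g x u - g x' u') \<le> L * (norm (x - x') + (\<Sum>i=1..n. norm (u i - u' i)))"
    and X [measurable]: "X \<in> borel_measurable F"
    and Y: "\<And>i. i \<in> {1..n} \<Longrightarrow> Y i \<in> borel_measurable F"
      "\<And>i w. i \<in> {1..n} \<Longrightarrow> w \<in> space F \<Longrightarrow> Y i w \<in> V i"
  shows "(\<lambda>w. g (X w) (\<lambda>i\<in>{1..n}. Y i w)) \<in> borel_measurable F"
proof -
  define S where "S = (UNIV :: 'a set) \<times> tuples V n"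
  define G where "G p = g (fst p) (snd p)" for p
  have "continuous_on S G"
    unfolding continuous_on_def
  proof
    fix p assume p: "p \<in> S"
    have c: "((\<lambda>q. snd q i) \<longlongrightarrow> snd p i) (at p within S)" for i
    proof -
      have "continuous_on UNIV (\<lambda>q :: 'a \<times> (nat \<Rightarrow> 'b). snd q i)"
        by (rule continuous_on_product_then_coordinatewise[where f = snd]) (rule continuous_on_snd[OF continuous_on_id])
      then have "((\<lambda>q. snd q i) \<longlongrightarrow> snd p i) (at p)"
        unfolding continuous_on_def by blast
      then show ?thesis by (rule tendsto_within_subset) simp
    qed
    have "((\<lambda>q. G q - G p) \<longlongrightarrow> 0) (at p within S)"
    proof (rule Lim_null_comparison)
      show "\<forall>\<^sub>F q in at p within S. norm (G q - G p)
          \<le> L * (norm (fst q - fst p) + (\<Sum>i=1..n. norm (snd q i - snd p i)))"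
        using p unfolding eventually_at_filter S_def G_def
        by (intro always_eventually) (auto intro!: lip simp del: One_nat_def)
      have "((\<lambda>q. L * (norm (fst q - fst p) + (\<Sum>i=1..n. norm (snd q i - snd p i))))
          \<longlongrightarrow> L * (norm (fst p - fst p) + (\<Sum>i=1..n. norm (snd p i - snd p i)))) (at p within S)"
        by (intro tendsto_intros c)
      then show "((\<lambda>q. L * (norm (fst q - fst p) + (\<Sum>i=1..n. norm (snd q i - snd p i))))
          \<longlongrightarrow> 0) (at p within S)" by simp
    qed
    then show "(G \<longlongrightarrow> G p) (at p within S)" by (simp add: LIM_zero_iff)
  qed
  then have G: "G \<in> borel_measurable (restrict_space borel S)"
    by (rule borel_measurable_continuous_on_restrict)
  have "(\<lambda>w. (\<lambda>i\<in>{1..n}. Y i w)) \<in> borel_measurable F"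
  proof (rule measurable_coordinatewise_then_product)
    fix i show "(\<lambda>w. (\<lambda>i\<in>{1..n}. Y i w) i) \<in> borel_measurable F"
      using Y(1) by (cases "i \<in> {1..n}") auto
  qed
  then have "(\<lambda>w. (X w, \<lambda>i\<in>{1..n}. Y i w)) \<in> borel_measurable F"
    by (intro borel_measurable_Pair X)
  then have "(\<lambda>w. (X w, \<lambda>i\<in>{1..n}. Y i w)) \<in> measurable F (restrict_space borel S)"
    by (rule measurable_restrict_space2[rotated]) (use Y(2) in \<open>auto simp: S_def tuples_def\<close>)
  from measurable_compose[OF this G] show ?thesis by (simp add: G_def)
qed

subsection \<open>Regularity of the fixed points\<close>

lemma tuples_restrict:
  "(\<And>i. i \<in> {1..n} \<Longrightarrow> u i \<in> V i) \<Longrightarrow> restrict u {1..n} \<in> tuples V n"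
  by (auto simp: tuples_def)

lemma tuples_memD: "u \<in> tuples V n \<Longrightarrow> i \<in> {1..n} \<Longrightarrow> u i \<in> V i"
  by (auto simp: tuples_def PiE_iff)

lemma tuples_extend:
  assumes "u \<in> tuples V (n - 1)" "y \<in> V n" "1 \<le> n"
  shows "u(n := y) \<in> tuples V n"
proof -
  have "{1..n} = insert n {1..n - 1}" using assms(3) by auto
  then show ?thesis using assms by (simp add: tuples_def PiE_fun_upd del: One_nat_def)
qed

lemma restrict_Suc_tuple:
  fixes u :: "nat \<Rightarrow> 'b"
  assumes "1 \<le> n"
  shows "(restrict u {1..n - 1})(n := u n) = restrict u {1..n}"
  using assms by (auto simp: fun_eq_iff restrict_def)

text \<open>One argument is changed at a time: \<open>x\<close> with the tuple fixed, then the
  components in order. Every intermediate tuple is admissible because the tuple space is a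
  product.\<close>

lemma lipschitz_each_var_joint:
  fixes f :: "'a::real_normed_vector \<Rightarrow> (nat \<Rightarrow> 'b::real_normed_vector) \<Rightarrow> 'c::real_normed_vector"
  assumes lip: "lipschitz_each_var L V n f" and u: "u \<in> tuples V n" "u' \<in> tuples V n"
  shows "norm (f x u - f x' u') \<le> L * (norm (x - x') + (\<Sum>i=1..n. norm (u i - u' i)))"
proof -
  \<comment> \<open>A hybrid tuple: the first \<open>j\<close> components come from
    \<open>u'\<close>, the others from \<open>u\<close>. Consecutive hybrids differ only in
    component \<open>Suc j\<close>.\<close>
  define z where "z j i = (if i \<in> {1..j} then u' i else u i)" for j i
  have z: "z j \<in> tuples V n" if "j \<le> n" for j
    using u that unfolding tuples_def z_def by (auto simp: PiE_iff extensional_def)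
  have step: "norm (f x' u - f x' (z j)) \<le> L * (\<Sum>i=1..j. norm (u i - u' i))" if "j \<le> n" for j
    using that
  proof (induction j)
    case 0
    have "z 0 = u" by (auto simp: z_def)
    then show ?case by simp
  next
    case (Suc j)
    have eq: "(z j)(Suc j := u' (Suc j)) = z (Suc j)" "(z j)(Suc j := u (Suc j)) = z j"
      by (auto simp: z_def fun_eq_iff)
    have "L-lipschitz_on (V (Suc j)) (\<lambda>y. f x' ((z j)(Suc j := y)))"
      using lip z[of j] Suc.prems by (auto simp: lipschitz_each_var_def)
    from lipschitz_onD[OF this, of "u (Suc j)" "u' (Suc j)"]
    have "norm (f x' (z j) - f x' (z (Suc j))) \<le> L * norm (u (Suc j) - u' (Suc j))"
      using u Suc.prems by (simp add: eq dist_norm tuples_memD)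
    with Suc norm_triangle_ineq[of "f x' u - f x' (z j)" "f x' (z j) - f x' (z (Suc j))"]
    show ?case by (simp add: algebra_simps)
  qed
  have "z n = u'" using u by (auto simp: z_def tuples_def fun_eq_iff PiE_iff extensional_def)
  with step[of n] have 1: "norm (f x' u - f x' u') \<le> L * (\<Sum>i=1..n. norm (u i - u' i))" by simp
  have "L-lipschitz_on UNIV (\<lambda>x. f x u)" using lip u by (auto simp: lipschitz_each_var_def)
  from lipschitz_onD[OF this, of x x'] have "norm (f x u - f x' u) \<le> L * norm (x - x')"
    by (simp add: dist_norm)
  with 1 norm_triangle_ineq[of "f x u - f x' u" "f x' u - f x' u'"]
  show ?thesis by (simp add: algebra_simps)
qed

text \<open>Zeros of \<open>g\<close> are fixed points of the step
  \<open>y - t *\<^sub>R g y\<close>, which maps the subspace into itself and is a contraction for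
  suitable \<open>t\<close>. Banach's theorem applies because a subspace is closed, hence
  complete.\<close>

lemma strongly_monotone_ex1_zero:
  fixes g :: "'b::euclidean_space \<Rightarrow> 'b"
  assumes S: "subspace S" and range: "\<And>y. y \<in> S \<Longrightarrow> g y \<in> S"
    and m: "0 < m" "\<And>y y'. y \<in> S \<Longrightarrow> y' \<in> S \<Longrightarrow> m * (norm (y - y'))\<^sup>2 \<le> (g y - g y') \<bullet> (y - y')"
    and L: "\<And>y y'. y \<in> S \<Longrightarrow> y' \<in> S \<Longrightarrow> norm (g y - g y') \<le> L * norm (y - y')"
  shows "\<exists>!y. y \<in> S \<and> g y = 0"
proof -
  \<comment> \<open>The maximum ensures \<open>0 < L'\<close> and also \<open>m \<le> L'\<close>, so
    that \<open>q\<close> below is nonnegative.\<close>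
  define L' where "L' = max L m"
  have L': "norm (g y - g y') \<le> L' * norm (y - y')" if "y \<in> S" "y' \<in> S" for y y'
    using L[OF that] by (rule order_trans) (simp add: L'_def mult_right_mono)
  have "0 < L'" "m \<le> L'" using m by (auto simp: L'_def)
  \<comment> \<open>This value minimises 1 - 2 t m + t^2 L'^2, the bound for the squared contraction
    factor; the minimum is \<open>q\<close>.\<close>
  define t where "t = m / L'\<^sup>2"
  have t: "0 < t" using m \<open>0 < L'\<close> by (simp add: t_def)
  define q where "q = 1 - m\<^sup>2 / L'\<^sup>2"
  have q: "0 \<le> q" "q < 1"
    using m \<open>0 < L'\<close> \<open>m \<le> L'\<close> by (auto simp: q_def divide_simps power_mono)
  have contr: "dist (y - t *\<^sub>R g y) (y' - t *\<^sub>R g y') \<le> sqrt q * dist y y'" if "y \<in> S" "y' \<in> S" for y y'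
  proof -
    have "(norm ((y - t *\<^sub>R g y) - (y' - t *\<^sub>R g y')))\<^sup>2
        = (norm (y - y'))\<^sup>2 - 2 * t * ((g y - g y') \<bullet> (y - y')) + t\<^sup>2 * (norm (g y - g y'))\<^sup>2"
      unfolding power2_norm_eq_inner by (simp add: algebra_simps inner_commute power2_eq_square)
    also have "\<dots> \<le> (norm (y - y'))\<^sup>2 - 2 * t * (m * (norm (y - y'))\<^sup>2) + t\<^sup>2 * (L' * norm (y - y'))\<^sup>2"
      using t that by (intro add_mono diff_mono mult_left_mono power_mono m(2) L') auto
    also have "\<dots> = q * (norm (y - y'))\<^sup>2"
      using \<open>0 < L'\<close> unfolding t_def q_def by (simp add: field_simps power2_eq_square)
    finally have "norm ((y - t *\<^sub>R g y) - (y' - t *\<^sub>R g y')) \<le> sqrt (q * (norm (y - y'))\<^sup>2)"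
      by (rule real_le_rsqrt)
    then show ?thesis by (simp add: dist_norm real_sqrt_mult)
  qed
  have "\<exists>!y. y \<in> S \<and> y - t *\<^sub>R g y = y"
  proof (rule Banach_fix[OF iffD2[OF complete_eq_closed closed_subspace[OF S]]])
    show "S \<noteq> {}" using subspace_0[OF S] by auto
    show "0 \<le> sqrt q" "sqrt q < 1" using q by (auto simp: real_sqrt_lt_1_iff)
    show "(\<lambda>y. y - t *\<^sub>R g y) ` S \<subseteq> S"
      using S range by (auto intro: subspace_diff subspace_scale)
  qed (use contr in auto)
  then show ?thesis using t by simp
qed

text \<open>The common ground of the two regularity alternatives, with constants uniform in
  \<open>n\<close>. An affine operator is in general not jointly Lipschitz, since a change of the
  matrix is multiplied by an unbounded \<open>y\<close>; but it is Lipschitz in its own variable,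
  and its zero is Lipschitz in all the others. The dependence of \<open>h\<close> on the other
  variables is therefore always routed through \<open>ystar\<close>.\<close>

locale regular_operators =
  fixes N :: nat and V :: "nat \<Rightarrow> 'b::euclidean_space set"
    and h :: "nat \<Rightarrow> 'a::euclidean_space \<Rightarrow> (nat \<Rightarrow> 'b) \<Rightarrow> 'b" and m L :: real
  assumes V: "n \<in> {1..N} \<Longrightarrow> subspace (V n)"
    and m_pos: "0 < m" and L_ge_1: "1 \<le> L"
    and h_monotone: "\<lbrakk>n \<in> {1..N}; u \<in> tuples V (n - 1); y \<in> V n; y' \<in> V n\<rbrakk> \<Longrightarrow>
        m * (norm (y - y'))\<^sup>2 \<le> (h n x (u(n := y)) - h n x (u(n := y'))) \<bullet> (y - y')"
    and h_lipschitz: "\<lbrakk>n \<in> {1..N}; u \<in> tuples V (n - 1); y \<in> V n; y' \<in> V n\<rbrakk> \<Longrightarrow>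
        norm (h n x (u(n := y)) - h n x (u(n := y'))) \<le> L * norm (y - y')"
    and ystar_mem: "\<lbrakk>n \<in> {1..N}; u \<in> tuples V (n - 1)\<rbrakk> \<Longrightarrow> ystar V h n x u \<in> V n"
    and ystar_zero: "\<lbrakk>n \<in> {1..N}; u \<in> tuples V (n - 1)\<rbrakk> \<Longrightarrow> h n x (u(n := ystar V h n x u)) = 0"
    and ystar_lipschitz: "\<lbrakk>n \<in> {1..N}; u \<in> tuples V (n - 1); u' \<in> tuples V (n - 1)\<rbrakk> \<Longrightarrow>
        norm (ystar V h n x u - ystar V h n x' u')
          \<le> L * (norm (x - x') + (\<Sum>i=1..n-1. norm (u i - u' i)))"

text \<open>Both alternatives follow one scheme. Strong monotonicity bounds the distance from a
  point to the zero by the norm of the operator at that point, divided by \<open>m\<close>. The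
  point inserted is the zero for the other arguments, where the operator value is caused by the
  change of arguments alone.\<close>

lemma regular_operators_single:
  fixes V :: "nat \<Rightarrow> 'b::euclidean_space set"
    and h :: "nat \<Rightarrow> 'a::euclidean_space \<Rightarrow> (nat \<Rightarrow> 'b) \<Rightarrow> 'b"
  assumes n: "1 \<le> n" and V: "subspace (V n)"
    and range: "\<And>x u. u \<in> tuples V n \<Longrightarrow> h n x u \<in> V n"
    and m: "0 < m" "\<And>x u y y'. \<lbrakk>u \<in> tuples V (n - 1); y \<in> V n; y' \<in> V n\<rbrakk> \<Longrightarrow>
        m * (norm (y - y'))\<^sup>2 \<le> (h n x (u(n := y)) - h n x (u(n := y'))) \<bullet> (y - y')"
    and reg: "lipschitz_each_var l V n (h n) \<or> affine_regular V n (h n) lA lA' lb lb'"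
  shows "\<exists>L. (\<forall>x. \<forall>u\<in>tuples V (n - 1). \<forall>y\<in>V n. \<forall>y'\<in>V n.
            norm (h n x (u(n := y)) - h n x (u(n := y'))) \<le> L * norm (y - y')) \<and>
        (\<forall>x. \<forall>u\<in>tuples V (n - 1). ystar V h n x u \<in> V n \<and> h n x (u(n := ystar V h n x u)) = 0) \<and>
        (\<forall>x x'. \<forall>u\<in>tuples V (n - 1). \<forall>u'\<in>tuples V (n - 1).
            norm (ystar V h n x u - ystar V h n x' u')
              \<le> L * (norm (x - x') + (\<Sum>i=1..n-1. norm (u i - u' i))))"
proof -
  let ?T = "tuples V (n - 1)"
  let ?d = "\<lambda>x x' u u'. norm (x - x') + (\<Sum>i=1..n-1. norm (u i - u' i))"
  note ext = tuples_extend[OF _ _ n, of _ V]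
  have zero_if_lip: "ystar V h n x u \<in> V n \<and> h n x (u(n := ystar V h n x u)) = 0"
    if u: "u \<in> ?T" and lip: "\<And>x u y y'. \<lbrakk>u \<in> ?T; y \<in> V n; y' \<in> V n\<rbrakk> \<Longrightarrow>
      norm (h n x (u(n := y)) - h n x (u(n := y'))) \<le> L * norm (y - y')" for L x u
  proof -
    have "\<exists>!y. y \<in> V n \<and> h n x (u(n := y)) = 0"
      by (rule strongly_monotone_ex1_zero[OF V _ m(1), where L = L])
        (use u lip range m(2) ext in auto)
    then show ?thesis unfolding ystar_def by (rule theI')
  qed
  have le_residual: "norm (ystar V h n x u - y) \<le> norm (h n x (u(n := y))) / m"
    if "u \<in> ?T" "y \<in> V n" and z: "ystar V h n x u \<in> V n" "h n x (u(n := ystar V h n x u)) = 0" for x u y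
  proof -
    let ?z = "ystar V h n x u"
    have "m * (norm (?z - y))\<^sup>2 \<le> (- h n x (u(n := y))) \<bullet> (?z - y)"
      using m(2)[OF that(1) z(1) that(2), of x] z(2) by simp
    also have "\<dots> \<le> norm (h n x (u(n := y))) * norm (?z - y)"
      using norm_cauchy_schwarz[of "- h n x (u(n := y))" "?z - y"] by simp
    finally have "m * norm (?z - y) \<le> norm (h n x (u(n := y)))"
      by (cases "norm (?z - y) = 0") (auto simp: power2_eq_square)
    then show ?thesis using m(1) by (simp add: field_simps)
  qed
  have combine: ?thesis
    if 1: "\<And>x u y y'. \<lbrakk>u \<in> ?T; y \<in> V n; y' \<in> V n\<rbrakk> \<Longrightarrow>
        norm (h n x (u(n := y)) - h n x (u(n := y'))) \<le> L1 * norm (y - y')"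
    and 2: "\<And>x x' u u'. \<lbrakk>u \<in> ?T; u' \<in> ?T\<rbrakk> \<Longrightarrow>
        norm (ystar V h n x u - ystar V h n x' u') \<le> L2 * ?d x x' u u'"
    and 3: "\<And>u x. u \<in> ?T \<Longrightarrow> ystar V h n x u \<in> V n \<and> h n x (u(n := ystar V h n x u)) = 0"
    for L1 L2
  proof (intro exI[of _ "max L1 L2"] conjI allI ballI)
    show "norm (h n x (u(n := y)) - h n x (u(n := y'))) \<le> max L1 L2 * norm (y - y')"
      if "u \<in> ?T" "y \<in> V n" "y' \<in> V n" for x u y y'
      using 1[OF that, of x] by (rule order_trans) (simp add: mult_right_mono)
    show "norm (ystar V h n x u - ystar V h n x' u') \<le> max L1 L2 * ?d x x' u u'"
      if "u \<in> ?T" "u' \<in> ?T" for x x' u u'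
      using 2[OF that, of x x'] by (rule order_trans) (intro mult_right_mono add_nonneg_nonneg sum_nonneg; simp)
  qed (use 3 in auto)
  show ?thesis
    using reg
  proof
    assume lip: "lipschitz_each_var l V n (h n)"
    have lip1: "norm (h n x (u(n := y)) - h n x (u(n := y'))) \<le> l * norm (y - y')"
      if "u \<in> ?T" "y \<in> V n" "y' \<in> V n" for x u y y'
    proof -
      have "l-lipschitz_on (V n) (\<lambda>z. h n x ((u(n := y))(n := z)))"
        using lip ext[OF that(1,2)] n unfolding lipschitz_each_var_def by (meson atLeastAtMost_iff order_refl)
      from lipschitz_onD[OF this that(2,3)] show ?thesis by (simp add: dist_norm)
    qed
    note zero = zero_if_lip[OF _ lip1]
    have "norm (ystar V h n x u - ystar V h n x' u') \<le> (l / m) * ?d x x' u u'"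
      if "u \<in> ?T" "u' \<in> ?T" for x x' u u'
    proof -
      let ?y = "ystar V h n x' u'"
      have y: "?y \<in> V n" "h n x' (u'(n := ?y)) = 0" using zero[OF that(2)] by auto
      have "norm (h n x (u(n := ?y)) - h n x' (u'(n := ?y)))
          \<le> l * (norm (x - x') + (\<Sum>i=1..n. norm ((u(n := ?y)) i - (u'(n := ?y)) i)))"
        by (rule lipschitz_each_var_joint[OF lip ext[OF that(1) y(1)] ext[OF that(2) y(1)]])
      \<comment> \<open>Both tuples carry the same last component \<open>?y\<close>, so the summand
        for \<open>n\<close> vanishes.\<close>
      also have "(\<Sum>i=1..n. norm ((u(n := ?y)) i - (u'(n := ?y)) i)) = (\<Sum>i=1..n-1. norm (u i - u' i))"
        using n by (intro sum.mono_neutral_cong_right) auto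
      finally have "norm (h n x (u(n := ?y))) \<le> l * ?d x x' u u'" by (simp only: y(2) diff_zero)
      then have "norm (h n x (u(n := ?y))) / m \<le> l * ?d x x' u u' / m"
        using m(1) by (simp add: divide_right_mono)
      with le_residual[OF that(1) y(1), of x] zero[OF that(1), of x] show ?thesis by fastforce
    qed
    from combine[OF lip1 this zero] show ?thesis .
  next
    assume aff: "affine_regular V n (h n) lA lA' lb lb'"
    obtain A :: "'a \<Rightarrow> (nat \<Rightarrow> 'b) \<Rightarrow> 'b \<Rightarrow>\<^sub>L 'b" and b :: "'a \<Rightarrow> (nat \<Rightarrow> 'b) \<Rightarrow> 'b" where
      eq: "\<And>x u y. u \<in> ?T \<Longrightarrow> y \<in> V n \<Longrightarrow> h n x (u(n := y)) = blinfun_apply (A x u) y + b x u"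
      and A: "lipschitz_each_var lA V (n - 1) A" "\<And>x u. u \<in> ?T \<Longrightarrow> norm (A x u) \<le> lA'"
      and b: "lipschitz_each_var lb V (n - 1) b" "\<And>x u. u \<in> ?T \<Longrightarrow> norm (b x u) \<le> lb'"
    proof -
      show thesis
        using aff unfolding affine_regular_def
      proof (elim exE conjE, goal_cases)
        case (1 A b)
        show thesis by (rule that[of A b]) (use 1 in blast)+
      qed
    qed
    have lip1: "norm (h n x (u(n := y)) - h n x (u(n := y'))) \<le> lA' * norm (y - y')"
      if "u \<in> ?T" "y \<in> V n" "y' \<in> V n" for x u y y'
    proof -
      have "h n x (u(n := y)) - h n x (u(n := y')) = blinfun_apply (A x u) (y - y')"
        using that by (simp add: eq blinfun.diff_right)
      then show ?thesis
        using norm_blinfun[of "A x u" "y - y'"] mult_right_mono[OF A(2)[OF that(1), of x] norm_ge_zero[of "y - y'"]]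
        by simp
    qed
    note zero = zero_if_lip[OF _ lip1]
    have "norm (ystar V h n x u - ystar V h n x' u') \<le> ((lA * (lb' / m) + lb) / m) * ?d x x' u u'"
      if "u \<in> ?T" "u' \<in> ?T" for x x' u u'
    proof -
      let ?y = "ystar V h n x' u'"
      have y: "?y \<in> V n" "h n x' (u'(n := ?y)) = 0" using zero[OF that(2)] by auto
      \<comment> \<open>At \<open>y = 0\<close> the affine operator reduces to \<open>b\<close>, so
        the error bound from 0 puts every zero into the ball of radius \<open>lb' / m\<close>. There
        a change of \<open>A\<close> is multiplied by a bounded vector, which makes the zero
        Lipschitz although the operator is not.\<close>
      have "norm (h n x' (u'(n := 0))) = norm (b x' u')"
        using eq[OF that(2) subspace_0[OF V]] by simp
      then have "norm ?y \<le> lb' / m"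
        using le_residual[OF that(2) subspace_0[OF V] y] b(2)[OF that(2), of x'] m(1)
        by (simp add: field_simps)
      moreover have "norm (A x u - A x' u') \<le> lA * ?d x x' u u'"
        by (rule lipschitz_each_var_joint[OF A(1) that])
      ultimately have 1: "norm (A x u - A x' u') * norm ?y \<le> (lA * ?d x x' u u') * (lb' / m)"
        by (intro mult_mono) (auto intro: order_trans[OF norm_ge_zero])
      have 2: "norm (b x u - b x' u') \<le> lb * ?d x x' u u'"
        by (rule lipschitz_each_var_joint[OF b(1) that])
      have "h n x (u(n := ?y)) = h n x (u(n := ?y)) - h n x' (u'(n := ?y))" using y by simp
      also have "\<dots> = blinfun_apply (A x u - A x' u') ?y + (b x u - b x' u')"
        using that y(1) by (simp only: eq blinfun.diff_left) simp
      also have "norm \<dots> \<le> norm (A x u - A x' u') * norm ?y + norm (b x u - b x' u')"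
        by (intro norm_triangle_le add_mono norm_blinfun order_refl)
      also have "\<dots> \<le> (lA * ?d x x' u u') * (lb' / m) + lb * ?d x x' u u'" using 1 2 by linarith
      finally have "norm (h n x (u(n := ?y))) / m \<le> ((lA * ?d x x' u u') * (lb' / m) + lb * ?d x x' u u') / m"
        using m(1) by (simp add: divide_right_mono)
      also have "\<dots> = ((lA * (lb' / m) + lb) / m) * ?d x x' u u'" by (simp add: algebra_simps add_divide_distrib)
      finally show ?thesis
        using le_residual[OF that(1) y(1), of x] zero[OF that(1), of x] by linarith
    qed
    from combine[OF lip1 this zero] show ?thesis .
  qed
qed


lemma regular_operators_exist:
  fixes V :: "nat \<Rightarrow> 'b::euclidean_space set"
    and h :: "nat \<Rightarrow> 'a::euclidean_space \<Rightarrow> (nat \<Rightarrow> 'b) \<Rightarrow> 'b"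
  assumes N: "1 \<le> N"
    and V: "\<forall>n\<in>{1..N}. subspace (V n)"
    and range: "\<forall>n\<in>{1..N}. \<forall>x. \<forall>u\<in>tuples V n. h n x u \<in> V n"
    and mono: "strongly_monotone N V h \<mu>"
    and reg: "\<forall>n\<in>{1..N}. lipschitz_each_var (l n) V n (h n) \<or>
                 affine_regular V n (h n) (lA n) (lA' n) (lb n) (lb' n)"
  shows "\<exists>m L. regular_operators N V h m L"
proof -
  have mono': "\<mu> n * (norm (y - y'))\<^sup>2 \<le> (h n x (u(n := y)) - h n x (u(n := y'))) \<bullet> (y - y')"
    if "n \<in> {1..N}" "u \<in> tuples V (n - 1)" "y \<in> V n" "y' \<in> V n" for n x u y y'
    using mono that unfolding strongly_monotone_def by blast
  have \<mu>0: "0 < \<mu> n" if "n \<in> {1..N}" for n using mono that unfolding strongly_monotone_def by blast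
  have "\<forall>n\<in>{1..N}. \<exists>L. (\<forall>x. \<forall>u\<in>tuples V (n - 1). \<forall>y\<in>V n. \<forall>y'\<in>V n.
            norm (h n x (u(n := y)) - h n x (u(n := y'))) \<le> L * norm (y - y')) \<and>
        (\<forall>x. \<forall>u\<in>tuples V (n - 1). ystar V h n x u \<in> V n \<and> h n x (u(n := ystar V h n x u)) = 0) \<and>
        (\<forall>x x'. \<forall>u\<in>tuples V (n - 1). \<forall>u'\<in>tuples V (n - 1).
            norm (ystar V h n x u - ystar V h n x' u')
              \<le> L * (norm (x - x') + (\<Sum>i=1..n-1. norm (u i - u' i))))"
    (is "\<forall>n\<in>_. \<exists>L. ?P n L")
  proof
    fix n assume n: "n \<in> {1..N}"
    show "\<exists>L. ?P n L"
      by (rule regular_operators_single[where m = "\<mu> n" and l = "l n" and lA = "lA n" and lA' = "lA' n"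
            and lb = "lb n" and lb' = "lb' n"])
        ((rule \<mu>0[OF n] | rule mono'[OF n], assumption+ | use n V range reg in blast | use n in simp)+)
  qed
  from bchoice[OF this] obtain Ln where "\<forall>n\<in>{1..N}. ?P n (Ln n)" by (rule exE)
  note Ln = bspec[OF this]
  \<comment> \<open>The leading 1 yields \<open>1 \<le> L\<close>; the absolute values let the sum
    dominate each of its terms.\<close>
  define L where "L = 1 + (\<Sum>n=1..N. \<bar>Ln n\<bar>)"
  have Ln_le: "Ln n \<le> L" if "n \<in> {1..N}" for n
  proof -
    have "\<bar>Ln n\<bar> \<le> (\<Sum>n=1..N. \<bar>Ln n\<bar>)" by (rule member_le_sum) (use that in auto)
    then show ?thesis by (simp add: L_def)
  qed
  define m where "m = Min (\<mu> ` {1..N})"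
  have m: "0 < m" "\<And>n. n \<in> {1..N} \<Longrightarrow> m \<le> \<mu> n"
    using N \<mu>0 by (auto simp: m_def)
  have "regular_operators N V h m L"
  proof
    show "1 \<le> L" by (simp add: L_def sum_nonneg)
    fix n assume n: "n \<in> {1..N}"
    note P = Ln[OF n]
    show "m * (norm (y - y'))\<^sup>2 \<le> (h n x (u(n := y)) - h n x (u(n := y'))) \<bullet> (y - y')"
      if "u \<in> tuples V (n - 1)" "y \<in> V n" "y' \<in> V n" for x u y y'
      by (rule order_trans[OF _ mono'[OF n that]]) (use m(2)[OF n] in \<open>simp add: mult_right_mono\<close>)
    show "norm (h n x (u(n := y)) - h n x (u(n := y'))) \<le> L * norm (y - y')"
      if "u \<in> tuples V (n - 1)" "y \<in> V n" "y' \<in> V n" for x u y y'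
      by (rule order_trans[OF _ mult_right_mono[OF Ln_le[OF n]]]) (use P that in auto)
    show "norm (ystar V h n x u - ystar V h n x' u')
          \<le> L * (norm (x - x') + (\<Sum>i=1..n-1. norm (u i - u' i)))"
      if "u \<in> tuples V (n - 1)" "u' \<in> tuples V (n - 1)" for x x' u u'
      by (rule order_trans[OF _ mult_right_mono[OF Ln_le[OF n]]])
        (use P that in \<open>auto intro!: add_nonneg_nonneg sum_nonneg simp del: One_nat_def\<close>)
  qed (use V m Ln in auto)
  then show ?thesis by blast
qed

text \<open>A discrete Gronwall argument along the chain: each new term is at most its source plus
  \<open>L\<close> times the partial sum, so passing from \<open>j\<close> to \<open>Suc j\<close>
  multiplies the earlier partial sum by at most \<open>1 + L\<close>.\<close>

lemma triangular_gronwall: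
  fixes a e :: "nat \<Rightarrow> real"
  assumes "\<And>n. n \<in> {1..N} \<Longrightarrow> a n \<le> e n + L * (\<Sum>i=1..n-1. a i)"
    and "\<And>n. n \<in> {1..N} \<Longrightarrow> 0 \<le> e n" and "0 \<le> L" and "j \<le> N"
  shows "(\<Sum>i=1..j. a i) \<le> (1 + L) ^ j * (\<Sum>i=1..j. e i)"
  using \<open>j \<le> N\<close>
proof (induction j)
  case (Suc j)
  have "(\<Sum>i=1..Suc j. a i) \<le> (1 + L) * (\<Sum>i=1..j. a i) + e (Suc j)"
    using assms(1)[of "Suc j"] Suc.prems by (simp add: algebra_simps)
  also have "\<dots> \<le> (1 + L) * ((1 + L) ^ j * (\<Sum>i=1..j. e i)) + (1 + L) ^ Suc j * e (Suc j)"
  proof (intro add_mono mult_left_mono)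
    have "1 * e (Suc j) \<le> (1 + L) ^ Suc j * e (Suc j)"
      by (intro mult_right_mono one_le_power) (use assms Suc.prems in auto)
    then show "e (Suc j) \<le> (1 + L) ^ Suc j * e (Suc j)" by simp
  qed (use assms Suc in auto)
  finally show ?case by (simp add: algebra_simps)
qed simp

section \<open>Residuals and the distance to the joint fixed point\<close>

context regular_operators
begin

text \<open>The distance to the zero of \<open>h n\<close> for the given earlier components, not to
  the joint fixed point; along the iterates it is the quantity in the second claim of the
  theorem.\<close>

definition residual :: "nat \<Rightarrow> 'a \<Rightarrow> (nat \<Rightarrow> 'b) \<Rightarrow> real" where
  "residual n x u = norm (u n - ystar V h n x (restrict u {1..n - 1}))"

lemma residual_nonneg [simp]: "0 \<le> residual n x u"
  by (simp add: residual_def)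

lemma restrict_mem: "u \<in> Pi {1..N} V \<Longrightarrow> n \<le> N \<Longrightarrow> restrict u {1..n} \<in> tuples V n"
  by (rule tuples_restrict) auto

lemma restrict_pred_mem: "u \<in> Pi {1..N} V \<Longrightarrow> n \<in> {1..N} \<Longrightarrow> restrict u {1..n - 1} \<in> tuples V (n - 1)"
  by (rule restrict_mem) auto

lemma ystar_restrict_lipschitz:
  assumes "n \<in> {1..N}" "u \<in> Pi {1..N} V" "u' \<in> Pi {1..N} V"
  shows "norm (ystar V h n x (restrict u {1..n - 1}) - ystar V h n x' (restrict u' {1..n - 1}))
    \<le> L * (norm (x - x') + (\<Sum>i=1..n-1. norm (u i - u' i)))"
  using ystar_lipschitz[OF assms(1) restrict_pred_mem[OF assms(2,1)] restrict_pred_mem[OF assms(3,1)], of x x']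
  by simp

text \<open>Exchanges the point at which \<open>ystar\<close> is taken. With the averaged iterates
  as \<open>x'\<close> and \<open>u'\<close> it bounds the residual by the tracking error plus the
  lags.\<close>

lemma residual_perturb:
  assumes "n \<in> {1..N}" "u \<in> Pi {1..N} V" "u' \<in> Pi {1..N} V"
  shows "residual n x u \<le> norm (u n - ystar V h n x' (restrict u' {1..n - 1}))
    + L * (norm (x - x') + (\<Sum>i=1..n-1. norm (u i - u' i)))"
proof -
  have "residual n x u \<le> norm (u n - ystar V h n x' (restrict u' {1..n - 1}))
    + norm (ystar V h n x (restrict u {1..n - 1}) - ystar V h n x' (restrict u' {1..n - 1}))"
    unfolding residual_def using norm_triangle_ineq4[of "u n - ystar V h n x' (restrict u' {1..n - 1})"
      "ystar V h n x (restrict u {1..n - 1}) - ystar V h n x' (restrict u' {1..n - 1})"] by simp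
  with ystar_restrict_lipschitz[OF assms, of x x'] show ?thesis by linarith
qed

lemma norm_h_le_residual:
  assumes "n \<in> {1..N}" "u \<in> Pi {1..N} V"
  shows "norm (h n x (restrict u {1..n})) \<le> L * residual n x u"
proof -
  let ?u = "restrict u {1..n - 1}"
  note u = restrict_pred_mem[OF assms(2,1)]
  have "u n \<in> V n" using assms by auto
  from h_lipschitz[OF assms(1) u this ystar_mem[OF assms(1) u], of x x]
  have "norm (h n x (?u(n := u n))) \<le> L * residual n x u"
    by (simp only: ystar_zero[OF assms(1) u] diff_zero residual_def)
  moreover have "?u(n := u n) = restrict u {1..n}" using assms(1) by (intro restrict_Suc_tuple) auto
  ultimately show ?thesis by simp
qed

text \<open>Here \<open>e\<close> points to the zero belonging to \<open>x'\<close> and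
  \<open>u'\<close>. Strong monotonicity is applied between \<open>u n\<close> and this displaced
  zero. The operator does not vanish there, but its norm is at most \<open>L\<close> times the
  displacement, and the displacement is at most \<open>L * r\<close>; hence the correction with
  \<open>L\<^sup>2\<close>.\<close>

lemma h_inner_lower:
  fixes x x' :: 'a and u u' :: "nat \<Rightarrow> 'b"
  assumes n: "n \<in> {1..N}" and u: "u \<in> Pi {1..N} V" "u' \<in> Pi {1..N} V"
  defines "e \<equiv> u n - ystar V h n x' (restrict u' {1..n - 1})"
    and "r \<equiv> norm (x - x') + (\<Sum>i=1..n-1. norm (u i - u' i))"
  shows "m * (norm e)\<^sup>2 - L\<^sup>2 * r * norm e \<le> h n x (restrict u {1..n}) \<bullet> e"
proof -
  let ?u = "restrict u {1..n - 1}" and ?u' = "restrict u' {1..n - 1}"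
  let ?z = "ystar V h n x' ?u'"
  note uu = restrict_pred_mem[OF u(1) n] restrict_pred_mem[OF u(2) n]
  have z: "?z \<in> V n" and un: "u n \<in> V n" using ystar_mem[OF n uu(2)] u n by auto
  have "norm (h n x (?u(n := ?z))) = norm (h n x (?u(n := ?z)) - h n x (?u(n := ystar V h n x ?u)))"
    using ystar_zero[OF n uu(1)] by simp
  also have "\<dots> \<le> L * norm (?z - ystar V h n x ?u)"
    by (rule h_lipschitz[OF n uu(1) z ystar_mem[OF n uu(1)]])
  also have "\<dots> \<le> L * (L * r)"
    using ystar_restrict_lipschitz[OF n u, of x x'] L_ge_1
    by (intro mult_left_mono) (auto simp: r_def norm_minus_commute)
  finally have "norm (h n x (?u(n := ?z))) * norm e \<le> L\<^sup>2 * r * norm e"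
    by (intro mult_right_mono) (auto simp: power2_eq_square)
  moreover have "- (norm (h n x (?u(n := ?z))) * norm e) \<le> h n x (?u(n := ?z)) \<bullet> e"
    using Cauchy_Schwarz_ineq2[of "h n x (?u(n := ?z))" e] by linarith
  moreover have "m * (norm e)\<^sup>2 \<le> (h n x (?u(n := u n)) - h n x (?u(n := ?z))) \<bullet> e"
    unfolding e_def by (rule h_monotone[OF n uu(1) un z])
  moreover have "?u(n := u n) = restrict u {1..n}" using n by (intro restrict_Suc_tuple) auto
  ultimately show ?thesis by (simp add: inner_diff_left)
qed

lemma ydiamond_tuple: "n \<le> N \<Longrightarrow> ydiamond V h n x \<in> tuples V n"
proof (induction n)
  case 0
  then show ?case by (simp add: tuples_def)
next
  case (Suc n)
  then have "ystar V h (Suc n) x (ydiamond V h n x) \<in> V (Suc n)"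
    using ystar_mem[of "Suc n"] by simp
  then show ?case
    unfolding ydiamond.simps by (intro tuples_extend) (use Suc in auto)
qed

lemma restrict_ydiamond: "n \<le> j \<Longrightarrow> j \<le> N \<Longrightarrow> restrict (ydiamond V h j x) {1..n} = ydiamond V h n x"
proof (induction j)
  case 0
  then show ?case by auto
next
  case (Suc j)
  show ?case
  proof (cases "n = Suc j")
    case True
    have "ydiamond V h n x \<in> extensional {1..n}"
      using ydiamond_tuple[of n x] Suc.prems by (simp add: tuples_def PiE_iff)
    then show ?thesis using True by (metis extensional_restrict)
  next
    case False
    have "restrict (ydiamond V h (Suc j) x) {1..n} = restrict (ydiamond V h j x) {1..n}"
      using Suc.prems False by (intro restrict_ext) auto
    also have "\<dots> = ydiamond V h n x" by (rule Suc.IH) (use Suc.prems False in auto)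
    finally show ?thesis .
  qed
qed

text \<open>The recursion never changes a component once it is set, so the final tuple solves all
  the fixed-point equations simultaneously.\<close>

lemma ydiamond_eq_ystar:
  assumes "n \<in> {1..N}"
  shows "ydiamond V h N x n = ystar V h n x (restrict (ydiamond V h N x) {1..n - 1})"
proof -
  obtain j where j: "n = Suc j" using assms by (cases n) auto
  have "ydiamond V h N x n = restrict (ydiamond V h N x) {1..n} n" using assms by simp
  also have "\<dots> = ydiamond V h n x n" using assms by (subst restrict_ydiamond) auto
  also have "\<dots> = ystar V h n x (ydiamond V h j x)" by (simp add: j)
  also have "ydiamond V h j x = restrict (ydiamond V h N x) {1..n - 1}"
    using assms j by (subst restrict_ydiamond) auto
  finally show ?thesis .
qed

lemma ydiamond_mem: "ydiamond V h N x \<in> Pi {1..N} V"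
  using ydiamond_tuple[of N x] by (auto simp: tuples_def PiE_iff)

text \<open>Component \<open>n\<close> misses its fixed-point value by its own residual plus the
  effect on \<open>ystar\<close> of the errors in earlier components; the triangular Gronwall
  estimate sums these contributions.\<close>

lemma sum_dist_ydiamond_le:
  assumes u: "u \<in> Pi {1..N} V"
  shows "(\<Sum>n=1..N. norm (u n - ydiamond V h N x n)) \<le> (1 + L) ^ N * (\<Sum>n=1..N. residual n x u)"
proof (rule triangular_gronwall[where N = N])
  fix n assume n: "n \<in> {1..N}"
  let ?D = "ydiamond V h N x"
  have "norm (u n - ?D n) \<le> residual n x u
      + norm (ystar V h n x (restrict u {1..n - 1}) - ystar V h n x (restrict ?D {1..n - 1}))"
    unfolding residual_def ydiamond_eq_ystar[OF n]
    using norm_triangle_ineq[of "u n - ystar V h n x (restrict u {1..n - 1})"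
        "ystar V h n x (restrict u {1..n - 1}) - ystar V h n x (restrict ?D {1..n - 1})"] by simp
  with ystar_restrict_lipschitz[OF n u ydiamond_mem, of x x x]
  show "norm (u n - ?D n) \<le> residual n x u + L * (\<Sum>i=1..n-1. norm (u i - ?D i))" by simp
qed (use L_ge_1 in auto)

text \<open>The fixed point at \<open>x\<close> serves as a trial tuple at \<open>x'\<close>. Only
  the change of \<open>x\<close> contributes to its residuals, and
  \<open>sum_dist_ydiamond_le\<close> converts them into a distance to the fixed point at
  \<open>x'\<close>.\<close>

lemma sum_ydiamond_lipschitz:
  "(\<Sum>n=1..N. norm (ydiamond V h N x n - ydiamond V h N x' n)) \<le> (1 + L) ^ N * (N * L) * norm (x - x')"
proof -
  let ?u = "ydiamond V h N x"
  have "residual n x' ?u \<le> L * norm (x - x')" if n: "n \<in> {1..N}" for n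
    using residual_perturb[OF n ydiamond_mem ydiamond_mem, of x' x x x]
    by (simp add: ydiamond_eq_ystar[OF n, symmetric] norm_minus_commute del: One_nat_def)
  then have "(\<Sum>n=1..N. residual n x' ?u) \<le> (\<Sum>n=1..N. L * norm (x - x'))"
    by (intro sum_mono)
  then have "(\<Sum>n=1..N. residual n x' ?u) \<le> (N * L) * norm (x - x')" by simp
  then have "(1 + L) ^ N * (\<Sum>n=1..N. residual n x' ?u) \<le> (1 + L) ^ N * ((N * L) * norm (x - x'))"
    using L_ge_1 by (intro mult_left_mono) auto
  moreover have "(\<Sum>n=1..N. norm (?u n - ydiamond V h N x' n)) \<le> (1 + L) ^ N * (\<Sum>n=1..N. residual n x' ?u)"
    by (rule sum_dist_ydiamond_le[OF ydiamond_mem])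
  ultimately show ?thesis by (simp add: mult.assoc)
qed

end

section \<open>The gradient of the outer objective and the bias of the drift\<close>

locale mssa_problem = regular_operators N V h m L
  for N and V :: "nat \<Rightarrow> 'b::euclidean_space set"
    and h :: "nat \<Rightarrow> 'a::euclidean_space \<Rightarrow> (nat \<Rightarrow> 'b) \<Rightarrow> 'b" and m L +
  fixes v :: "'a \<Rightarrow> (nat \<Rightarrow> 'b) \<Rightarrow> 'a" and \<Phi> :: "'a \<Rightarrow> real" and l0 C_F :: real
  assumes l0: "0 < l0" and v_lipschitz: "main_lipschitz N V v h l0"
    and \<Phi>_bound: "C_F \<le> \<Phi> x" and \<Phi>_grad: "GDERIV \<Phi> x :> v x (ydiamond V h N x)"
begin

abbreviation grad :: "'a \<Rightarrow> 'a" where "grad x \<equiv> v x (ydiamond V h N x)"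

definition grad_lip :: real where "grad_lip = l0 * (1 + (1 + L) ^ N * (N * L))"

lemma grad_lip_nonneg: "0 \<le> grad_lip"
  using l0 L_ge_1 by (simp add: grad_lip_def)

text \<open>\<open>main_lipschitz\<close> compares the drift at a fixed point with the drift at an
  arbitrary tuple; the tuple chosen is the fixed point at \<open>x'\<close>, whose distance to the
  one at \<open>x\<close> is known.\<close>

lemma grad_lipschitz: "norm (grad x - grad x') \<le> grad_lip * norm (x - x')"
proof -
  have "norm (grad x - grad x') \<le> l0 * (norm (x - x') +
      (\<Sum>n=1..N. norm (ydiamond V h N x' n - ydiamond V h N x n)))"
    using v_lipschitz ydiamond_tuple[of N x'] by (simp add: main_lipschitz_def)
  also have "\<dots> \<le> l0 * (norm (x - x') + (1 + L) ^ N * (N * L) * norm (x - x'))"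
    using l0 sum_ydiamond_lipschitz[of x' x] by (intro mult_left_mono add_left_mono) (auto simp: norm_minus_commute)
  finally show ?thesis by (simp add: grad_lip_def algebra_simps)
qed

lemma drift_error:
  assumes "u \<in> Pi {1..N} V"
  shows "norm (v x (restrict u {1..N}) - grad x) \<le> l0 * (1 + L) ^ N * (\<Sum>n=1..N. residual n x u)"
proof -
  have "norm (grad x - v x (restrict u {1..N})) \<le> l0 * (norm (x - x) +
      (\<Sum>n=1..N. norm (restrict u {1..N} n - ydiamond V h N x n)))"
    using v_lipschitz restrict_mem[OF assms order_refl] unfolding main_lipschitz_def by blast
  also have "\<dots> = l0 * (\<Sum>n=1..N. norm (u n - ydiamond V h N x n))" by simp
  also have "\<dots> \<le> l0 * ((1 + L) ^ N * (\<Sum>n=1..N. residual n x u))"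
    using l0 sum_dist_ydiamond_le[OF assms] by (intro mult_left_mono) auto
  finally show ?thesis by (simp add: norm_minus_commute mult.assoc)
qed

text \<open>The mean value theorem on the segment, combined with the Lipschitz gradient. Taking the
  gradient at one intermediate point instead of integrating along the segment gives
  \<open>grad_lip\<close> in place of the usual half of it. The upper bound yields descent; the
  two-sided form yields quadratic growth of \<Phi>, hence integrability.\<close>

lemma \<Phi>_taylor: "\<bar>\<Phi> x' - \<Phi> x - grad x \<bullet> (x' - x)\<bar> \<le> grad_lip * (norm (x' - x))\<^sup>2"
proof -
  let ?\<phi> = "\<lambda>t. \<Phi> (x + t *\<^sub>R (x' - x))"
  have "(?\<phi> has_derivative (\<lambda>s. s * ((x' - x) \<bullet> grad (x + t *\<^sub>R (x' - x))))) (at t within {0..1})" for t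
  proof -
    have 1: "(\<Phi> has_derivative (\<lambda>d. d \<bullet> grad (x + t *\<^sub>R (x' - x)))) (at (x + t *\<^sub>R (x' - x)))"
      using \<Phi>_grad by (simp add: gderiv_def)
    have 2: "((\<lambda>t. x + t *\<^sub>R (x' - x)) has_derivative (\<lambda>s. s *\<^sub>R (x' - x))) (at t within {0..1})"
      by (auto intro!: derivative_eq_intros)
    from has_derivative_compose[OF 2 1] show ?thesis by simp
  qed
  then have "\<exists>t\<in>{0<..<1}. ?\<phi> 1 - ?\<phi> 0 = (1 - 0) * ((x' - x) \<bullet> grad (x + t *\<^sub>R (x' - x)))"
    by (intro mvt_simple) auto
  then obtain t where t: "0 < t" "t < 1" "\<Phi> x' - \<Phi> x = (x' - x) \<bullet> grad (x + t *\<^sub>R (x' - x))" by auto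
  then have "\<bar>\<Phi> x' - \<Phi> x - grad x \<bullet> (x' - x)\<bar> = \<bar>(x' - x) \<bullet> (grad (x + t *\<^sub>R (x' - x)) - grad x)\<bar>"
    by (simp add: inner_diff_right inner_commute)
  also have "\<dots> \<le> norm (x' - x) * norm (grad (x + t *\<^sub>R (x' - x)) - grad x)"
    by (rule Cauchy_Schwarz_ineq2)
  also have "\<dots> \<le> norm (x' - x) * (grad_lip * norm (x' - x))"
  proof (intro mult_left_mono norm_ge_zero)
    have "norm (grad (x + t *\<^sub>R (x' - x)) - grad x) \<le> grad_lip * norm (t *\<^sub>R (x' - x))"
      using grad_lipschitz[of "x + t *\<^sub>R (x' - x)" x] by simp
    also have "\<dots> \<le> grad_lip * norm (x' - x)"
      using t grad_lip_nonneg by (intro mult_left_mono) (auto intro!: mult_left_le_one_le)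
    finally show "norm (grad (x + t *\<^sub>R (x' - x)) - grad x) \<le> grad_lip * norm (x' - x)" .
  qed
  finally show ?thesis by (simp add: power2_eq_square mult_ac)
qed

end

subsection \<open>The coupled recursion\<close>

text \<open>The left-hand side bounds one step of the tracking error: \<open>e\<close> is its norm, \<open>r\<close> the sum of the
  norms of the lags, and \<open>L * e + L\<^sup>2 * r\<close> a bound for the norm of \<open>h\<close>.\<close>

definition absorbing :: "real \<Rightarrow> real \<Rightarrow> real \<Rightarrow> real \<Rightarrow> real \<Rightarrow> real \<Rightarrow> real \<Rightarrow> bool" where
  "absorbing b B m L \<omega> c \<epsilon>0 \<longleftrightarrow>
    (\<forall>\<epsilon> \<beta> e r. 0 < \<epsilon> \<and> \<epsilon> \<le> \<epsilon>0 \<and> b * \<epsilon> \<le> \<beta> \<and> \<beta> \<le> B * \<epsilon> \<and> 0 \<le> e \<and> 0 \<le> r \<longrightarrow>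
      e\<^sup>2 + 2 * L * \<epsilon> * r * e - 2 * \<beta> * m * e\<^sup>2 + 2 * \<beta> * L\<^sup>2 * r * e
        + (L * \<epsilon> * r + \<beta> * (L * e + L\<^sup>2 * r))\<^sup>2 + \<beta>\<^sup>2 * (1 + 2 * \<omega>) * (L * e + L\<^sup>2 * r)\<^sup>2
      \<le> (1 - b * m * \<epsilon>) * e\<^sup>2 + c * \<epsilon> * r\<^sup>2)"

text \<open>The contraction contributes \<open>- 2 * b * m * \<epsilon> * e\<^sup>2\<close>. Half of
  it is kept, a quarter pays for the cross terms in \<open>r * e\<close> by Young's inequality, and
  a quarter pays for the second-order terms in \<open>e\<close>, which requires
  \<open>\<epsilon>\<close> to be small.\<close>

lemma absorbing_exists:
  fixes b B m L \<omega> :: real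
  assumes "0 < b" "0 < B" "0 < m" "0 < L" "0 < \<omega>"
  shows "\<exists>c>0. \<exists>\<epsilon>0>0. absorbing b B m L \<omega> c \<epsilon>0"
proof -
  \<comment> \<open>\<open>c2\<close> collects the cross terms in \<open>r * e\<close> per unit of
    \<open>\<epsilon>\<close>; \<open>p\<close> and \<open>s\<close> are such that
    \<open>\<epsilon> * (p * e + s * r)\<close> dominates both expressions to be squared;
    \<open>d\<close> is the contraction rate.\<close>
  define c2 where "c2 = 2 * L + 2 * B * L\<^sup>2"
  define p where "p = B * L"
  define s where "s = L + B * L\<^sup>2"
  define d where "d = b * m"
  have pos: "0 < c2" "0 < p" "0 < s" "0 < d" using assms by (auto simp: c2_def p_def s_def d_def add_pos_pos)
  define c where "c = c2\<^sup>2 / (2 * d) + (4 + 4 * \<omega>) * s\<^sup>2"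
  \<comment> \<open>The two squares have weights 1 and \<open>1 + 2 * \<omega>\<close>, and squaring
    a sum of two terms doubles them: this is the factor \<open>4 + 4 * \<omega>\<close>. The bound 1
    is what reduces \<open>\<epsilon>\<^sup>2 * r\<^sup>2\<close> to
    \<open>\<epsilon> * r\<^sup>2\<close>.\<close>
  define \<epsilon>0 where "\<epsilon>0 = min 1 (d / (2 * ((4 + 4 * \<omega>) * p\<^sup>2)))"
  have c: "0 < c" using pos assms by (auto simp: c_def intro!: add_pos_pos)
  have \<epsilon>0: "0 < \<epsilon>0" using pos assms by (auto simp: \<epsilon>0_def)
  show ?thesis
    unfolding absorbing_def
  proof (rule exI[of _ c], intro conjI c, rule exI[of _ \<epsilon>0], intro conjI \<epsilon>0 allI impI)
    fix \<epsilon> \<beta> e r :: real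
    assume "0 < \<epsilon> \<and> \<epsilon> \<le> \<epsilon>0 \<and> b * \<epsilon> \<le> \<beta> \<and> \<beta> \<le> B * \<epsilon> \<and> 0 \<le> e \<and> 0 \<le> r"
    then have h: "0 < \<epsilon>" "\<epsilon> \<le> \<epsilon>0" "b * \<epsilon> \<le> \<beta>" "\<beta> \<le> B * \<epsilon>" "0 \<le> e" "0 \<le> r" by auto
    have \<beta>: "0 \<le> \<beta>" using h assms by (meson less_imp_le mult_nonneg_nonneg order_trans)
    have q: "0 \<le> L * e + L\<^sup>2 * r" using assms h by auto
    have q1: "\<beta> * (L * e + L\<^sup>2 * r) \<le> B * \<epsilon> * (L * e + L\<^sup>2 * r)"
      using h q by (intro mult_right_mono) auto
    also have "\<dots> \<le> \<epsilon> * (p * e + s * r)"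
      using h assms by (simp add: p_def s_def algebra_simps)
    finally have q2: "\<beta> * (L * e + L\<^sup>2 * r) \<le> \<epsilon> * (p * e + s * r)" .
    have q3: "L * \<epsilon> * r + \<beta> * (L * e + L\<^sup>2 * r) \<le> \<epsilon> * (p * e + s * r)"
      using q1 by (simp add: p_def s_def algebra_simps)
    have sq: "(\<epsilon> * (p * e + s * r))\<^sup>2 \<le> \<epsilon>\<^sup>2 * (2 * p\<^sup>2 * e\<^sup>2 + 2 * s\<^sup>2 * r\<^sup>2)"
    proof -
      have "(p * e + s * r)\<^sup>2 \<le> 2 * p\<^sup>2 * e\<^sup>2 + 2 * s\<^sup>2 * r\<^sup>2"
        using sum_squares_bound[of "p * e" "s * r"] unfolding power2_sum power_mult_distrib by linarith
      then show ?thesis by (simp add: power_mult_distrib mult_left_mono)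
    qed
    have t1: "(L * \<epsilon> * r + \<beta> * (L * e + L\<^sup>2 * r))\<^sup>2 \<le> \<epsilon>\<^sup>2 * (2 * p\<^sup>2 * e\<^sup>2 + 2 * s\<^sup>2 * r\<^sup>2)"
      by (rule order_trans[OF power_mono[OF q3] sq]) (use h \<beta> q assms in auto)
    have t2: "(\<beta> * (L * e + L\<^sup>2 * r))\<^sup>2 \<le> \<epsilon>\<^sup>2 * (2 * p\<^sup>2 * e\<^sup>2 + 2 * s\<^sup>2 * r\<^sup>2)"
      by (rule order_trans[OF power_mono[OF q2] sq]) (use h \<beta> q assms in auto)
    have t2': "\<beta>\<^sup>2 * (1 + 2 * \<omega>) * (L * e + L\<^sup>2 * r)\<^sup>2 \<le> (1 + 2 * \<omega>) * (\<epsilon>\<^sup>2 * (2 * p\<^sup>2 * e\<^sup>2 + 2 * s\<^sup>2 * r\<^sup>2))"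
      using mult_left_mono[OF t2, of "1 + 2 * \<omega>"] assms by (simp add: power_mult_distrib mult_ac)
    have t3: "b * \<epsilon> * (m * e\<^sup>2) \<le> \<beta> * (m * e\<^sup>2)" using h assms by (intro mult_right_mono) auto
    have t4: "\<beta> * (2 * L\<^sup>2 * r * e) \<le> B * \<epsilon> * (2 * L\<^sup>2 * r * e)" using h assms by (intro mult_right_mono) auto
    have "c2 * r * e \<le> d / 2 * e\<^sup>2 + c2\<^sup>2 / (2 * d) * r\<^sup>2"
    proof -
      have "0 \<le> (d * e - c2 * r)\<^sup>2 / (2 * d)" using pos by simp
      also have "\<dots> = d / 2 * e\<^sup>2 + c2\<^sup>2 / (2 * d) * r\<^sup>2 - c2 * r * e"
        using pos by (simp add: power2_eq_square field_simps)
      finally show ?thesis by simp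
    qed
    then have t5: "\<epsilon> * (c2 * r * e) \<le> \<epsilon> * (d / 2 * e\<^sup>2 + c2\<^sup>2 / (2 * d) * r\<^sup>2)"
      using h by (intro mult_left_mono) auto
    have "\<epsilon> * ((4 + 4 * \<omega>) * p\<^sup>2) \<le> d / 2"
    proof -
      have "\<epsilon> \<le> d / (2 * ((4 + 4 * \<omega>) * p\<^sup>2))" using h by (simp add: \<epsilon>0_def)
      moreover have "0 < (4 + 4 * \<omega>) * p\<^sup>2" using pos assms by simp
      ultimately show ?thesis by (simp add: pos_le_divide_eq field_simps)
    qed
    then have t6: "\<epsilon> * e\<^sup>2 * (\<epsilon> * ((4 + 4 * \<omega>) * p\<^sup>2)) \<le> \<epsilon> * e\<^sup>2 * (d / 2)"
      using h by (intro mult_left_mono) auto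
    have "\<epsilon> \<le> 1" using h by (simp add: \<epsilon>0_def)
    then have t7: "\<epsilon> * (\<epsilon> * ((4 + 4 * \<omega>) * s\<^sup>2 * r\<^sup>2)) \<le> 1 * (\<epsilon> * ((4 + 4 * \<omega>) * s\<^sup>2 * r\<^sup>2))"
      using h assms by (intro mult_right_mono) auto
    have "e\<^sup>2 + 2 * L * \<epsilon> * r * e - 2 * \<beta> * m * e\<^sup>2 + 2 * \<beta> * L\<^sup>2 * r * e
      + (L * \<epsilon> * r + \<beta> * (L * e + L\<^sup>2 * r))\<^sup>2 + \<beta>\<^sup>2 * (1 + 2 * \<omega>) * (L * e + L\<^sup>2 * r)\<^sup>2
      \<le> e\<^sup>2 - 2 * (b * \<epsilon> * (m * e\<^sup>2)) + \<epsilon> * (c2 * r * e)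
        + (2 + 2 * \<omega>) * (\<epsilon>\<^sup>2 * (2 * p\<^sup>2 * e\<^sup>2 + 2 * s\<^sup>2 * r\<^sup>2))"
      using t1 t2' t3 t4 by (simp add: c2_def algebra_simps)
    also have "\<dots> = e\<^sup>2 - 2 * d * \<epsilon> * e\<^sup>2 + \<epsilon> * (c2 * r * e)
        + \<epsilon> * e\<^sup>2 * (\<epsilon> * ((4 + 4 * \<omega>) * p\<^sup>2)) + \<epsilon> * (\<epsilon> * ((4 + 4 * \<omega>) * s\<^sup>2 * r\<^sup>2))"
      by (simp add: d_def algebra_simps power2_eq_square)
    also have "\<dots> \<le> e\<^sup>2 - 2 * d * \<epsilon> * e\<^sup>2 + \<epsilon> * (d / 2 * e\<^sup>2 + c2\<^sup>2 / (2 * d) * r\<^sup>2)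
        + \<epsilon> * e\<^sup>2 * (d / 2) + \<epsilon> * ((4 + 4 * \<omega>) * s\<^sup>2 * r\<^sup>2)"
      using t5 t6 t7 by linarith
    also have "\<dots> = (1 - b * m * \<epsilon>) * e\<^sup>2 + c * \<epsilon> * r\<^sup>2"
      by (simp add: c_def d_def algebra_simps)
    finally show "e\<^sup>2 + 2 * L * \<epsilon> * r * e - 2 * \<beta> * m * e\<^sup>2 + 2 * \<beta> * L\<^sup>2 * r * e
      + (L * \<epsilon> * r + \<beta> * (L * e + L\<^sup>2 * r))\<^sup>2 + \<beta>\<^sup>2 * (1 + 2 * \<omega>) * (L * e + L\<^sup>2 * r)\<^sup>2
      \<le> (1 - b * m * \<epsilon>) * e\<^sup>2 + c * \<epsilon> * r\<^sup>2" .
  qed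
qed

text \<open>In closed form, the sum of \<open>(1 + q) ^ (j - n) * T n\<close> over \<open>n\<close>
  from 1 to \<open>j\<close>. The recursive form fits the induction over the number of
  sequences.\<close>

primrec cascade :: "real \<Rightarrow> (nat \<Rightarrow> real) \<Rightarrow> nat \<Rightarrow> real" where
  "cascade q T 0 = 0"
| "cascade q T (Suc j) = (1 + q) * cascade q T j + T (Suc j)"

lemma cascade_bounds:
  assumes "0 \<le> q" "\<And>n. n \<in> {1..j} \<Longrightarrow> 0 \<le> T n"
  shows "0 \<le> cascade q T j" "cascade q T j \<le> (1 + q) ^ j * (\<Sum>n=1..j. T n)"
proof -
  have "0 \<le> cascade q T j \<and> cascade q T j \<le> (1 + q) ^ j * (\<Sum>n=1..j. T n)"
    using assms(2)
  proof (induction j)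
    case (Suc j)
    then have IH: "0 \<le> cascade q T j" "cascade q T j \<le> (1 + q) ^ j * (\<Sum>n=1..j. T n)"
      and T: "0 \<le> T (Suc j)" by auto
    have "1 * T (Suc j) \<le> (1 + q) ^ Suc j * T (Suc j)"
      using T assms(1) by (intro mult_right_mono one_le_power) auto
    moreover have "(1 + q) * cascade q T j \<le> (1 + q) * ((1 + q) ^ j * (\<Sum>n=1..j. T n))"
      using IH assms(1) by (intro mult_left_mono) auto
    ultimately show ?case using IH T assms(1) by (simp add: algebra_simps)
  qed simp
  then show "0 \<le> cascade q T j" "cascade q T j \<le> (1 + q) ^ j * (\<Sum>n=1..j. T n)" by auto
qed

text \<open>The weights grow geometrically towards the first sequence, so that the decrease of \<open>T i\<close>
  pays for its appearance as a disturbance in every later \<open>T n\<close>.\<close>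

lemma cascade_decrease:
  fixes T T' e d :: "nat \<Rightarrow> real"
  assumes "0 \<le> q" "0 \<le> \<epsilon>" and "\<And>n. n \<in> {1..j} \<Longrightarrow> 0 \<le> e n"
    and "\<And>n. n \<in> {1..j} \<Longrightarrow>
      T' n \<le> T n - \<epsilon> * (e n + d n) + q * \<epsilon> * (D + (\<Sum>i=1..n-1. d i)) + q * \<epsilon>\<^sup>2"
  shows "cascade q T' j \<le> cascade q T j - \<epsilon> * (\<Sum>n=1..j. e n + d n) + ((1 + q) ^ j - 1) * (\<epsilon> * D + \<epsilon>\<^sup>2)"
  using assms(3,4)
proof (induction j)
  case (Suc j)
  have IH: "cascade q T' j \<le> cascade q T j - \<epsilon> * (\<Sum>n=1..j. e n + d n) + ((1 + q) ^ j - 1) * (\<epsilon> * D + \<epsilon>\<^sup>2)"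
    using Suc by auto
  have "(1 + q) * cascade q T' j
      \<le> (1 + q) * (cascade q T j - \<epsilon> * (\<Sum>n=1..j. e n + d n) + ((1 + q) ^ j - 1) * (\<epsilon> * D + \<epsilon>\<^sup>2))"
    using IH assms(1) by (intro mult_left_mono) auto
  moreover have "T' (Suc j) \<le> T (Suc j) - \<epsilon> * (e (Suc j) + d (Suc j))
      + q * \<epsilon> * (D + (\<Sum>i=1..j. d i)) + q * \<epsilon>\<^sup>2"
    using Suc.prems(2)[of "Suc j"] by simp
  \<comment> \<open>Multiplying the earlier part by \<open>1 + q\<close> releases the additional
    decrease on the right, which covers the disturbance of the new term by the earlier
    \<open>d i\<close>. The coefficient of the remainder follows from (1 + q) ((1 + q)^j - 1) + q =
    (1 + q)^(j+1) - 1.\<close>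
  moreover have "q * \<epsilon> * (\<Sum>i=1..j. d i) \<le> q * \<epsilon> * (\<Sum>n=1..j. e n + d n)"
    using assms(1,2) Suc.prems(1) by (intro mult_left_mono sum_mono) auto
  ultimately show ?case by (simp add: algebra_simps)
qed simp

text \<open>\<open>D\<close> and \<open>d n\<close> stand for the second moments of the lags of \<open>x\<close> and \<open>y\<^sub>n\<close>, \<open>e n\<close> for that of the
  tracking error, \<open>G\<close> for that of the gradient and \<open>P\<close> for the mean of \<open>\<Phi>\<close>.\<close>

definition telescoping :: "nat \<Rightarrow> real \<Rightarrow> real \<Rightarrow> real \<Rightarrow> real \<Rightarrow> bool" where
  "telescoping N a C \<rho> C' \<longleftrightarrow> (\<forall>(\<epsilon>::real) \<alpha> K D d e G P.
    0 < \<epsilon> \<and> (\<forall>k\<le>K. 0 < \<alpha> k \<and> \<alpha> k \<le> \<rho> * \<epsilon>) \<and>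
    (\<forall>k\<le>Suc K. 0 \<le> D k \<and> 0 \<le> G k \<and> (\<forall>n\<in>{1..N}. 0 \<le> d n k \<and> 0 \<le> e n k)) \<and>
    (\<forall>k\<le>K. \<forall>n\<in>{1..N}. e n (Suc k)
        \<le> (1 - a * \<epsilon>) * e n k + C * \<epsilon> * (D k + (\<Sum>i=1..n-1. d i k)) + C * \<epsilon>\<^sup>2) \<and>
    (\<forall>k\<le>K. \<forall>n\<in>{1..N}. d n (Suc k)
        \<le> (1 - \<epsilon>) * d n k + C * \<epsilon> * (e n k + (D k + (\<Sum>i=1..n-1. d i k))) + C * \<epsilon>\<^sup>2) \<and>
    (\<forall>k\<le>K. D (Suc k) \<le> (1 - \<epsilon>) * D k
        + C * ((\<alpha> k)\<^sup>2 / \<epsilon>) * (G k + (D k + (\<Sum>n=1..N. e n k + d n k))) + C * \<epsilon>\<^sup>2) \<and>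
    (\<forall>k\<le>K. P (Suc k) \<le> P k - \<alpha> k / 4 * G k
        + C * \<epsilon> * (D k + (\<Sum>n=1..N. e n k + d n k)) + C * \<epsilon>\<^sup>2)
    \<longrightarrow> (\<Sum>k\<le>K. \<alpha> k / 8 * G k + \<epsilon> * (D k + (\<Sum>n=1..N. e n k + d n k)))
      \<le> P 0 - P (Suc K) + C' * (D 0 + (\<Sum>n=1..N. e n 0 + d n 0)) + C' * ((real K + 1) * \<epsilon>\<^sup>2))"

text \<open>The Lyapunov function is \<open>P k + \<kappa> * U k\<close>, where \<open>U k\<close>
  adds the weighted lag of \<open>x\<close> to the cascade of \<open>R * e n k + d n k\<close>. The
  errors decrease by more than they disturb \<open>P\<close>, and the gradient disturbs
  \<open>\<kappa> * U\<close> by at most half of the decrease \<open>\<alpha> k / 4 * G k\<close>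
  available in \<open>P\<close>.\<close>

lemma telescoping_exists:
  assumes a: "0 < a" and C: "1 \<le> C"
  shows "\<exists>\<rho>>0. \<rho> \<le> 1 \<and> (\<exists>C'\<ge>0. telescoping N a C \<rho> C')"
proof -
  \<comment> \<open>Each weight is dictated by the decrease it must leave.
    \<open>R * a = C + 1\<close> keeps a unit decrease of \<open>e\<close> after its disturbance of
    \<open>d\<close> with coefficient \<open>C\<close>; \<open>q\<close> is the resulting
    disturbance coefficient of \<open>R * e + d\<close>; \<open>c + 1\<close> exceeds by one the
    coefficient with which \<open>D\<close> disturbs the cascade; \<open>\<kappa>\<close> outweighs
    the \<open>C\<close> in the recursion of \<open>P\<close>; \<open>\<rho>\<close> reduces the
    return of gradient and errors to one eighth.\<close>
  define R where "R = (C + 1) / a"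
  define q where "q = C + R * C"
  define c where "c = (1 + q) ^ N - 1"
  define \<kappa> where "\<kappa> = 2 * (C + 1)"
  define c1 where "c1 = (c + 1) * C"
  define \<rho> where "\<rho> = 1 / (1 + 8 * \<kappa> * c1)"
  define C' where "C' = max (\<kappa> * (c + 1) * (1 + R)) (C + \<kappa> * (c1 + c))"
  have R: "0 < R" using a C by (simp add: R_def)
  have q: "0 < q" using R C by (simp add: q_def add_pos_pos)
  have c: "0 \<le> c" using q by (simp add: c_def one_le_power)
  have \<kappa>: "4 \<le> \<kappa>" and c1: "1 \<le> c1" using C c by (auto simp: \<kappa>_def c1_def intro: order_trans[OF _ mult_mono[of 1 _ 1]])
  have \<kappa>c1: "0 < \<kappa> * c1" using \<kappa> c1 by simp
  have \<rho>: "0 < \<rho>" "\<rho> \<le> 1" "\<kappa> * c1 * \<rho> \<le> 1 / 8"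
    using \<kappa>c1 by (auto simp: \<rho>_def field_simps)
  have C': "0 \<le> C'" using C \<kappa> c c1 by (auto simp: C'_def le_max_iff_disj)
  show ?thesis
    unfolding telescoping_def
  proof (rule exI[of _ \<rho>], intro conjI \<rho>, rule exI[of _ C'], intro conjI C' allI impI, elim conjE, goal_cases)
    case (1 \<epsilon> \<alpha> K D d e G P)
    note \<epsilon> = 1(1) and \<alpha> = 1(2)[rule_format] and nonneg = 1(3)[rule_format]
      and e_rec = 1(4)[rule_format] and d_rec = 1(5)[rule_format]
      and D_rec = 1(6)[rule_format] and P_rec = 1(7)[rule_format]
    define Z where "Z k = D k + (\<Sum>n=1..N. e n k + d n k)" for k
    define T where "T k n = R * e n k + d n k" for k n
    define U where "U k = (c + 1) * D k + cascade q (T k) N" for k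
    have Z0: "0 \<le> Z k" if "k \<le> Suc K" for k
      using nonneg that unfolding Z_def by (intro add_nonneg_nonneg sum_nonneg) auto
    have T0: "0 \<le> T k n" if "k \<le> Suc K" "n \<in> {1..N}" for k n
      using nonneg that R by (simp add: T_def)
    have U0: "0 \<le> U k" if "k \<le> Suc K" for k
      unfolding U_def using c nonneg that q T0 by (intro add_nonneg_nonneg cascade_bounds mult_nonneg_nonneg) auto
    have step: "P (Suc k) + \<kappa> * U (Suc k) \<le> P k + \<kappa> * U k - (\<alpha> k / 8 * G k + \<epsilon> * Z k) + C' * \<epsilon>\<^sup>2"
      if k: "k \<le> K" for k
    proof -
      have T_step: "T (Suc k) n \<le> T k n - \<epsilon> * (e n k + d n k) + q * \<epsilon> * (D k + (\<Sum>i=1..n-1. d i k)) + q * \<epsilon>\<^sup>2"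
        if n: "n \<in> {1..N}" for n
      proof -
        have "R * e n (Suc k) \<le> R * ((1 - a * \<epsilon>) * e n k + C * \<epsilon> * (D k + (\<Sum>i=1..n-1. d i k)) + C * \<epsilon>\<^sup>2)"
          using R e_rec[OF k n] by (intro mult_left_mono) auto
        moreover have "R * ((1 - a * \<epsilon>) * e n k) = R * e n k - (C + 1) * \<epsilon> * e n k"
          using a by (simp add: R_def field_simps)
        ultimately show ?thesis using d_rec[OF k n] by (simp add: T_def q_def algebra_simps)
      qed
      have "cascade q (T (Suc k)) N \<le> cascade q (T k) N - \<epsilon> * (\<Sum>n=1..N. e n k + d n k)
          + ((1 + q) ^ N - 1) * (\<epsilon> * D k + \<epsilon>\<^sup>2)"
        by (rule cascade_decrease) (use q \<epsilon> nonneg k T_step in auto)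
      then have W: "cascade q (T (Suc k)) N \<le> cascade q (T k) N - \<epsilon> * (\<Sum>n=1..N. e n k + d n k)
          + c * (\<epsilon> * D k + \<epsilon>\<^sup>2)" by (simp add: c_def)
      have \<alpha>k: "0 < \<alpha> k" "\<alpha> k \<le> \<rho> * \<epsilon>" using \<alpha>[OF k] by auto
      \<comment> \<open>One factor is bounded in two ways: by \<open>\<rho> * \<alpha> k\<close> for
        the gradient, whose decrease is proportional to \<open>\<alpha> k\<close>, and by
        \<open>\<rho> * \<epsilon>\<close> for the errors, whose decrease is proportional to
        \<open>\<epsilon>\<close>.\<close>
      have "(\<alpha> k)\<^sup>2 / \<epsilon> = \<alpha> k * (\<alpha> k / \<epsilon>)" by (simp add: power2_eq_square)
      also have "\<dots> \<le> \<alpha> k * \<rho>" using \<alpha>k \<epsilon> by (intro mult_left_mono) (auto simp: divide_le_eq)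
      finally have r1: "(\<alpha> k)\<^sup>2 / \<epsilon> \<le> \<rho> * \<alpha> k" by (simp add: mult.commute)
      have "\<rho> * \<alpha> k \<le> \<rho> * (1 * \<epsilon>)"
        using \<alpha>k \<rho> \<epsilon> by (intro mult_left_mono order_trans[OF \<alpha>k(2)] mult_right_mono) auto
      with r1 have r2: "(\<alpha> k)\<^sup>2 / \<epsilon> \<le> \<rho> * \<epsilon>" by simp
      have "(\<alpha> k)\<^sup>2 / \<epsilon> * (G k + Z k) = (\<alpha> k)\<^sup>2 / \<epsilon> * G k + (\<alpha> k)\<^sup>2 / \<epsilon> * Z k" by (rule distrib_left)
      also have "\<dots> \<le> \<rho> * \<alpha> k * G k + \<rho> * \<epsilon> * Z k"
        using r1 r2 nonneg[of k] Z0[of k] k by (intro add_mono mult_right_mono) auto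
      finally have "C * ((\<alpha> k)\<^sup>2 / \<epsilon> * (G k + Z k)) \<le> C * (\<rho> * \<alpha> k * G k + \<rho> * \<epsilon> * Z k)"
        using C by (intro mult_left_mono) auto
      then have "D (Suc k) \<le> (1 - \<epsilon>) * D k + C * (\<rho> * \<alpha> k * G k + \<rho> * \<epsilon> * Z k) + C * \<epsilon>\<^sup>2"
        using D_rec[OF k] by (simp add: Z_def mult.assoc)
      then have "(c + 1) * D (Suc k) \<le> (c + 1) * ((1 - \<epsilon>) * D k + C * (\<rho> * \<alpha> k * G k + \<rho> * \<epsilon> * Z k) + C * \<epsilon>\<^sup>2)"
        using c by (intro mult_left_mono) auto
      also have "\<dots> = (c + 1) * D k - (c + 1) * \<epsilon> * D k + c1 * \<rho> * (\<alpha> k * G k) + c1 * \<rho> * (\<epsilon> * Z k) + c1 * \<epsilon>\<^sup>2"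
        by (simp add: c1_def algebra_simps)
      finally have "U (Suc k) \<le> U k - \<epsilon> * Z k + c1 * \<rho> * (\<alpha> k * G k) + c1 * \<rho> * (\<epsilon> * Z k) + (c1 + c) * \<epsilon>\<^sup>2"
        using W by (simp add: U_def Z_def algebra_simps)
      then have "\<kappa> * U (Suc k) \<le> \<kappa> * (U k - \<epsilon> * Z k + c1 * \<rho> * (\<alpha> k * G k) + c1 * \<rho> * (\<epsilon> * Z k) + (c1 + c) * \<epsilon>\<^sup>2)"
        using \<kappa> by (intro mult_left_mono) auto
      also have "\<dots> = \<kappa> * U k - \<kappa> * (\<epsilon> * Z k) + \<kappa> * c1 * \<rho> * (\<alpha> k * G k) + \<kappa> * c1 * \<rho> * (\<epsilon> * Z k) + \<kappa> * (c1 + c) * \<epsilon>\<^sup>2"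
        by (simp add: algebra_simps)
      also have "\<dots> \<le> \<kappa> * U k - \<kappa> * (\<epsilon> * Z k) + 1 / 8 * (\<alpha> k * G k) + 1 / 8 * (\<epsilon> * Z k) + \<kappa> * (c1 + c) * \<epsilon>\<^sup>2"
        using \<rho>(3) \<alpha>k nonneg[of k] Z0[of k] k \<epsilon> c c1 by (intro add_mono mult_right_mono) auto
      finally have "P (Suc k) + \<kappa> * U (Suc k) \<le> P k + \<kappa> * U k - (\<kappa> - C - 1 / 8) * (\<epsilon> * Z k)
          - \<alpha> k / 8 * G k + (C + \<kappa> * (c1 + c)) * \<epsilon>\<^sup>2"
        using P_rec[OF k] by (simp add: Z_def algebra_simps)
      moreover have "1 * (\<epsilon> * Z k) \<le> (\<kappa> - C - 1 / 8) * (\<epsilon> * Z k)"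
        using C \<epsilon> Z0[of k] k by (intro mult_right_mono) (auto simp: \<kappa>_def)
      moreover have "(C + \<kappa> * (c1 + c)) * \<epsilon>\<^sup>2 \<le> C' * \<epsilon>\<^sup>2"
        by (intro mult_right_mono) (auto simp: C'_def)
      ultimately show ?thesis by linarith
    qed
    \<comment> \<open>The one-step decrease telescopes. At the end \<open>U\<close> is discarded as
      nonnegative, while \<open>P (Suc K)\<close> is retained; its lower bound is supplied only
      where \<open>P\<close> is the mean of \<Phi>.\<close>
    have "(\<Sum>k<j. \<alpha> k / 8 * G k + \<epsilon> * Z k) \<le> P 0 + \<kappa> * U 0 - (P j + \<kappa> * U j) + j * (C' * \<epsilon>\<^sup>2)"
      if "j \<le> Suc K" for j
      using that
    proof (induction j)
      case (Suc j)
      with step[of j] show ?case by (simp add: algebra_simps)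
    qed simp
    from this[of "Suc K"]
    have "(\<Sum>k\<le>K. \<alpha> k / 8 * G k + \<epsilon> * Z k) \<le> P 0 + \<kappa> * U 0 - (P (Suc K) + \<kappa> * U (Suc K)) + (real K + 1) * (C' * \<epsilon>\<^sup>2)"
      by (simp add: lessThan_Suc_atMost add.commute)
    moreover have "0 \<le> \<kappa> * U (Suc K)" using \<kappa> U0 by simp
    moreover have "\<kappa> * U 0 \<le> C' * Z 0"
    proof -
      have "cascade q (T 0) N \<le> (c + 1) * (\<Sum>n=1..N. T 0 n)"
        using cascade_bounds(2)[of q N "T 0"] q T0 by (simp add: c_def)
      also have "\<dots> \<le> (c + 1) * (\<Sum>n=1..N. (1 + R) * (e n 0 + d n 0))"
      proof (intro mult_left_mono sum_mono)
        fix n assume "n \<in> {1..N}"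
        then show "T 0 n \<le> (1 + R) * (e n 0 + d n 0)"
          using nonneg[of 0] R by (simp add: T_def algebra_simps)
      qed (use c in simp)
      finally have "cascade q (T 0) N \<le> (c + 1) * ((1 + R) * (\<Sum>n=1..N. e n 0 + d n 0))"
        by (simp add: sum_distrib_left)
      moreover have "1 * D 0 \<le> (1 + R) * D 0" using R nonneg[of 0] by (intro mult_right_mono) auto
      then have "(c + 1) * D 0 \<le> (c + 1) * ((1 + R) * D 0)" using c by (intro mult_left_mono) auto
      ultimately have "U 0 \<le> (c + 1) * (1 + R) * Z 0" by (simp add: U_def Z_def algebra_simps)
      then have "\<kappa> * U 0 \<le> \<kappa> * ((c + 1) * (1 + R) * Z 0)" using \<kappa> by (intro mult_left_mono) auto
      also have "\<dots> \<le> C' * Z 0" using Z0[of 0] by (simp add: mult.assoc[symmetric]) (intro mult_right_mono; simp add: C'_def)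
      finally show ?thesis .
    qed
    ultimately have "(\<Sum>k\<le>K. \<alpha> k / 8 * G k + \<epsilon> * Z k) \<le> P 0 - P (Suc K) + C' * Z 0 + C' * ((real K + 1) * \<epsilon>\<^sup>2)"
      by (simp add: algebra_simps)
    then show ?case by (simp add: Z_def)
  qed
qed

subsection \<open>Averaged iterates\<close>

text \<open>Convexity of the squared norm, with \<open>- (c / \<epsilon>) *\<^sub>R q\<close> as the
  second point: the contraction factor \<open>1 - \<epsilon>\<close> survives in full, and a
  perturbation with step \<open>c\<close> costs \<open>c\<^sup>2 / \<epsilon>\<close>.\<close>

lemma scaled_convex_sq_bound:
  fixes d q :: "'c::real_inner"
  assumes "0 < \<epsilon>" "\<epsilon> \<le> 1"
  shows "(norm ((1 - \<epsilon>) *\<^sub>R d - c *\<^sub>R q))\<^sup>2 \<le> (1 - \<epsilon>) * (norm d)\<^sup>2 + c\<^sup>2 / \<epsilon> * (norm q)\<^sup>2"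
proof -
  let ?p = "- (c / \<epsilon>) *\<^sub>R q"
  have "(1 - \<epsilon>) * (norm d)\<^sup>2 + \<epsilon> * (norm p)\<^sup>2 - (norm ((1 - \<epsilon>) *\<^sub>R d + \<epsilon> *\<^sub>R p))\<^sup>2
      = \<epsilon> * (1 - \<epsilon>) * (norm (d - p))\<^sup>2" for p
    unfolding power2_norm_eq_inner by (simp add: algebra_simps inner_commute power2_eq_square)
  moreover have "0 \<le> \<epsilon> * (1 - \<epsilon>) * (norm (d - ?p))\<^sup>2" using assms by simp
  ultimately have "(norm ((1 - \<epsilon>) *\<^sub>R d + \<epsilon> *\<^sub>R ?p))\<^sup>2 \<le> (1 - \<epsilon>) * (norm d)\<^sup>2 + \<epsilon> * (norm ?p)\<^sup>2"
    by (metis diff_ge_0_iff_ge)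
  moreover have "\<epsilon> *\<^sub>R ?p = - c *\<^sub>R q" using assms by simp
  moreover have "\<epsilon> * (norm ?p)\<^sup>2 = c\<^sup>2 / \<epsilon> * (norm q)\<^sup>2"
    using assms by (simp add: power_mult_distrib power_divide) (simp add: power2_eq_square)
  ultimately show ?thesis using assms by simp
qed

text \<open>The value at \<open>Suc k\<close> takes in \<open>z k\<close>, not
  \<open>z (Suc k)\<close>: this delay makes the average a function of the strict past. Starting at
  \<open>z 0\<close> makes the initial lag vanish.\<close>

primrec smooth :: "real \<Rightarrow> (nat \<Rightarrow> 'w \<Rightarrow> 'c::euclidean_space) \<Rightarrow> nat \<Rightarrow> 'w \<Rightarrow> 'c" where
  "smooth \<epsilon> z 0 w = z 0 w"
| "smooth \<epsilon> z (Suc k) w = (1 - \<epsilon>) *\<^sub>R smooth \<epsilon> z k w + \<epsilon> *\<^sub>R z k w"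

lemma smooth_eq: "smooth \<epsilon> z 0 = z 0"
    "smooth \<epsilon> z (Suc k) = (\<lambda>w. (1 - \<epsilon>) *\<^sub>R smooth \<epsilon> z k w + \<epsilon> *\<^sub>R z k w)"
  by (auto simp: fun_eq_iff)

lemma smooth_diff_Suc: "smooth \<epsilon> z (Suc k) w - smooth \<epsilon> z k w = \<epsilon> *\<^sub>R (z k w - smooth \<epsilon> z k w)"
  by (simp add: algebra_simps)

text \<open>For positive \<open>k\<close> only values before time \<open>k\<close> enter; for
  \<open>k = 0\<close> truncated subtraction leaves the condition on the starting value
  \<open>z 0\<close>.\<close>

lemma measurable_smooth:
  "(\<And>l. l \<le> k - 1 \<Longrightarrow> z l \<in> borel_measurable F) \<Longrightarrow> smooth \<epsilon> z k \<in> borel_measurable F"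
proof (induction k)
  case (Suc k)
  then have "smooth \<epsilon> z k \<in> borel_measurable F" "z k \<in> borel_measurable F" by auto
  then show ?case unfolding smooth_eq by measurable
qed (simp add: smooth_eq)

lemma sq_integrable_smooth:
  "(\<And>l. l \<le> k - 1 \<Longrightarrow> sq_integrable M (z l)) \<Longrightarrow> sq_integrable M (smooth \<epsilon> z k)"
proof (induction k)
  case (Suc k)
  then have "sq_integrable M (smooth \<epsilon> z k)" "sq_integrable M (z k)" by auto
  then show ?case unfolding smooth_eq by (intro sq_integrable_add sq_integrable_scaleR)
qed (simp add: smooth_eq)

lemma smooth_mem:
  "subspace S \<Longrightarrow> (\<And>l. l \<le> k - 1 \<Longrightarrow> z l w \<in> S) \<Longrightarrow> smooth \<epsilon> z k w \<in> S"
proof (induction k)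
  case (Suc k)
  then have "smooth \<epsilon> z k w \<in> S" "z k w \<in> S" by auto
  then show ?case using Suc.prems(1) by (auto intro: subspace_add subspace_scale)
qed simp

lemma generated_by_subalgebra:
  assumes "\<And>l. l \<le> k \<Longrightarrow> x l \<in> borel_measurable M"
    and "\<And>n l. n \<in> {1..N} \<Longrightarrow> l \<le> k \<Longrightarrow> y n l \<in> borel_measurable M"
  shows "subalgebra M (generated_by M N x y k)"
proof -
  let ?G = "{x l -` B \<inter> space M | l B. l \<le> k \<and> B \<in> sets borel} \<union>
        {y n l -` B \<inter> space M | n l B. n \<in> {1..N} \<and> l \<le> k \<and> B \<in> sets borel}"
  have "?G \<subseteq> sets M" using assms by (auto intro: measurable_sets)
  moreover have "?G \<subseteq> Pow (space M)" by auto
  ultimately show ?thesis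
    unfolding subalgebra_def generated_by_def by (simp add: sets.sigma_sets_subset)
qed

lemma generated_by_measurable:
  shows "l \<le> k \<Longrightarrow> x l \<in> borel_measurable (generated_by M N x y k)"
    and "n \<in> {1..N} \<Longrightarrow> l \<le> k \<Longrightarrow> y n l \<in> borel_measurable (generated_by M N x y k)"
proof -
  let ?G = "{x l -` B \<inter> space M | l B. l \<le> k \<and> B \<in> sets borel} \<union>
        {y n l -` B \<inter> space M | n l B. n \<in> {1..N} \<and> l \<le> k \<and> B \<in> sets borel}"
  have sp: "space (generated_by M N x y k) = space M"
    and st: "sets (generated_by M N x y k) = sigma_sets (space M) ?G"
    unfolding generated_by_def by (rule space_measure_of sets_measure_of; blast)+
  show "x l \<in> borel_measurable (generated_by M N x y k)" if "l \<le> k"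
    by (rule measurableI) (unfold sp st, simp, rule sigma_sets.Basic, use that in blast)
  show "y n l \<in> borel_measurable (generated_by M N x y k)" if "n \<in> {1..N}" "l \<le> k"
    by (rule measurableI) (unfold sp st, simp, rule sigma_sets.Basic, use that in blast)
qed

lemma (in regular_operators) measurable_ystar:
  assumes n: "n \<in> {1..N}" and X: "X \<in> borel_measurable F"
    and U: "\<And>i. i \<in> {1..N} \<Longrightarrow> U i \<in> borel_measurable F"
      "\<And>i w. i \<in> {1..N} \<Longrightarrow> w \<in> space F \<Longrightarrow> U i w \<in> V i"
  shows "(\<lambda>w. ystar V h n (X w) (\<lambda>i\<in>{1..n - 1}. U i w)) \<in> borel_measurable F"
  by (rule measurable_tuple_function[where V = V and L = L, OF ystar_lipschitz[OF n] X])
    (use n U in auto)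

text \<open>A Lipschitz map grows at most linearly. The comparison value is the one at the origin,
  an admissible argument because each \<open>V i\<close> is a subspace.\<close>

lemma (in regular_operators) sq_integrable_ystar:
  assumes M: "finite_measure M" and n: "n \<in> {1..N}" and X: "sq_integrable M X"
    and U: "\<And>i. i \<in> {1..N} \<Longrightarrow> sq_integrable M (U i)"
      "\<And>i w. i \<in> {1..N} \<Longrightarrow> w \<in> space M \<Longrightarrow> U i w \<in> V i"
  shows "sq_integrable M (\<lambda>w. ystar V h n (X w) (\<lambda>i\<in>{1..n - 1}. U i w))"
proof -
  interpret finite_measure M by fact
  let ?c = "ystar V h n 0 (restrict (\<lambda>_. 0) {1..n - 1})"
  let ?g = "\<lambda>w. norm ?c + L *\<^sub>R (norm (X w) + (\<Sum>i=1..n-1. norm (U i w)))"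
  have "sq_integrable M ?g"
    by (intro sq_integrable_add sq_integrable_const sq_integrable_scaleR sq_integrable_norm sq_integrable_sum X U)
      (use n in auto)
  then show ?thesis
  proof (rule sq_integrable_bound[where c = 1, rotated])
    fix w assume w: "w \<in> space M"
    have "norm (ystar V h n (X w) (restrict (\<lambda>i. U i w) {1..n - 1}) - ?c)
        \<le> L * (norm (X w - 0) + (\<Sum>i=1..n-1. norm (U i w - 0)))"
      by (rule ystar_restrict_lipschitz[OF n]) (use U w in \<open>auto intro: subspace_0[OF V]\<close>)
    then have "norm (ystar V h n (X w) (restrict (\<lambda>i. U i w) {1..n - 1})) \<le> ?g w"
      using norm_triangle_sub[of "ystar V h n (X w) (restrict (\<lambda>i. U i w) {1..n - 1})" ?c] by simp
    then show "norm (ystar V h n (X w) (\<lambda>i\<in>{1..n - 1}. U i w)) \<le> 1 * norm (?g w)" by simp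
  next
    show "(\<lambda>w. ystar V h n (X w) (\<lambda>i\<in>{1..n - 1}. U i w)) \<in> borel_measurable M"
      by (rule measurable_ystar[OF n sq_integrableD(1)[OF X] sq_integrableD(1)[OF U(1)] U(2)])
  qed
qed

section \<open>One run: iterates, averages, lags and tracking errors\<close>

locale mssa_process = mssa_problem N V h m L v \<Phi> l0 C_F + prob_space M
  for N and V :: "nat \<Rightarrow> 'b::euclidean_space set"
    and h :: "nat \<Rightarrow> 'a::euclidean_space \<Rightarrow> (nat \<Rightarrow> 'b) \<Rightarrow> 'b" and m L
    and v :: "'a \<Rightarrow> (nat \<Rightarrow> 'b) \<Rightarrow> 'a" and \<Phi> :: "'a \<Rightarrow> real" and l0 C_F :: real
    and M :: "'w measure" +
  fixes \<omega>0 \<omega>1 \<omega>2 \<sigma> \<epsilon> :: real and \<alpha> :: "nat \<Rightarrow> real" and \<beta> :: "nat \<Rightarrow> nat \<Rightarrow> real" and K :: nat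
    and x :: "nat \<Rightarrow> 'w \<Rightarrow> 'a" and y :: "nat \<Rightarrow> nat \<Rightarrow> 'w \<Rightarrow> 'b"
    and \<xi> :: "nat \<Rightarrow> 'w \<Rightarrow> 'a" and \<psi> :: "nat \<Rightarrow> nat \<Rightarrow> 'w \<Rightarrow> 'b"
  assumes run: "mssa_run M N V v h \<alpha> \<beta> K x y \<xi> \<psi>"
    and noise: "noise_bounded M N v h \<omega>0 \<omega>1 \<omega>2 \<sigma> K x y \<xi> \<psi>"
    and \<omega>_pos: "0 < \<omega>0" "0 < \<omega>1" "0 < \<omega>2"
    and \<epsilon>_pos: "0 < \<epsilon>" and \<epsilon>_le_1: "\<epsilon> \<le> 1"
    and \<alpha>_pos: "k \<le> K \<Longrightarrow> 0 < \<alpha> k"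
    and \<beta>_pos: "n \<in> {1..N} \<Longrightarrow> k \<le> K \<Longrightarrow> 0 < \<beta> n k"
    and x_init: "sq_integrable M (x 0)" and y_init: "n \<in> {1..N} \<Longrightarrow> sq_integrable M (y n 0)"
begin

abbreviation "Y k w \<equiv> (\<lambda>i. y i k w)"
definition "h_at n k w = h n (x k w) (\<lambda>i\<in>{1..n}. y i k w)"
definition "v_at k w = v (x k w) (\<lambda>i\<in>{1..N}. y i k w)"
definition "hist k = generated_by M N x y k"
definition "x_smooth = smooth \<epsilon> x"
definition "y_smooth n = smooth \<epsilon> (y n)"
definition "x_lag k w = x k w - x_smooth k w"
definition "y_lag n k w = y n k w - y_smooth n k w"
definition "target n k w = ystar V h n (x_smooth k w) (\<lambda>i\<in>{1..n - 1}. y_smooth i k w)"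
definition "y_err n k w = y n k w - target n k w"
definition "target_shift n k w = target n (Suc k) w - target n k w"
definition "y_res n k w = y n k w - ystar V h n (x k w) (\<lambda>i\<in>{1..n - 1}. y i k w)"

lemma measurable_iterates:
  "k \<le> Suc K \<Longrightarrow> x k \<in> borel_measurable M"
  "k \<le> Suc K \<Longrightarrow> n \<in> {1..N} \<Longrightarrow> y n k \<in> borel_measurable M"
  using run by (auto simp: mssa_run_def)

lemma y_mem: "k \<le> Suc K \<Longrightarrow> n \<in> {1..N} \<Longrightarrow> w \<in> space M \<Longrightarrow> y n k w \<in> V n"
  using run by (auto simp: mssa_run_def)

lemma Y_Pi: "k \<le> Suc K \<Longrightarrow> w \<in> space M \<Longrightarrow> Y k w \<in> Pi {1..N} V"
  using y_mem by auto

lemma measurable_noise: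
  "k \<le> K \<Longrightarrow> \<xi> k \<in> borel_measurable M"
  "k \<le> K \<Longrightarrow> n \<in> {1..N} \<Longrightarrow> \<psi> n k \<in> borel_measurable M"
  using run by (auto simp: mssa_run_def)

lemma y_Suc: "\<lbrakk>k \<le> K; n \<in> {1..N}; w \<in> space M\<rbrakk> \<Longrightarrow> y n (Suc k) w = y n k w - \<beta> n k *\<^sub>R (h_at n k w + \<psi> n k w)"
  using run by (simp add: mssa_run_def h_at_def)

lemma x_Suc: "\<lbrakk>k \<le> K; w \<in> space M\<rbrakk> \<Longrightarrow> x (Suc k) w = x k w - \<alpha> k *\<^sub>R (v_at k w + \<xi> k w)"
  using run by (simp add: mssa_run_def v_at_def)

lemma subalgebra_hist: "k \<le> Suc K \<Longrightarrow> subalgebra M (hist k)"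
  unfolding hist_def by (rule generated_by_subalgebra) (auto intro: measurable_iterates)

lemma space_hist: "k \<le> Suc K \<Longrightarrow> space (hist k) = space M"
  using subalgebra_hist[of k] by (simp add: subalgebra_def)

text \<open>The operators \<open>h\<close> and \<open>v\<close> are not assumed measurable; along the iterates they are read off
  the update equations.\<close>

lemma measurable_h_at:
  assumes "k \<le> K" "n \<in> {1..N}"
  shows "h_at n k \<in> borel_measurable M"
proof -
  have [measurable]: "y n k \<in> borel_measurable M" "y n (Suc k) \<in> borel_measurable M" "\<psi> n k \<in> borel_measurable M"
    using assms by (auto intro: measurable_iterates measurable_noise)
  have "h_at n k w = (1 / \<beta> n k) *\<^sub>R (y n k w - y n (Suc k) w) - \<psi> n k w" if "w \<in> space M" for w
    using y_Suc[OF assms that] \<beta>_pos[OF assms(2,1)] by simp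
  moreover have "(\<lambda>w. (1 / \<beta> n k) *\<^sub>R (y n k w - y n (Suc k) w) - \<psi> n k w) \<in> borel_measurable M"
    by measurable
  ultimately show ?thesis by (simp cong: measurable_cong)
qed

lemma measurable_v_at:
  assumes "k \<le> K"
  shows "v_at k \<in> borel_measurable M"
proof -
  have [measurable]: "x k \<in> borel_measurable M" "x (Suc k) \<in> borel_measurable M" "\<xi> k \<in> borel_measurable M"
    using assms by (auto intro: measurable_iterates measurable_noise)
  have "v_at k w = (1 / \<alpha> k) *\<^sub>R (x k w - x (Suc k) w) - \<xi> k w" if "w \<in> space M" for w
    using x_Suc[OF assms that] \<alpha>_pos[OF assms] by simp
  moreover have "(\<lambda>w. (1 / \<alpha> k) *\<^sub>R (x k w - x (Suc k) w) - \<xi> k w) \<in> borel_measurable M"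
    by measurable
  ultimately show ?thesis by (simp cong: measurable_cong)
qed

lemma norm_y_res: "norm (y_res n k w) = residual n (x k w) (Y k w)"
  by (simp add: y_res_def residual_def)

lemma norm_h_at_le: "\<lbrakk>k \<le> K; n \<in> {1..N}; w \<in> space M\<rbrakk> \<Longrightarrow> norm (h_at n k w) \<le> L * norm (y_res n k w)"
  unfolding h_at_def norm_y_res using norm_h_le_residual[of n "Y k w" "x k w"] Y_Pi[of k w] by simp

lemma norm_v_at_diff_le:
  "\<lbrakk>k \<le> K; w \<in> space M\<rbrakk> \<Longrightarrow>
    norm (v_at k w - grad (x k w)) \<le> l0 * (1 + L) ^ N * (\<Sum>n=1..N. norm (y_res n k w))"
  unfolding v_at_def norm_y_res using drift_error[of "Y k w" "x k w"] Y_Pi[of k w] by simp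

lemma measurable_grad: "X \<in> borel_measurable F' \<Longrightarrow> (\<lambda>w. grad (X w)) \<in> borel_measurable F'"
proof -
  have "grad_lip-lipschitz_on UNIV grad"
    by (rule lipschitz_onI) (auto simp: dist_norm grad_lipschitz grad_lip_nonneg)
  then have "continuous_on UNIV grad" by (rule lipschitz_on_continuous_on)
  then show "X \<in> borel_measurable F' \<Longrightarrow> (\<lambda>w. grad (X w)) \<in> borel_measurable F'"
    by (rule borel_measurable_continuous_on)
qed

lemma sq_integrable_grad:
  assumes "sq_integrable M X"
  shows "sq_integrable M (\<lambda>w. grad (X w))"
proof (rule sq_integrable_bound[where c = 1])
  show "sq_integrable M (\<lambda>w. norm (grad 0) + grad_lip *\<^sub>R norm (X w))"
    by (intro sq_integrable_add sq_integrable_const sq_integrable_scaleR sq_integrable_norm assms)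
  show "norm (grad (X w)) \<le> 1 * norm (norm (grad 0) + grad_lip *\<^sub>R norm (X w))" for w
    using grad_lipschitz[of "X w" 0] norm_triangle_sub[of "grad (X w)" "grad 0"] by simp
qed (use assms in \<open>auto intro!: measurable_grad simp: sq_integrable_def\<close>)

text \<open>Integrability of \<open>h_at n k\<close> is a premise because it is established along
  the run only by an induction in which this bound is one of the steps.\<close>

lemma noise_\<psi>:
  assumes k: "k \<le> K" and n: "n \<in> {1..N}" and h_at: "sq_integrable M (h_at n k)"
  shows "centered_given M (hist k) (\<psi> n k)" "sq_integrable M (\<psi> n k)"
    "(\<integral>w. (norm (\<psi> n k w))\<^sup>2 \<partial>M) \<le> \<omega>0 * (\<integral>w. (norm (h_at n k w))\<^sup>2 \<partial>M) + \<sigma>\<^sup>2"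
proof -
  show c: "centered_given M (hist k) (\<psi> n k)"
    using noise k n by (auto simp: noise_bounded_def hist_def Let_def)
  have "AE w in M. cond_var M (hist k) (\<psi> n k) w \<le> ennreal (\<omega>0 * (norm (h_at n k w))\<^sup>2 + \<sigma>\<^sup>2)"
    using noise k n by (auto simp: noise_bounded_def hist_def Let_def h_at_def)
  note * = centered_given_second_moment[OF subalgebra_hist c this]
  have i: "integrable M (\<lambda>w. (norm (h_at n k w))\<^sup>2)" using h_at by (simp add: sq_integrable_def)
  show "sq_integrable M (\<psi> n k)" using * k i \<omega>_pos by simp
  have "(\<integral>w. (norm (\<psi> n k w))\<^sup>2 \<partial>M) \<le> (\<integral>w. \<omega>0 * (norm (h_at n k w))\<^sup>2 + \<sigma>\<^sup>2 \<partial>M)"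
    using * k i \<omega>_pos by simp
  also have "\<dots> = \<omega>0 * (\<integral>w. (norm (h_at n k w))\<^sup>2 \<partial>M) + \<sigma>\<^sup>2"
    using i by (simp add: prob_space)
  finally show "(\<integral>w. (norm (\<psi> n k w))\<^sup>2 \<partial>M) \<le> \<omega>0 * (\<integral>w. (norm (h_at n k w))\<^sup>2 \<partial>M) + \<sigma>\<^sup>2" .
qed

lemma noise_\<xi>:
  assumes k: "k \<le> K" and v_at: "sq_integrable M (v_at k)" and h_at: "\<And>n. n \<in> {1..N} \<Longrightarrow> sq_integrable M (h_at n k)"
  shows "centered_given M (hist k) (\<xi> k)" "sq_integrable M (\<xi> k)"
    "(\<integral>w. (norm (\<xi> k w))\<^sup>2 \<partial>M) \<le> \<omega>1 * (\<integral>w. (norm (v_at k w))\<^sup>2 \<partial>M) + \<sigma>\<^sup>2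
      + \<omega>2 * (\<Sum>n=1..N. (\<integral>w. (norm (h_at n k w))\<^sup>2 \<partial>M))"
proof -
  let ?b = "\<lambda>w. \<omega>1 * (norm (v_at k w))\<^sup>2 + \<sigma>\<^sup>2 + \<omega>2 * (\<Sum>n=1..N. (norm (h_at n k w))\<^sup>2)"
  show c: "centered_given M (hist k) (\<xi> k)"
    using noise k by (auto simp: noise_bounded_def hist_def Let_def)
  have "AE w in M. cond_var M (hist k) (\<xi> k) w \<le> ennreal (?b w)"
    using noise k unfolding noise_bounded_def hist_def Let_def h_at_def v_at_def by blast
  note * = centered_given_second_moment[OF subalgebra_hist c this]
  have i: "integrable M (\<lambda>w. (norm (v_at k w))\<^sup>2)" using v_at by (simp add: sq_integrable_def)
  have j: "integrable M (\<lambda>w. (norm (h_at n k w))\<^sup>2)" if "n \<in> {1..N}" for n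
    using h_at[OF that] by (simp add: sq_integrable_def)
  have b: "integrable M ?b"
    using i j by (intro Bochner_Integration.integrable_add integrable_mult_right Bochner_Integration.integrable_sum) auto
  have b0: "0 \<le> ?b w" for w
    using \<omega>_pos by (intro add_nonneg_nonneg mult_nonneg_nonneg sum_nonneg) auto
  show "sq_integrable M (\<xi> k)" using *[OF _ b b0] k by simp
  have "(\<integral>w. (norm (\<xi> k w))\<^sup>2 \<partial>M) \<le> (\<integral>w. ?b w \<partial>M)" using *[OF _ b b0] k by simp
  also have "\<dots> = \<omega>1 * (\<integral>w. (norm (v_at k w))\<^sup>2 \<partial>M) + \<sigma>\<^sup>2
      + \<omega>2 * (\<Sum>n=1..N. (\<integral>w. (norm (h_at n k w))\<^sup>2 \<partial>M))"
    using i Bochner_Integration.integrable_sum[OF j, of "{1..N}" "\<lambda>n. n"]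
      Bochner_Integration.integral_sum[OF j, of "{1..N}" "\<lambda>n. n"] by (simp add: prob_space del: One_nat_def)
  finally show "(\<integral>w. (norm (\<xi> k w))\<^sup>2 \<partial>M) \<le> \<omega>1 * (\<integral>w. (norm (v_at k w))\<^sup>2 \<partial>M) + \<sigma>\<^sup>2
      + \<omega>2 * (\<Sum>n=1..N. (\<integral>w. (norm (h_at n k w))\<^sup>2 \<partial>M))" .
qed

text \<open>A chain of comparisons: \<open>ystar\<close> grows linearly, \<open>h_at\<close> is at
  most \<open>L\<close> times the residual, and \<open>v_at\<close> differs from the gradient by a
  multiple of the sum of residuals.\<close>

lemma sq_integrable_of_iterates:
  assumes k: "k \<le> Suc K" and x: "sq_integrable M (x k)" and y: "\<And>n. n \<in> {1..N} \<Longrightarrow> sq_integrable M (y n k)"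
  shows "n \<in> {1..N} \<Longrightarrow> sq_integrable M (y_res n k)"
    and "k \<le> K \<Longrightarrow> n \<in> {1..N} \<Longrightarrow> sq_integrable M (h_at n k)"
    and "k \<le> K \<Longrightarrow> sq_integrable M (v_at k)"
proof -
  show y_res: "sq_integrable M (y_res n k)" if n: "n \<in> {1..N}" for n
    unfolding y_res_def[abs_def]
    by (intro sq_integrable_diff y n sq_integrable_ystar x finite_measure_axioms) (use k y_mem in auto)
  show "sq_integrable M (h_at n k)" if "k \<le> K" "n \<in> {1..N}" for n
    by (rule sq_integrable_bound[OF measurable_h_at y_res norm_h_at_le]) (use that in auto)
  assume k': "k \<le> K"
  show "sq_integrable M (v_at k)"
  proof (rule sq_integrable_bound[OF measurable_v_at[OF k'], where c = 1])
    let ?g = "\<lambda>w. norm (grad (x k w)) + (l0 * (1 + L) ^ N) *\<^sub>R (\<Sum>n=1..N. norm (y_res n k w))"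
    show "sq_integrable M ?g"
      by (intro sq_integrable_add sq_integrable_scaleR sq_integrable_sum sq_integrable_norm sq_integrable_grad x y_res)
    show "norm (v_at k w) \<le> 1 * norm (?g w)" if "w \<in> space M" for w
      using norm_v_at_diff_le[OF k' that] norm_triangle_sub[of "v_at k w" "grad (x k w)"] by simp
  qed
qed

text \<open>Integrable iterates give integrable drifts, the conditional variance bounds turn these
  into integrable noise, and the update passes integrability on to the next iterates.\<close>

lemma sq_integrable_iterates:
  "k \<le> Suc K \<Longrightarrow> sq_integrable M (x k) \<and> (\<forall>n\<in>{1..N}. sq_integrable M (y n k))"
proof (induction k)
  case 0
  then show ?case using x_init y_init by simp
next
  case (Suc k)
  then have k: "k \<le> K" and x: "sq_integrable M (x k)"
    and y: "\<And>n. n \<in> {1..N} \<Longrightarrow> sq_integrable M (y n k)" by auto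
  have h_at: "sq_integrable M (h_at n k)" if "n \<in> {1..N}" for n
    using sq_integrable_of_iterates(2)[OF _ x y] k that by auto
  have v_at: "sq_integrable M (v_at k)"
    using sq_integrable_of_iterates(3)[OF _ x y] k by auto
  have "sq_integrable M (\<lambda>w. x k w - \<alpha> k *\<^sub>R (v_at k w + \<xi> k w))"
    by (intro sq_integrable_diff sq_integrable_scaleR sq_integrable_add x v_at noise_\<xi>(2) k h_at)
  moreover have "sq_integrable M (\<lambda>w. y n k w - \<beta> n k *\<^sub>R (h_at n k w + \<psi> n k w))" if "n \<in> {1..N}" for n
    by (intro sq_integrable_diff sq_integrable_scaleR sq_integrable_add y h_at noise_\<psi>(2) k that)
  ultimately show ?case
    using x_Suc[OF k] y_Suc[OF k] unfolding sq_integrable_def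
    by (simp cong: measurable_cong Bochner_Integration.integrable_cong)
qed

lemma sq_integrable_x: "k \<le> Suc K \<Longrightarrow> sq_integrable M (x k)"
  and sq_integrable_y: "k \<le> Suc K \<Longrightarrow> n \<in> {1..N} \<Longrightarrow> sq_integrable M (y n k)"
  using sq_integrable_iterates by auto

lemma sq_integrable_y_res: "k \<le> Suc K \<Longrightarrow> n \<in> {1..N} \<Longrightarrow> sq_integrable M (y_res n k)"
  and sq_integrable_h_at: "k \<le> K \<Longrightarrow> n \<in> {1..N} \<Longrightarrow> sq_integrable M (h_at n k)"
  and sq_integrable_v_at: "k \<le> K \<Longrightarrow> sq_integrable M (v_at k)"
  using sq_integrable_of_iterates sq_integrable_x sq_integrable_y le_SucI by metis+

section \<open>Adapted and predictable quantities\<close>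

lemma x_smooth_props:
  "k \<le> Suc K \<Longrightarrow> x_smooth k \<in> borel_measurable (hist k)"
  "k \<le> K \<Longrightarrow> x_smooth (Suc k) \<in> borel_measurable (hist k)"
  "k \<le> Suc K \<Longrightarrow> sq_integrable M (x_smooth k)"
  unfolding x_smooth_def hist_def
  by (auto intro!: measurable_smooth sq_integrable_smooth generated_by_measurable sq_integrable_x)

lemma y_smooth_props:
  assumes "n \<in> {1..N}"
  shows "k \<le> Suc K \<Longrightarrow> y_smooth n k \<in> borel_measurable (hist k)"
  "k \<le> K \<Longrightarrow> y_smooth n (Suc k) \<in> borel_measurable (hist k)"
  "k \<le> Suc K \<Longrightarrow> sq_integrable M (y_smooth n k)"
  "k \<le> Suc K \<Longrightarrow> w \<in> space M \<Longrightarrow> y_smooth n k w \<in> V n"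
  unfolding y_smooth_def hist_def using assms
  by (auto intro!: measurable_smooth sq_integrable_smooth generated_by_measurable sq_integrable_y
      smooth_mem V y_mem)

lemma y_smooth_Pi: "k \<le> Suc K \<Longrightarrow> w \<in> space M \<Longrightarrow> (\<lambda>i. y_smooth i k w) \<in> Pi {1..N} V"
  using y_smooth_props(4) by auto

lemma target_props:
  assumes "n \<in> {1..N}"
  shows "k \<le> Suc K \<Longrightarrow> target n k \<in> borel_measurable (hist k)"
  "k \<le> K \<Longrightarrow> target n (Suc k) \<in> borel_measurable (hist k)"
  "k \<le> Suc K \<Longrightarrow> sq_integrable M (target n k)"
  unfolding target_def[abs_def]
  by (intro measurable_ystar sq_integrable_ystar assms x_smooth_props y_smooth_props finite_measure_axioms; simp add: space_hist y_smooth_props)+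

lemma lag_props:
  shows "k \<le> Suc K \<Longrightarrow> x_lag k \<in> borel_measurable (hist k)" "k \<le> Suc K \<Longrightarrow> sq_integrable M (x_lag k)"
    "k \<le> Suc K \<Longrightarrow> n \<in> {1..N} \<Longrightarrow> y_lag n k \<in> borel_measurable (hist k)"
    "k \<le> Suc K \<Longrightarrow> n \<in> {1..N} \<Longrightarrow> sq_integrable M (y_lag n k)"
  unfolding x_lag_def[abs_def] y_lag_def[abs_def]
  by (auto intro!: borel_measurable_diff sq_integrable_diff x_smooth_props y_smooth_props sq_integrable_x sq_integrable_y
      simp: hist_def generated_by_measurable x_smooth_props[unfolded hist_def] y_smooth_props[unfolded hist_def])

text \<open>\<open>target_shift n k\<close> is measurable with respect to \<open>hist k\<close>
  although it involves time \<open>Suc k\<close>, since the averages at \<open>Suc k\<close> use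
  iterates up to \<open>k\<close> only. Hence the noise of step \<open>k\<close> is orthogonal to
  \<open>y_err n k - target_shift n k\<close>.\<close>

lemma y_err_props:
  assumes "n \<in> {1..N}"
  shows "k \<le> Suc K \<Longrightarrow> y_err n k \<in> borel_measurable (hist k)" "k \<le> Suc K \<Longrightarrow> sq_integrable M (y_err n k)"
    "k \<le> K \<Longrightarrow> target_shift n k \<in> borel_measurable (hist k)" "k \<le> K \<Longrightarrow> sq_integrable M (target_shift n k)"
  unfolding y_err_def[abs_def] target_shift_def[abs_def] using assms
  by (auto intro!: borel_measurable_diff sq_integrable_diff target_props sq_integrable_y
      simp: hist_def generated_by_measurable target_props[unfolded hist_def])

lemma x_lag_Suc:
  assumes "k \<le> K" "w \<in> space M"
  shows "x_lag (Suc k) w = (1 - \<epsilon>) *\<^sub>R x_lag k w - \<alpha> k *\<^sub>R (v_at k w + \<xi> k w)"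
  using x_Suc[OF assms] by (simp add: x_lag_def x_smooth_def algebra_simps)

lemma y_lag_Suc:
  assumes "k \<le> K" "n \<in> {1..N}" "w \<in> space M"
  shows "y_lag n (Suc k) w = (1 - \<epsilon>) *\<^sub>R y_lag n k w - \<beta> n k *\<^sub>R (h_at n k w + \<psi> n k w)"
  using y_Suc[OF assms] by (simp add: y_lag_def y_smooth_def algebra_simps)

lemma y_err_Suc:
  assumes "k \<le> K" "n \<in> {1..N}" "w \<in> space M"
  shows "y_err n (Suc k) w = (y_err n k w - target_shift n k w) - \<beta> n k *\<^sub>R (h_at n k w + \<psi> n k w)"
  using y_Suc[OF assms] by (simp add: y_err_def target_shift_def algebra_simps)

end

subsection \<open>One-step estimates\<close>

lemma sum_square_le:
  fixes b :: "nat \<Rightarrow> real"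
  assumes "n \<in> {1..N}"
  shows "(a + (\<Sum>i=1..n-1. b i))\<^sup>2 \<le> 2 * real N * (a\<^sup>2 + (\<Sum>i=1..n-1. (b i)\<^sup>2))"
proof -
  let ?s = "\<Sum>i=1..n-1. b i" and ?q = "\<Sum>i=1..n-1. (b i)\<^sup>2"
  have "?s\<^sup>2 \<le> ?q * card {1..n-1}" by (rule sum_squared_le_sum_of_squares)
  also have "\<dots> \<le> ?q * N" using assms by (intro mult_left_mono sum_nonneg) auto
  finally have "?s\<^sup>2 \<le> ?q * N" .
  moreover have "(a + ?s)\<^sup>2 \<le> 2 * a\<^sup>2 + 2 * ?s\<^sup>2"
    using sum_squares_bound[of a ?s] unfolding power2_sum by linarith
  moreover have "1 * a\<^sup>2 \<le> N * a\<^sup>2" using assms by (intro mult_right_mono) auto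
  ultimately show ?thesis by (simp add: algebra_simps)
qed

lemma square_add_le: "(norm (u + v))\<^sup>2 \<le> 2 * (norm u)\<^sup>2 + 2 * (norm v)\<^sup>2"
proof -
  have "(norm (u + v))\<^sup>2 \<le> (norm u + norm v)\<^sup>2" by (intro power_mono norm_triangle_ineq norm_ge_zero)
  then show ?thesis using sum_squares_bound[of "norm u" "norm v"] unfolding power2_sum by linarith
qed

text \<open>Arises from \<open>(e + L * r)\<^sup>2 \<le> 2 * e\<^sup>2 + 2 * L\<^sup>2 *
  r\<^sup>2\<close>, the square of the sum of lags being at most \<open>2 * N\<close> times the sum
  of their squares.\<close>

definition (in regular_operators) residual_const :: real where "residual_const = 2 + 4 * L\<^sup>2 * N"

text \<open>The squared constant of \<open>drift_error\<close>, a factor \<open>N\<close> from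
  Cauchy-Schwarz over the residuals, and \<open>N * residual_const\<close> from bounding each
  squared residual by the total error.\<close>

definition (in mssa_problem) drift_const :: real where "drift_const = (l0 * (1 + L) ^ N)\<^sup>2 * real N * (N * residual_const)"

text \<open>The first summand comes from \<open>2 * (1 + \<omega>1)\<close> times the second moment
  of the drift, which is split into gradient and bias with factor 2 each; the second comes from the
  share of the squared \<open>h_at\<close> in the noise of \<open>x\<close>.\<close>

definition (in mssa_problem) noise_const :: "real \<Rightarrow> real \<Rightarrow> real" where
  "noise_const \<omega>1 \<omega>2 = 4 * (1 + \<omega>1) * (1 + drift_const) + 2 * \<omega>2 * (N * (L\<^sup>2 * residual_const))"

lemma (in regular_operators) residual_const_ge: "2 \<le> residual_const"
  by (simp add: residual_const_def)

lemma (in mssa_problem) drift_const_nonneg: "0 \<le> drift_const"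
  using residual_const_ge by (simp add: drift_const_def)

section \<open>Pointwise and integrated bounds in terms of the total error\<close>

context mssa_process
begin

abbreviation "second_moment f \<equiv> (\<integral>w. (norm (f w))\<^sup>2 \<partial>M)"
definition "grad_at k w = grad (x k w)"
definition "lag_sq n k w = (norm (x_lag k w))\<^sup>2 + (\<Sum>i=1..n-1. (norm (y_lag i k w))\<^sup>2)"
definition "lag_norm n k w = norm (x_lag k w) + (\<Sum>i=1..n-1. norm (y_lag i k w))"
definition "error_sq k w = (norm (x_lag k w))\<^sup>2 + (\<Sum>n=1..N. (norm (y_err n k w))\<^sup>2 + (norm (y_lag n k w))\<^sup>2)"
definition "lag_moment n k = second_moment (x_lag k) + (\<Sum>i=1..n-1. second_moment (y_lag i k))"
definition "error_moment k = second_moment (x_lag k) + (\<Sum>n=1..N. second_moment (y_err n k) + second_moment (y_lag n k))"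

lemma lag_norm_nonneg: "0 \<le> lag_norm n k w"
  by (simp add: lag_norm_def sum_nonneg)

lemma lag_norm_square_le: "n \<in> {1..N} \<Longrightarrow> (lag_norm n k w)\<^sup>2 \<le> 2 * real N * lag_sq n k w"
  unfolding lag_norm_def lag_sq_def by (rule sum_square_le)

lemma integral_lag_sq:
  assumes "k \<le> Suc K" "n \<in> {1..N}"
  shows "integrable M (lag_sq n k)" "(\<integral>w. lag_sq n k w \<partial>M) = lag_moment n k"
proof -
  have i: "integrable M (\<lambda>w. (norm (x_lag k w))\<^sup>2)" "\<And>i. i \<in> {1..n-1} \<Longrightarrow> integrable M (\<lambda>w. (norm (y_lag i k w))\<^sup>2)"
    using assms by (auto intro!: sq_integrableD(2) lag_props)
  note j = Bochner_Integration.integrable_sum[OF i(2), of "{1..n-1}" "\<lambda>i. i"]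
    Bochner_Integration.integral_sum[OF i(2), of "{1..n-1}" "\<lambda>i. i"]
  show "integrable M (lag_sq n k)" "(\<integral>w. lag_sq n k w \<partial>M) = lag_moment n k"
    unfolding lag_sq_def[abs_def] lag_moment_def using i(1) j by (simp_all del: One_nat_def)
qed

lemma integral_error_sq:
  assumes "k \<le> Suc K"
  shows "integrable M (error_sq k)" "(\<integral>w. error_sq k w \<partial>M) = error_moment k"
proof -
  have i: "integrable M (\<lambda>w. (norm (x_lag k w))\<^sup>2)"
    "\<And>i. i \<in> {1..N} \<Longrightarrow> integrable M (\<lambda>w. (norm (y_err i k w))\<^sup>2)"
    "\<And>i. i \<in> {1..N} \<Longrightarrow> integrable M (\<lambda>w. (norm (y_lag i k w))\<^sup>2)"
    using assms by (auto intro!: sq_integrableD(2) lag_props y_err_props)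
  have i': "\<And>i. i \<in> {1..N} \<Longrightarrow> integrable M (\<lambda>w. (norm (y_err i k w))\<^sup>2 + (norm (y_lag i k w))\<^sup>2)"
    using i by auto
  note j = Bochner_Integration.integrable_sum[OF i', of "{1..N}" "\<lambda>i. i"]
    Bochner_Integration.integral_sum[OF i', of "{1..N}" "\<lambda>i. i"]
  have "(\<Sum>n=1..N. (\<integral>w. (norm (y_err n k w))\<^sup>2 + (norm (y_lag n k w))\<^sup>2 \<partial>M)) = (\<Sum>n=1..N. second_moment (y_err n k) + second_moment (y_lag n k))"
    using i by (intro sum.cong) auto
  then show "integrable M (error_sq k)" "(\<integral>w. error_sq k w \<partial>M) = error_moment k"
    unfolding error_sq_def[abs_def] error_moment_def using i(1) j by (simp_all del: One_nat_def)
qed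

lemma y_err_lag_le_error: "n \<in> {1..N} \<Longrightarrow> (norm (y_err n k w))\<^sup>2 + lag_sq n k w \<le> error_sq k w"
proof -
  assume n: "n \<in> {1..N}"
  have "(\<Sum>i=1..n-1. (norm (y_lag i k w))\<^sup>2) \<le> (\<Sum>i=1..N. (norm (y_lag i k w))\<^sup>2)"
    by (rule sum_mono2) (use n in auto)
  moreover have "(norm (y_err n k w))\<^sup>2 \<le> (\<Sum>i=1..N. (norm (y_err i k w))\<^sup>2)"
    by (rule member_le_sum[of _ _ "\<lambda>i. (norm (y_err i k w))\<^sup>2"]) (use n in auto)
  ultimately show ?thesis by (simp add: error_sq_def lag_sq_def sum.distrib)
qed

lemma y_err_lag_moment_le:
  assumes "k \<le> Suc K" "n \<in> {1..N}"
  shows "second_moment (y_err n k) + lag_moment n k \<le> error_moment k"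
proof -
  have i: "integrable M (\<lambda>w. (norm (y_err n k w))\<^sup>2)" using y_err_props(2)[OF assms(2,1)] by (rule sq_integrableD)
  have "(\<integral>w. (norm (y_err n k w))\<^sup>2 + lag_sq n k w \<partial>M) \<le> (\<integral>w. error_sq k w \<partial>M)"
    by (rule integral_mono) (use i integral_lag_sq[OF assms] integral_error_sq[OF assms(1)] y_err_lag_le_error[OF assms(2)] in auto)
  then show ?thesis using i integral_lag_sq[OF assms] integral_error_sq[OF assms(1)] by simp
qed

lemma norm_y_res_le:
  assumes "k \<le> Suc K" "n \<in> {1..N}" "w \<in> space M"
  shows "norm (y_res n k w) \<le> norm (y_err n k w) + L * lag_norm n k w"
  using residual_perturb[OF assms(2) Y_Pi[OF assms(1,3)] y_smooth_Pi[OF assms(1,3)], of "x k w" "x_smooth k w"]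
  unfolding norm_y_res by (simp add: y_err_def target_def lag_norm_def x_lag_def y_lag_def)

lemma norm_y_res_square_le:
  assumes "k \<le> Suc K" "n \<in> {1..N}" "w \<in> space M"
  shows "(norm (y_res n k w))\<^sup>2 \<le> residual_const * ((norm (y_err n k w))\<^sup>2 + lag_sq n k w)"
proof -
  have "(norm (y_res n k w))\<^sup>2 \<le> (norm (y_err n k w) + L * lag_norm n k w)\<^sup>2"
    by (intro power_mono norm_y_res_le assms norm_ge_zero)
  also have "\<dots> \<le> 2 * (norm (y_err n k w))\<^sup>2 + 2 * (L * lag_norm n k w)\<^sup>2"
    using square_add_le[of "norm (y_err n k w)" "L * lag_norm n k w"] by simp
  also have "(L * lag_norm n k w)\<^sup>2 \<le> L\<^sup>2 * (2 * real N * lag_sq n k w)"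
    unfolding power_mult_distrib by (intro mult_left_mono lag_norm_square_le assms) auto
  finally have "(norm (y_res n k w))\<^sup>2 \<le> 2 * (norm (y_err n k w))\<^sup>2 + 4 * L\<^sup>2 * real N * lag_sq n k w" by simp
  moreover have "0 \<le> lag_sq n k w" by (simp add: lag_sq_def sum_nonneg)
  moreover have "0 \<le> 4 * L\<^sup>2 * real N * (norm (y_err n k w))\<^sup>2" by simp
  ultimately show ?thesis unfolding residual_const_def distrib_left distrib_right by linarith
qed

lemma second_moment_y_res_le:
  assumes "k \<le> Suc K" "n \<in> {1..N}"
  shows "second_moment (y_res n k) \<le> residual_const * (second_moment (y_err n k) + lag_moment n k)"
proof -
  have i: "integrable M (\<lambda>w. (norm (y_err n k w))\<^sup>2)" using y_err_props(2)[OF assms(2,1)] by (rule sq_integrableD)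
  have "second_moment (y_res n k) \<le> (\<integral>w. residual_const * ((norm (y_err n k w))\<^sup>2 + lag_sq n k w) \<partial>M)"
    by (rule integral_mono)
      (use i integral_lag_sq[OF assms] sq_integrable_y_res[OF assms] norm_y_res_square_le[OF assms] in \<open>auto simp: sq_integrable_def\<close>)
  also have "\<dots> = residual_const * (second_moment (y_err n k) + lag_moment n k)" using i integral_lag_sq[OF assms] by simp
  finally show ?thesis .
qed

lemma second_moment_h_at_le:
  assumes "k \<le> K" "n \<in> {1..N}"
  shows "second_moment (h_at n k) \<le> L\<^sup>2 * residual_const * (second_moment (y_err n k) + lag_moment n k)"
proof -
  have k: "k \<le> Suc K" using assms by simp
  note i = sq_integrableD(2)[OF sq_integrable_y_res[OF k assms(2)]] sq_integrableD(2)[OF sq_integrable_h_at[OF assms]]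
  have "second_moment (h_at n k) \<le> (\<integral>w. L\<^sup>2 * (norm (y_res n k w))\<^sup>2 \<partial>M)"
  proof (rule integral_mono)
    fix w assume "w \<in> space M"
    from power_mono[OF norm_h_at_le[OF assms this] norm_ge_zero, of 2]
    show "(norm (h_at n k w))\<^sup>2 \<le> L\<^sup>2 * (norm (y_res n k w))\<^sup>2" by (simp add: power_mult_distrib)
  qed (use i in auto)
  also have "\<dots> = L\<^sup>2 * second_moment (y_res n k)" by simp
  also have "\<dots> \<le> L\<^sup>2 * (residual_const * (second_moment (y_err n k) + lag_moment n k))" by (intro mult_left_mono second_moment_y_res_le k assms) auto
  finally show ?thesis by (simp add: mult.assoc)
qed

lemma sum_second_moment_h_at_le:
  assumes "k \<le> K"
  shows "(\<Sum>n=1..N. second_moment (h_at n k)) \<le> N * (L\<^sup>2 * residual_const) * error_moment k"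
proof -
  have "second_moment (h_at n k) \<le> L\<^sup>2 * residual_const * error_moment k" if n: "n \<in> {1..N}" for n
    by (rule order_trans[OF second_moment_h_at_le[OF assms n]]) (intro mult_left_mono y_err_lag_moment_le n; use assms residual_const_ge in simp)
  then have "(\<Sum>n=1..N. second_moment (h_at n k)) \<le> (\<Sum>n=1..N. L\<^sup>2 * residual_const * error_moment k)" by (rule sum_mono)
  then show ?thesis by simp
qed

lemma sq_integrable_grad_at: "k \<le> Suc K \<Longrightarrow> sq_integrable M (grad_at k)"
  unfolding grad_at_def[abs_def] by (intro sq_integrable_grad sq_integrable_x)

lemma measurable_grad_at: "k \<le> Suc K \<Longrightarrow> grad_at k \<in> borel_measurable (hist k)"
  unfolding grad_at_def[abs_def] hist_def by (intro measurable_grad generated_by_measurable) simp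

lemma second_moment_v_at_diff_le:
  assumes "k \<le> K"
  shows "(\<integral>w. (norm (v_at k w - grad_at k w))\<^sup>2 \<partial>M) \<le> drift_const * error_moment k"
proof -
  have k: "k \<le> Suc K" using assms by simp
  let ?c = "l0 * (1 + L) ^ N"
  have "(\<integral>w. (norm (v_at k w - grad_at k w))\<^sup>2 \<partial>M) \<le> (\<integral>w. drift_const * error_sq k w \<partial>M)"
  proof (rule integral_mono)
    show "integrable M (\<lambda>w. (norm (v_at k w - grad_at k w))\<^sup>2)"
      using sq_integrable_diff[OF sq_integrable_v_at[OF assms] sq_integrable_grad_at[OF k]] by (rule sq_integrableD)
    fix w assume w: "w \<in> space M"
    have "(\<Sum>n=1..N. norm (y_res n k w))\<^sup>2 \<le> (\<Sum>n=1..N. (norm (y_res n k w))\<^sup>2) * card {1..N}"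
      by (rule sum_squared_le_sum_of_squares)
    also have "\<dots> \<le> (\<Sum>n=1..N. residual_const * error_sq k w) * N"
    proof -
      have "(norm (y_res n k w))\<^sup>2 \<le> residual_const * error_sq k w" if n: "n \<in> {1..N}" for n
        by (rule order_trans[OF norm_y_res_square_le[OF k n w]]) (intro mult_left_mono y_err_lag_le_error n; use residual_const_ge in simp)
      then show ?thesis by (simp only: card_atLeastAtMost diff_Suc_1 Suc_eq_plus1 diff_add_inverse2) (intro mult_right_mono sum_mono; simp)
    qed
    finally have 1: "(\<Sum>n=1..N. norm (y_res n k w))\<^sup>2 \<le> N * (N * residual_const) * error_sq k w" by (simp add: mult_ac)
    have "(norm (v_at k w - grad_at k w))\<^sup>2 \<le> (?c * (\<Sum>n=1..N. norm (y_res n k w)))\<^sup>2"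
      unfolding grad_at_def by (intro power_mono norm_v_at_diff_le assms w norm_ge_zero)
    also have "\<dots> \<le> ?c\<^sup>2 * (N * (N * residual_const) * error_sq k w)"
      unfolding power_mult_distrib[of ?c] by (intro mult_left_mono 1) auto
    finally show "(norm (v_at k w - grad_at k w))\<^sup>2 \<le> drift_const * error_sq k w" by (simp add: drift_const_def mult_ac)
  qed (use integral_error_sq[OF k] in auto)
  then show ?thesis using integral_error_sq[OF k] by simp
qed

lemma second_moment_v_at_le:
  assumes "k \<le> K"
  shows "second_moment (v_at k) \<le> 2 * second_moment (grad_at k) + 2 * drift_const * error_moment k"
proof -
  have k: "k \<le> Suc K" using assms by simp
  note i = sq_integrableD(2)[OF sq_integrable_v_at[OF assms]] sq_integrableD(2)[OF sq_integrable_grad_at[OF k]]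
    sq_integrableD(2)[OF sq_integrable_diff[OF sq_integrable_v_at[OF assms] sq_integrable_grad_at[OF k]]]
  have "second_moment (v_at k) \<le> (\<integral>w. 2 * (norm (grad_at k w))\<^sup>2 + 2 * (norm (v_at k w - grad_at k w))\<^sup>2 \<partial>M)"
  proof (rule integral_mono)
    show "(norm (v_at k w))\<^sup>2 \<le> 2 * (norm (grad_at k w))\<^sup>2 + 2 * (norm (v_at k w - grad_at k w))\<^sup>2" for w
      using square_add_le[of "grad_at k w" "v_at k w - grad_at k w"] by simp
  qed (use i in auto)
  also have "\<dots> = 2 * second_moment (grad_at k) + 2 * (\<integral>w. (norm (v_at k w - grad_at k w))\<^sup>2 \<partial>M)" using i by simp
  finally show ?thesis using second_moment_v_at_diff_le[OF assms] by simp
qed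

lemma error_moment_nonneg: "0 \<le> error_moment k"
  by (simp add: error_moment_def sum_nonneg add_nonneg_nonneg)

lemma total_drift_le:
  assumes "k \<le> K"
  shows "2 * second_moment (v_at k) + 2 * second_moment (\<xi> k) \<le> noise_const \<omega>1 \<omega>2 * (second_moment (grad_at k) + error_moment k) + 2 * \<sigma>\<^sup>2"
proof -
  have \<xi>: "second_moment (\<xi> k) \<le> \<omega>1 * second_moment (v_at k) + \<sigma>\<^sup>2 + \<omega>2 * (\<Sum>n=1..N. second_moment (h_at n k))"
    by (rule noise_\<xi>(3)) (use assms sq_integrable_v_at sq_integrable_h_at in auto)
  have 1: "\<omega>2 * (\<Sum>n=1..N. second_moment (h_at n k)) \<le> \<omega>2 * (N * (L\<^sup>2 * residual_const) * error_moment k)"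
    using \<omega>_pos by (intro mult_left_mono sum_second_moment_h_at_le assms) auto
  have 2: "(1 + \<omega>1) * second_moment (v_at k) \<le> (1 + \<omega>1) * (2 * second_moment (grad_at k) + 2 * drift_const * error_moment k)"
    using \<omega>_pos by (intro mult_left_mono second_moment_v_at_le assms) auto
  have 3: "0 \<le> (1 + \<omega>1) * error_moment k" "0 \<le> (1 + \<omega>1) * (drift_const * second_moment (grad_at k))" "0 \<le> \<omega>2 * (N * (L\<^sup>2 * residual_const) * second_moment (grad_at k))"
    using \<omega>_pos error_moment_nonneg drift_const_nonneg residual_const_ge by (auto intro!: mult_nonneg_nonneg)
  have "2 * second_moment (v_at k) + 2 * second_moment (\<xi> k) \<le> 2 * ((1 + \<omega>1) * second_moment (v_at k)) + 2 * \<sigma>\<^sup>2 + 2 * (\<omega>2 * (\<Sum>n=1..N. second_moment (h_at n k)))"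
    using \<xi> by (simp add: algebra_simps)
  also have "\<dots> \<le> 2 * ((1 + \<omega>1) * (2 * second_moment (grad_at k) + 2 * drift_const * error_moment k)) + 2 * \<sigma>\<^sup>2 + 2 * (\<omega>2 * (N * (L\<^sup>2 * residual_const) * error_moment k))"
    using 1 2 by linarith
  also have "\<dots> \<le> noise_const \<omega>1 \<omega>2 * (second_moment (grad_at k) + error_moment k) + 2 * \<sigma>\<^sup>2"
    using 3 by (simp add: noise_const_def algebra_simps)
  finally show ?thesis .
qed

text \<open>The drift enters through convexity with factor
  \<open>(\<alpha> k)\<^sup>2 / \<epsilon>\<close>, the noise through orthogonality with factor
  \<open>(\<alpha> k)\<^sup>2\<close>. The constant \<open>\<sigma>\<^sup>2\<close> must stay with
  the smaller factor: the larger one is only known to be of order \<open>\<epsilon>\<close>, and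
  such a constant would add up to order \<open>\<surd>K\<close>.\<close>

lemma x_lag_recursion:
  assumes "k \<le> K" and \<alpha>: "\<alpha> k \<le> \<epsilon>"
  shows "second_moment (x_lag (Suc k)) \<le> (1 - \<epsilon>) * second_moment (x_lag k) + noise_const \<omega>1 \<omega>2 * ((\<alpha> k)\<^sup>2 / \<epsilon>) * (second_moment (grad_at k) + error_moment k) + 2 * \<sigma>\<^sup>2 * \<epsilon>\<^sup>2"
proof -
  have k: "k \<le> Suc K" using assms by simp
  note ivv = sq_integrable_v_at[OF assms(1)] and idx = lag_props(2)[OF k] and mdx = lag_props(1)[OF k]
  note \<xi> = noise_\<xi>(1,2)[OF assms(1) ivv sq_integrable_h_at[OF assms(1)]]
  have P: "(\<lambda>w. (1 - \<epsilon>) *\<^sub>R x_lag k w) \<in> borel_measurable (hist k)" "sq_integrable M (\<lambda>w. (1 - \<epsilon>) *\<^sub>R x_lag k w)"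
    using mdx sq_integrable_scaleR[OF idx] by auto
  have "second_moment (x_lag (Suc k)) = (\<integral>w. (norm ((1 - \<epsilon>) *\<^sub>R x_lag k w - \<alpha> k *\<^sub>R (v_at k w + \<xi> k w)))\<^sup>2 \<partial>M)"
    using x_lag_Suc[OF assms(1)] by (intro Bochner_Integration.integral_cong) auto
  also have "\<dots> \<le> (\<integral>w. (norm ((1 - \<epsilon>) *\<^sub>R x_lag k w - \<alpha> k *\<^sub>R v_at k w))\<^sup>2 \<partial>M) + (\<alpha> k)\<^sup>2 * (second_moment (v_at k) + 2 * second_moment (\<xi> k))"
    by (rule noisy_step_second_moment[OF subalgebra_hist[OF k] \<xi> P ivv])
  also have "(\<integral>w. (norm ((1 - \<epsilon>) *\<^sub>R x_lag k w - \<alpha> k *\<^sub>R v_at k w))\<^sup>2 \<partial>M)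
      \<le> (\<integral>w. (1 - \<epsilon>) * (norm (x_lag k w))\<^sup>2 + (\<alpha> k)\<^sup>2 / \<epsilon> * (norm (v_at k w))\<^sup>2 \<partial>M)"
    by (rule integral_mono)
      (use sq_integrable_diff[OF P(2) sq_integrable_scaleR[OF ivv]] ivv idx
          scaled_convex_sq_bound[OF \<epsilon>_pos \<epsilon>_le_1] in \<open>auto simp: sq_integrable_def\<close>)
  also have "\<dots> = (1 - \<epsilon>) * second_moment (x_lag k) + (\<alpha> k)\<^sup>2 / \<epsilon> * second_moment (v_at k)"
    using ivv idx by (simp add: sq_integrable_def)
  finally have 1: "second_moment (x_lag (Suc k)) \<le> (1 - \<epsilon>) * second_moment (x_lag k) + (\<alpha> k)\<^sup>2 / \<epsilon> * second_moment (v_at k)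
      + (\<alpha> k)\<^sup>2 * (second_moment (v_at k) + 2 * second_moment (\<xi> k))" by simp
  let ?g = "noise_const \<omega>1 \<omega>2 * (second_moment (grad_at k) + error_moment k)"
  have 2: "second_moment (v_at k) + (second_moment (v_at k) + 2 * second_moment (\<xi> k)) - 2 * \<sigma>\<^sup>2 \<le> ?g"
    using total_drift_le[OF assms(1)] by simp
  have le: "(\<alpha> k)\<^sup>2 \<le> (\<alpha> k)\<^sup>2 / \<epsilon>" using \<epsilon>_pos \<epsilon>_le_1 by (simp add: le_divide_eq mult_left_le)
  have \<alpha>2: "(\<alpha> k)\<^sup>2 \<le> \<epsilon>\<^sup>2" using \<alpha>_pos[OF assms(1)] \<alpha> by (intro power_mono) auto
  have "(\<alpha> k)\<^sup>2 / \<epsilon> * second_moment (v_at k) + (\<alpha> k)\<^sup>2 * (second_moment (v_at k) + 2 * second_moment (\<xi> k))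
      \<le> (\<alpha> k)\<^sup>2 / \<epsilon> * ?g + 2 * \<sigma>\<^sup>2 * \<epsilon>\<^sup>2"
  \<comment> \<open>\<open>total_drift_le\<close> bounds drift and noise jointly, with
    \<open>2 * \<sigma>\<^sup>2\<close> split off. If the bracket is at least
    \<open>2 * \<sigma>\<^sup>2\<close>, its excess is nonnegative and may be given the larger
    factor, where the joint bound applies. Otherwise the bracket itself is below
    \<open>2 * \<sigma>\<^sup>2\<close>, and the drift is bounded alone.\<close>
  proof (cases "2 * \<sigma>\<^sup>2 \<le> second_moment (v_at k) + 2 * second_moment (\<xi> k)")
    case True
    have "(\<alpha> k)\<^sup>2 * (second_moment (v_at k) + 2 * second_moment (\<xi> k) - 2 * \<sigma>\<^sup>2) \<le> (\<alpha> k)\<^sup>2 / \<epsilon> * (second_moment (v_at k) + 2 * second_moment (\<xi> k) - 2 * \<sigma>\<^sup>2)"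
      using le True by (intro mult_right_mono) auto
    moreover have "(\<alpha> k)\<^sup>2 / \<epsilon> * (second_moment (v_at k) + (second_moment (v_at k) + 2 * second_moment (\<xi> k)) - 2 * \<sigma>\<^sup>2) \<le> (\<alpha> k)\<^sup>2 / \<epsilon> * ?g"
      using \<epsilon>_pos by (intro mult_left_mono 2) auto
    moreover have "(\<alpha> k)\<^sup>2 * (2 * \<sigma>\<^sup>2) \<le> \<epsilon>\<^sup>2 * (2 * \<sigma>\<^sup>2)" using \<alpha>2 by (intro mult_right_mono) auto
    ultimately show ?thesis by (simp add: algebra_simps)
  next
    case False
    then have "(\<alpha> k)\<^sup>2 * (second_moment (v_at k) + 2 * second_moment (\<xi> k)) \<le> \<epsilon>\<^sup>2 * (2 * \<sigma>\<^sup>2)"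
      using \<alpha>2 by (intro mult_mono) auto
    moreover have "second_moment (v_at k) \<le> 2 * second_moment (grad_at k) + 2 * drift_const * error_moment k" by (rule second_moment_v_at_le[OF assms(1)])
    then have "second_moment (v_at k) \<le> ?g"
    proof (rule order_trans)
      have a: "2 * 1 * (1 + drift_const) \<le> 4 * (1 + \<omega>1) * (1 + drift_const)"
        using \<omega>_pos drift_const_nonneg by (intro mult_right_mono) auto
      have "0 \<le> 2 * \<omega>2 * (N * (L\<^sup>2 * residual_const))" using \<omega>_pos residual_const_ge by (intro mult_nonneg_nonneg) auto
      with a have "2 * (1 + drift_const) \<le> noise_const \<omega>1 \<omega>2" unfolding noise_const_def by linarith
      then have "2 * (1 + drift_const) * (second_moment (grad_at k) + error_moment k) \<le> ?g" using error_moment_nonneg by (intro mult_right_mono) auto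
      moreover have "0 \<le> drift_const * second_moment (grad_at k)" using drift_const_nonneg by simp
      ultimately show "2 * second_moment (grad_at k) + 2 * drift_const * error_moment k \<le> ?g" using error_moment_nonneg[of k] by (simp add: algebra_simps)
    qed
    then have "(\<alpha> k)\<^sup>2 / \<epsilon> * second_moment (v_at k) \<le> (\<alpha> k)\<^sup>2 / \<epsilon> * ?g" using \<epsilon>_pos by (intro mult_left_mono) auto
    ultimately show ?thesis by (simp add: mult.commute)
  qed
  with 1 show ?thesis by (simp add: mult_ac)
qed

text \<open>The scheme is that of \<open>x_lag_recursion\<close>, but
  \<open>(\<beta> n k)\<^sup>2 / \<epsilon>\<close> has the order \<open>\<epsilon>\<close> of the
  contraction. The coefficient of the errors is thus not small and is left to the weights of the
  Lyapunov function.\<close>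

lemma y_lag_recursion:
  assumes "k \<le> K" and n: "n \<in> {1..N}" and \<beta>: "\<beta> n k \<le> B * \<epsilon>"
  shows "second_moment (y_lag n (Suc k)) \<le> (1 - \<epsilon>) * second_moment (y_lag n k)
    + (B\<^sup>2 * (2 + 2 * \<omega>0) * (L\<^sup>2 * residual_const)) * \<epsilon> * (second_moment (y_err n k) + lag_moment n k) + (2 * B\<^sup>2 * \<sigma>\<^sup>2) * \<epsilon>\<^sup>2"
proof -
  have k: "k \<le> Suc K" using assms by simp
  note ihv = sq_integrable_h_at[OF assms(1) n] and idy = lag_props(4)[OF k n] and mdy = lag_props(3)[OF k n]
  note \<psi> = noise_\<psi>[OF assms(1) n ihv]
  have P: "(\<lambda>w. (1 - \<epsilon>) *\<^sub>R y_lag n k w) \<in> borel_measurable (hist k)" "sq_integrable M (\<lambda>w. (1 - \<epsilon>) *\<^sub>R y_lag n k w)"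
    using mdy sq_integrable_scaleR[OF idy] by auto
  have "second_moment (y_lag n (Suc k)) = (\<integral>w. (norm ((1 - \<epsilon>) *\<^sub>R y_lag n k w - \<beta> n k *\<^sub>R (h_at n k w + \<psi> n k w)))\<^sup>2 \<partial>M)"
    using y_lag_Suc[OF assms(1) n] by (intro Bochner_Integration.integral_cong) auto
  also have "\<dots> \<le> (\<integral>w. (norm ((1 - \<epsilon>) *\<^sub>R y_lag n k w - \<beta> n k *\<^sub>R h_at n k w))\<^sup>2 \<partial>M) + (\<beta> n k)\<^sup>2 * (second_moment (h_at n k) + 2 * second_moment (\<psi> n k))"
    by (rule noisy_step_second_moment[OF subalgebra_hist[OF k] \<psi>(1,2) P ihv])
  also have "(\<integral>w. (norm ((1 - \<epsilon>) *\<^sub>R y_lag n k w - \<beta> n k *\<^sub>R h_at n k w))\<^sup>2 \<partial>M)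
      \<le> (\<integral>w. (1 - \<epsilon>) * (norm (y_lag n k w))\<^sup>2 + (\<beta> n k)\<^sup>2 / \<epsilon> * (norm (h_at n k w))\<^sup>2 \<partial>M)"
    by (rule integral_mono)
      (use sq_integrable_diff[OF P(2) sq_integrable_scaleR[OF ihv]] ihv idy
          scaled_convex_sq_bound[OF \<epsilon>_pos \<epsilon>_le_1] in \<open>auto simp: sq_integrable_def\<close>)
  also have "\<dots> = (1 - \<epsilon>) * second_moment (y_lag n k) + (\<beta> n k)\<^sup>2 / \<epsilon> * second_moment (h_at n k)"
    using ihv idy by (simp add: sq_integrable_def)
  finally have 1: "second_moment (y_lag n (Suc k)) \<le> (1 - \<epsilon>) * second_moment (y_lag n k) + (\<beta> n k)\<^sup>2 / \<epsilon> * second_moment (h_at n k)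
      + (\<beta> n k)\<^sup>2 * (second_moment (h_at n k) + 2 * second_moment (\<psi> n k))" by simp
  have \<beta>2: "(\<beta> n k)\<^sup>2 \<le> B\<^sup>2 * \<epsilon>\<^sup>2"
    using power_mono[OF \<beta>, of 2] \<beta>_pos[OF n assms(1)] by (simp add: power_mult_distrib)
  then have 2: "(\<beta> n k)\<^sup>2 / \<epsilon> \<le> B\<^sup>2 * \<epsilon>" using \<epsilon>_pos by (simp add: divide_le_eq power2_eq_square mult_ac)
  have "(\<beta> n k)\<^sup>2 / \<epsilon> * second_moment (h_at n k) \<le> B\<^sup>2 * \<epsilon> * second_moment (h_at n k)" using 2 by (intro mult_right_mono) auto
  moreover have "(\<beta> n k)\<^sup>2 * (second_moment (h_at n k) + 2 * second_moment (\<psi> n k)) \<le> B\<^sup>2 * \<epsilon>\<^sup>2 * ((1 + 2 * \<omega>0) * second_moment (h_at n k) + 2 * \<sigma>\<^sup>2)"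
    using \<beta>2 \<psi>(3) by (intro mult_mono) (auto simp: algebra_simps intro!: add_nonneg_nonneg)
  moreover have "B\<^sup>2 * \<epsilon>\<^sup>2 * ((1 + 2 * \<omega>0) * second_moment (h_at n k)) \<le> B\<^sup>2 * \<epsilon> * ((1 + 2 * \<omega>0) * second_moment (h_at n k))"
    using \<epsilon>_pos \<epsilon>_le_1 \<omega>_pos by (intro mult_right_mono mult_left_mono) (auto simp: power2_eq_square mult_left_le)
  ultimately have "second_moment (y_lag n (Suc k)) \<le> (1 - \<epsilon>) * second_moment (y_lag n k) + B\<^sup>2 * (2 + 2 * \<omega>0) * \<epsilon> * second_moment (h_at n k) + (2 * B\<^sup>2 * \<sigma>\<^sup>2) * \<epsilon>\<^sup>2"
    using 1 by (simp add: algebra_simps)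
  moreover have "B\<^sup>2 * (2 + 2 * \<omega>0) * \<epsilon> * second_moment (h_at n k) \<le> B\<^sup>2 * (2 + 2 * \<omega>0) * \<epsilon> * (L\<^sup>2 * residual_const * (second_moment (y_err n k) + lag_moment n k))"
    using \<epsilon>_pos \<omega>_pos by (intro mult_left_mono second_moment_h_at_le assms) auto
  ultimately show ?thesis by (simp add: mult_ac)
qed

lemma norm_target_shift_le:
  assumes "k \<le> K" "n \<in> {1..N}" "w \<in> space M"
  shows "norm (target_shift n k w) \<le> L * \<epsilon> * lag_norm n k w"
proof -
  have "norm (target_shift n k w) \<le> L * (norm (x_smooth (Suc k) w - x_smooth k w) + (\<Sum>i=1..n-1. norm (y_smooth i (Suc k) w - y_smooth i k w)))"
    unfolding target_shift_def target_def
    using ystar_restrict_lipschitz[OF assms(2) y_smooth_Pi y_smooth_Pi, of "Suc k" w k w "x_smooth (Suc k) w" "x_smooth k w"] assms by simp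
  also have "\<dots> = L * \<epsilon> * lag_norm n k w"
    using \<epsilon>_pos unfolding x_smooth_def y_smooth_def smooth_diff_Suc
    by (simp add: lag_norm_def x_lag_def y_lag_def x_smooth_def y_smooth_def sum_distrib_left distrib_left mult.assoc)
  finally show ?thesis .
qed

lemma y_err_recursion:
  assumes "k \<le> K" and n: "n \<in> {1..N}" and \<beta>: "\<beta> n k \<le> B * \<epsilon>"
    and absorb: "\<And>e r. \<lbrakk>0 \<le> e; 0 \<le> r\<rbrakk> \<Longrightarrow>
      e\<^sup>2 + 2 * L * \<epsilon> * r * e - 2 * \<beta> n k * m * e\<^sup>2 + 2 * \<beta> n k * L\<^sup>2 * r * e
        + (L * \<epsilon> * r + \<beta> n k * (L * e + L\<^sup>2 * r))\<^sup>2 + (\<beta> n k)\<^sup>2 * (1 + 2 * \<omega>0) * (L * e + L\<^sup>2 * r)\<^sup>2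
      \<le> (1 - a * \<epsilon>) * e\<^sup>2 + c * \<epsilon> * r\<^sup>2"
    and c: "0 \<le> c"
  shows "second_moment (y_err n (Suc k)) \<le> (1 - a * \<epsilon>) * second_moment (y_err n k) + (c * (2 * real N)) * \<epsilon> * lag_moment n k + (2 * B\<^sup>2 * \<sigma>\<^sup>2) * \<epsilon>\<^sup>2"
proof -
  have k: "k \<le> Suc K" using assms by simp
  note ihv = sq_integrable_h_at[OF assms(1) n] and ieh = y_err_props(2)[OF n k] and meh = y_err_props(1)[OF n k]
    and its = y_err_props(4)[OF n assms(1)] and mts = y_err_props(3)[OF n assms(1)]
  note \<psi> = noise_\<psi>[OF assms(1) n ihv]
  have P: "(\<lambda>w. y_err n k w - target_shift n k w) \<in> borel_measurable (hist k)" "sq_integrable M (\<lambda>w. y_err n k w - target_shift n k w)"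
    using meh mts sq_integrable_diff[OF ieh its] by auto
  have \<beta>0: "0 < \<beta> n k" by (rule \<beta>_pos[OF n assms(1)])
  \<comment> \<open>The multiplicative part of the noise is added before integration, so that one
    scalar inequality covers contraction, target motion and noise. In
    \<open>1 + 2 * \<omega>0\<close> the 1 stems from the drift term of
    \<open>noisy_step_second_moment\<close>, the rest from its doubled noise term.\<close>
  have pointwise: "(norm (y_err n k w - target_shift n k w - \<beta> n k *\<^sub>R h_at n k w))\<^sup>2 + (\<beta> n k)\<^sup>2 * (1 + 2 * \<omega>0) * (norm (h_at n k w))\<^sup>2
      \<le> (1 - a * \<epsilon>) * (norm (y_err n k w))\<^sup>2 + (c * (2 * real N)) * \<epsilon> * lag_sq n k w" if w: "w \<in> space M" for w
  proof -
    let ?e = "norm (y_err n k w)" and ?r = "lag_norm n k w"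
    have h_at: "norm (h_at n k w) \<le> L * ?e + L\<^sup>2 * ?r"
    proof -
      have "norm (h_at n k w) \<le> L * (?e + L * ?r)"
        by (rule order_trans[OF norm_h_at_le[OF assms(1) n w] mult_left_mono[OF norm_y_res_le[OF k n w]]]) (use L_ge_1 in simp)
      then show ?thesis by (simp add: algebra_simps power2_eq_square)
    qed
    have ts: "norm (target_shift n k w) \<le> L * \<epsilon> * ?r" by (rule norm_target_shift_le[OF assms(1) n w])
    have "norm (target_shift n k w + \<beta> n k *\<^sub>R h_at n k w) \<le> L * \<epsilon> * ?r + \<beta> n k * (L * ?e + L\<^sup>2 * ?r)"
      using ts h_at \<beta>0 by (intro norm_triangle_le add_mono) (auto intro: mult_left_mono)
    then have 1: "(norm (target_shift n k w + \<beta> n k *\<^sub>R h_at n k w))\<^sup>2 \<le> (L * \<epsilon> * ?r + \<beta> n k * (L * ?e + L\<^sup>2 * ?r))\<^sup>2"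
      by (intro power_mono) auto
    have "- (y_err n k w \<bullet> target_shift n k w) \<le> norm (y_err n k w) * norm (target_shift n k w)"
      using Cauchy_Schwarz_ineq2[of "y_err n k w" "target_shift n k w"] by linarith
    also have "\<dots> \<le> ?e * (L * \<epsilon> * ?r)" by (intro mult_left_mono ts norm_ge_zero)
    finally have 2: "- (y_err n k w \<bullet> target_shift n k w) \<le> ?e * (L * \<epsilon> * ?r)" .
    \<comment> \<open>The displaced zero of \<open>h_inner_lower\<close> is the target, so its
      \<open>r\<close> is the sum of the norms of the lags.\<close>
    have "m * ?e\<^sup>2 - L\<^sup>2 * ?r * ?e \<le> h_at n k w \<bullet> y_err n k w"
      using h_inner_lower[OF n Y_Pi[OF k w] y_smooth_Pi[OF k w], where x = "x k w" and x' = "x_smooth k w"]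
      by (simp add: h_at_def y_err_def target_def lag_norm_def x_lag_def y_lag_def)
    from mult_left_mono[OF this, of "\<beta> n k"]
    have 3: "\<beta> n k * (m * ?e\<^sup>2 - L\<^sup>2 * ?r * ?e) \<le> \<beta> n k * (h_at n k w \<bullet> y_err n k w)" using \<beta>0 by simp
    have 4: "(\<beta> n k)\<^sup>2 * (1 + 2 * \<omega>0) * (norm (h_at n k w))\<^sup>2 \<le> (\<beta> n k)\<^sup>2 * (1 + 2 * \<omega>0) * (L * ?e + L\<^sup>2 * ?r)\<^sup>2"
      using \<omega>_pos h_at by (intro mult_left_mono power_mono) auto
    have "(norm (y_err n k w - target_shift n k w - \<beta> n k *\<^sub>R h_at n k w))\<^sup>2
        = ?e\<^sup>2 - 2 * (y_err n k w \<bullet> target_shift n k w) - 2 * (\<beta> n k * (h_at n k w \<bullet> y_err n k w))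
          + (norm (target_shift n k w + \<beta> n k *\<^sub>R h_at n k w))\<^sup>2"
      unfolding power2_norm_eq_inner by (simp add: algebra_simps inner_commute)
    then have "(norm (y_err n k w - target_shift n k w - \<beta> n k *\<^sub>R h_at n k w))\<^sup>2 + (\<beta> n k)\<^sup>2 * (1 + 2 * \<omega>0) * (norm (h_at n k w))\<^sup>2
        \<le> ?e\<^sup>2 + 2 * L * \<epsilon> * ?r * ?e - 2 * \<beta> n k * m * ?e\<^sup>2 + 2 * \<beta> n k * L\<^sup>2 * ?r * ?e
          + (L * \<epsilon> * ?r + \<beta> n k * (L * ?e + L\<^sup>2 * ?r))\<^sup>2 + (\<beta> n k)\<^sup>2 * (1 + 2 * \<omega>0) * (L * ?e + L\<^sup>2 * ?r)\<^sup>2"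
      using 1 2 3 4 by (simp add: right_diff_distrib mult_ac)
    also have "\<dots> \<le> (1 - a * \<epsilon>) * ?e\<^sup>2 + c * \<epsilon> * ?r\<^sup>2" by (rule absorb) (auto simp: lag_norm_nonneg)
    also have "c * \<epsilon> * ?r\<^sup>2 \<le> c * \<epsilon> * (2 * real N * lag_sq n k w)"
      using c \<epsilon>_pos by (intro mult_left_mono lag_norm_square_le n) auto
    finally show ?thesis by (simp add: mult_ac)
  qed
  note i = sq_integrableD(2)[OF sq_integrable_diff[OF P(2) sq_integrable_scaleR[OF ihv]]]
    sq_integrableD(2)[OF ihv] sq_integrableD(2)[OF ieh] integral_lag_sq[OF k n]
  have split: "(\<integral>w. (norm (y_err n k w - target_shift n k w - \<beta> n k *\<^sub>R h_at n k w))\<^sup>2 + (\<beta> n k)\<^sup>2 * (1 + 2 * \<omega>0) * (norm (h_at n k w))\<^sup>2 \<partial>M)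
      = (\<integral>w. (norm (y_err n k w - target_shift n k w - \<beta> n k *\<^sub>R h_at n k w))\<^sup>2 \<partial>M) + (\<beta> n k)\<^sup>2 * (1 + 2 * \<omega>0) * second_moment (h_at n k)"
    using i by simp
  have "second_moment (y_err n (Suc k)) = (\<integral>w. (norm ((y_err n k w - target_shift n k w) - \<beta> n k *\<^sub>R (h_at n k w + \<psi> n k w)))\<^sup>2 \<partial>M)"
    using y_err_Suc[OF assms(1) n] by (intro Bochner_Integration.integral_cong) auto
  also have "\<dots> \<le> (\<integral>w. (norm ((y_err n k w - target_shift n k w) - \<beta> n k *\<^sub>R h_at n k w))\<^sup>2 \<partial>M) + (\<beta> n k)\<^sup>2 * (second_moment (h_at n k) + 2 * second_moment (\<psi> n k))"
    by (rule noisy_step_second_moment[OF subalgebra_hist[OF k] \<psi>(1,2) P ihv])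
  also have "(\<beta> n k)\<^sup>2 * (second_moment (h_at n k) + 2 * second_moment (\<psi> n k)) \<le> (\<beta> n k)\<^sup>2 * ((1 + 2 * \<omega>0) * second_moment (h_at n k) + 2 * \<sigma>\<^sup>2)"
    using \<psi>(3) by (intro mult_left_mono) (auto simp: algebra_simps)
  also have "(\<integral>w. (norm ((y_err n k w - target_shift n k w) - \<beta> n k *\<^sub>R h_at n k w))\<^sup>2 \<partial>M) + (\<beta> n k)\<^sup>2 * ((1 + 2 * \<omega>0) * second_moment (h_at n k) + 2 * \<sigma>\<^sup>2)
      = (\<integral>w. (norm (y_err n k w - target_shift n k w - \<beta> n k *\<^sub>R h_at n k w))\<^sup>2 + (\<beta> n k)\<^sup>2 * (1 + 2 * \<omega>0) * (norm (h_at n k w))\<^sup>2 \<partial>M)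
        + (\<beta> n k)\<^sup>2 * (2 * \<sigma>\<^sup>2)"
    unfolding split by (simp only: distrib_left distrib_right mult.assoc add.assoc)
  also have "(\<integral>w. (norm (y_err n k w - target_shift n k w - \<beta> n k *\<^sub>R h_at n k w))\<^sup>2 + (\<beta> n k)\<^sup>2 * (1 + 2 * \<omega>0) * (norm (h_at n k w))\<^sup>2 \<partial>M)
      \<le> (\<integral>w. (1 - a * \<epsilon>) * (norm (y_err n k w))\<^sup>2 + (c * (2 * real N)) * \<epsilon> * lag_sq n k w \<partial>M)"
    by (rule integral_mono) (use i pointwise in auto)
  also have "\<dots> = (1 - a * \<epsilon>) * second_moment (y_err n k) + (c * (2 * real N)) * \<epsilon> * lag_moment n k" using i by simp
  also have "(\<beta> n k)\<^sup>2 * (2 * \<sigma>\<^sup>2) \<le> (B\<^sup>2 * \<epsilon>\<^sup>2) * (2 * \<sigma>\<^sup>2)"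
    using power_mono[OF \<beta>, of 2] \<beta>0 by (intro mult_right_mono) (auto simp: power_mult_distrib)
  finally show ?thesis by (simp add: mult_ac)
qed

text \<open>By the Taylor bound at 0, \<Phi> grows at most quadratically, and the iterates are
  square integrable.\<close>

lemma integrable_\<Phi>: "k \<le> Suc K \<Longrightarrow> integrable M (\<lambda>w. \<Phi> (x k w))"
proof -
  assume k: "k \<le> Suc K"
  have i: "integrable M (\<lambda>w. (norm (x k w))\<^sup>2)" "integrable M (\<lambda>w. grad 0 \<bullet> x k w)"
    using sq_integrableD(2)[OF sq_integrable_x[OF k]] sq_integrable_inner[OF sq_integrable_const sq_integrable_x[OF k]]
    by auto
  have "\<Phi> differentiable (at x)" for x
    using \<Phi>_grad[of x] by (auto simp: gderiv_def differentiable_def)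
  then have "continuous_on UNIV \<Phi>"
    by (intro differentiable_imp_continuous_on) (simp add: differentiable_on_def)
  then have m: "(\<lambda>w. \<Phi> (x k w)) \<in> borel_measurable M"
    using measurable_iterates(1)[OF k] by (rule borel_measurable_continuous_on)
  show ?thesis
  proof (rule Bochner_Integration.integrable_bound[OF _ m])
    show "integrable M (\<lambda>w. \<bar>\<Phi> 0\<bar> + \<bar>grad 0 \<bullet> x k w\<bar> + grad_lip * (norm (x k w))\<^sup>2)" using i by auto
    have "\<bar>\<Phi> u\<bar> \<le> \<bar>\<Phi> 0\<bar> + \<bar>grad 0 \<bullet> u\<bar> + grad_lip * (norm u)\<^sup>2" for u
      using \<Phi>_taylor[of u 0] by simp
    then show "AE w in M. norm (\<Phi> (x k w)) \<le> norm (\<bar>\<Phi> 0\<bar> + \<bar>grad 0 \<bullet> x k w\<bar> + grad_lip * (norm (x k w))\<^sup>2)"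
      by (intro AE_I2) (simp add: order_trans[OF _ abs_ge_self])
  qed
qed

text \<open>The noise drops out of the first-order term because the gradient at \<open>x k\<close>
  is known at time \<open>k\<close>. Of the decrease \<open>\<alpha> k / 2\<close> of the squared
  gradient one half survives; the other half pays for the second-order term, and this is where
  \<open>\<epsilon>\<close> has to be small.\<close>

lemma \<Phi>_recursion:
  assumes "k \<le> K" and \<alpha>: "\<alpha> k \<le> \<epsilon>" and \<epsilon>: "\<epsilon> * (grad_lip * noise_const \<omega>1 \<omega>2) \<le> 1 / 4"
  shows "(\<integral>w. \<Phi> (x (Suc k) w) \<partial>M) \<le> (\<integral>w. \<Phi> (x k w) \<partial>M) - \<alpha> k / 4 * second_moment (grad_at k)
    + (drift_const / 2 + 1 / 4) * \<epsilon> * error_moment k + (2 * grad_lip * \<sigma>\<^sup>2) * \<epsilon>\<^sup>2"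
proof -
  have k: "k \<le> Suc K" and sk: "Suc k \<le> Suc K" using assms by auto
  note ivv = sq_integrable_v_at[OF assms(1)] and igg = sq_integrable_grad_at[OF k]
  note \<xi> = noise_\<xi>(1,2)[OF assms(1) ivv sq_integrable_h_at[OF assms(1)]]
  have \<alpha>0: "0 < \<alpha> k" by (rule \<alpha>_pos[OF assms(1)])
  note i = integrable_\<Phi>[OF k] integrable_\<Phi>[OF sk] sq_integrableD(2)[OF igg] sq_integrableD(2)[OF ivv]
    sq_integrableD(2)[OF \<xi>(2)] sq_integrable_inner[OF igg \<xi>(2)]
    sq_integrableD(2)[OF sq_integrable_diff[OF ivv igg]]
  have pointwise: "\<Phi> (x (Suc k) w) \<le> \<Phi> (x k w) - \<alpha> k / 2 * (norm (grad_at k w))\<^sup>2 + \<alpha> k / 2 * (norm (v_at k w - grad_at k w))\<^sup>2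
      - \<alpha> k * (grad_at k w \<bullet> \<xi> k w) + grad_lip * (\<alpha> k)\<^sup>2 * (2 * (norm (v_at k w))\<^sup>2 + 2 * (norm (\<xi> k w))\<^sup>2)"
    if w: "w \<in> space M" for w
  proof -
    have d: "x (Suc k) w - x k w = - \<alpha> k *\<^sub>R (v_at k w + \<xi> k w)" using x_Suc[OF assms(1) w] by simp
    have "\<Phi> (x (Suc k) w) \<le> \<Phi> (x k w) + grad_at k w \<bullet> (x (Suc k) w - x k w) + grad_lip * (norm (x (Suc k) w - x k w))\<^sup>2"
      using \<Phi>_taylor[of "x (Suc k) w" "x k w"] by (simp add: grad_at_def)
    also have "(norm (x (Suc k) w - x k w))\<^sup>2 = (\<alpha> k)\<^sup>2 * (norm (v_at k w + \<xi> k w))\<^sup>2"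
      unfolding d by (simp add: power_mult_distrib)
    also have "grad_lip * ((\<alpha> k)\<^sup>2 * (norm (v_at k w + \<xi> k w))\<^sup>2)
        \<le> grad_lip * ((\<alpha> k)\<^sup>2 * (2 * (norm (v_at k w))\<^sup>2 + 2 * (norm (\<xi> k w))\<^sup>2))"
      by (intro mult_left_mono square_add_le grad_lip_nonneg) auto
    also have "grad_at k w \<bullet> (x (Suc k) w - x k w) = - \<alpha> k * (grad_at k w \<bullet> v_at k w) - \<alpha> k * (grad_at k w \<bullet> \<xi> k w)"
      unfolding d by (simp add: algebra_simps)
    \<comment> \<open>Polarisation turns the bias of the drift into a square; the squared norm of
      \<open>v_at\<close> comes with a favourable sign and is dropped afterwards.\<close>
    also have "grad_at k w \<bullet> v_at k w = ((norm (grad_at k w))\<^sup>2 + (norm (v_at k w))\<^sup>2 - (norm (v_at k w - grad_at k w))\<^sup>2) / 2"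
      unfolding power2_norm_eq_inner by (simp add: algebra_simps inner_commute)
    finally have "\<Phi> (x (Suc k) w) \<le> \<Phi> (x k w) - \<alpha> k / 2 * (norm (grad_at k w))\<^sup>2 + \<alpha> k / 2 * (norm (v_at k w - grad_at k w))\<^sup>2
      - \<alpha> k * (grad_at k w \<bullet> \<xi> k w) + grad_lip * (\<alpha> k)\<^sup>2 * (2 * (norm (v_at k w))\<^sup>2 + 2 * (norm (\<xi> k w))\<^sup>2)
      - \<alpha> k / 2 * (norm (v_at k w))\<^sup>2"
      by (simp add: algebra_simps add_divide_distrib diff_divide_distrib)
    moreover have "0 \<le> \<alpha> k / 2 * (norm (v_at k w))\<^sup>2" using \<alpha>0 by simp
    ultimately show ?thesis by linarith
  qed
  have "(\<integral>w. \<Phi> (x (Suc k) w) \<partial>M) \<le> (\<integral>w. \<Phi> (x k w) - \<alpha> k / 2 * (norm (grad_at k w))\<^sup>2 + \<alpha> k / 2 * (norm (v_at k w - grad_at k w))\<^sup>2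
      - \<alpha> k * (grad_at k w \<bullet> \<xi> k w) + grad_lip * (\<alpha> k)\<^sup>2 * (2 * (norm (v_at k w))\<^sup>2 + 2 * (norm (\<xi> k w))\<^sup>2) \<partial>M)"
    by (rule integral_mono) (use i pointwise in auto)
  also have "\<dots> = (\<integral>w. \<Phi> (x k w) \<partial>M) - \<alpha> k / 2 * second_moment (grad_at k) + \<alpha> k / 2 * (\<integral>w. (norm (v_at k w - grad_at k w))\<^sup>2 \<partial>M)
      + grad_lip * (\<alpha> k)\<^sup>2 * (2 * second_moment (v_at k) + 2 * second_moment (\<xi> k))"
    using i centered_given_orthogonal[OF subalgebra_hist[OF k] \<xi> measurable_grad_at[OF k] igg] by simp
  also have "\<alpha> k / 2 * (\<integral>w. (norm (v_at k w - grad_at k w))\<^sup>2 \<partial>M) \<le> \<alpha> k / 2 * (drift_const * error_moment k)"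
    using \<alpha>0 by (intro mult_left_mono second_moment_v_at_diff_le assms) auto
  also have "\<alpha> k / 2 * (drift_const * error_moment k) \<le> \<epsilon> / 2 * (drift_const * error_moment k)"
    using \<alpha> drift_const_nonneg error_moment_nonneg by (intro mult_right_mono) auto
  also have "grad_lip * (\<alpha> k)\<^sup>2 * (2 * second_moment (v_at k) + 2 * second_moment (\<xi> k))
      \<le> grad_lip * (\<alpha> k)\<^sup>2 * (noise_const \<omega>1 \<omega>2 * (second_moment (grad_at k) + error_moment k) + 2 * \<sigma>\<^sup>2)"
    by (intro mult_left_mono total_drift_le assms mult_nonneg_nonneg grad_lip_nonneg) auto
  finally have 1: "(\<integral>w. \<Phi> (x (Suc k) w) \<partial>M) \<le> (\<integral>w. \<Phi> (x k w) \<partial>M) - \<alpha> k / 2 * second_moment (grad_at k) + \<epsilon> / 2 * (drift_const * error_moment k)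
      + grad_lip * (\<alpha> k)\<^sup>2 * (noise_const \<omega>1 \<omega>2 * (second_moment (grad_at k) + error_moment k)) + grad_lip * (\<alpha> k)\<^sup>2 * (2 * \<sigma>\<^sup>2)"
    by (simp add: algebra_simps)
  have noise_const: "0 \<le> noise_const \<omega>1 \<omega>2"
    unfolding noise_const_def using \<omega>_pos drift_const_nonneg residual_const_ge by (intro add_nonneg_nonneg mult_nonneg_nonneg) auto
  have "\<alpha> k * (grad_lip * noise_const \<omega>1 \<omega>2) \<le> 1 / 4"
    by (rule order_trans[OF mult_right_mono[OF \<alpha>] \<epsilon>]) (use noise_const grad_lip_nonneg in simp)
  then have "\<alpha> k * (grad_lip * noise_const \<omega>1 \<omega>2) * (\<alpha> k * (second_moment (grad_at k) + error_moment k)) \<le> 1 / 4 * (\<alpha> k * (second_moment (grad_at k) + error_moment k))"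
    using \<alpha>0 error_moment_nonneg by (intro mult_right_mono) auto
  moreover have "\<alpha> k * error_moment k \<le> \<epsilon> * error_moment k" using \<alpha> error_moment_nonneg by (intro mult_right_mono) auto
  ultimately have 2: "grad_lip * (\<alpha> k)\<^sup>2 * (noise_const \<omega>1 \<omega>2 * (second_moment (grad_at k) + error_moment k)) \<le> \<alpha> k / 4 * second_moment (grad_at k) + 1 / 4 * (\<epsilon> * error_moment k)"
    by (simp add: algebra_simps power2_eq_square)
  have "grad_lip * (\<alpha> k)\<^sup>2 * (2 * \<sigma>\<^sup>2) \<le> grad_lip * \<epsilon>\<^sup>2 * (2 * \<sigma>\<^sup>2)"
    using \<alpha> \<alpha>0 grad_lip_nonneg by (intro mult_right_mono mult_left_mono power_mono) auto
  with 1 2 show ?thesis by (simp add: algebra_simps)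
qed

end

subsection \<open>Convergence rate\<close>

text \<open>The sum of all coefficients in the four recursions, so that one constant serves them
  all; the leading 1 meets the premise \<open>1 \<le> C\<close> of
  \<open>telescoping_exists\<close>. It involves neither the horizon nor \<open>\<alpha>\<close>, so
  the threshold \<rho> may be derived from it.\<close>

definition (in mssa_problem) recursion_const :: "real \<Rightarrow> real \<Rightarrow> real \<Rightarrow> real \<Rightarrow> real \<Rightarrow> real \<Rightarrow> real" where
  "recursion_const \<omega>0 \<omega>1 \<omega>2 \<sigma> B c = 1 + c * (2 * real N) + 2 * B\<^sup>2 * \<sigma>\<^sup>2 + B\<^sup>2 * (2 + 2 * \<omega>0) * (L\<^sup>2 * residual_const)
    + noise_const \<omega>1 \<omega>2 + 2 * \<sigma>\<^sup>2 + (drift_const / 2 + 1 / 4) + 2 * grad_lip * \<sigma>\<^sup>2"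

lemma (in mssa_problem) noise_const_nonneg: "0 \<le> \<omega>1 \<Longrightarrow> 0 \<le> \<omega>2 \<Longrightarrow> 0 \<le> noise_const \<omega>1 \<omega>2"
  unfolding noise_const_def using drift_const_nonneg residual_const_ge by (intro add_nonneg_nonneg mult_nonneg_nonneg) auto

lemma (in mssa_problem) recursion_const_ge:
  assumes "0 \<le> c" "0 \<le> \<omega>0" "0 \<le> \<omega>1" "0 \<le> \<omega>2"
  shows "1 \<le> recursion_const \<omega>0 \<omega>1 \<omega>2 \<sigma> B c" "c * (2 * real N) \<le> recursion_const \<omega>0 \<omega>1 \<omega>2 \<sigma> B c"
    "2 * B\<^sup>2 * \<sigma>\<^sup>2 \<le> recursion_const \<omega>0 \<omega>1 \<omega>2 \<sigma> B c"
    "B\<^sup>2 * (2 + 2 * \<omega>0) * (L\<^sup>2 * residual_const) \<le> recursion_const \<omega>0 \<omega>1 \<omega>2 \<sigma> B c"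
    "noise_const \<omega>1 \<omega>2 \<le> recursion_const \<omega>0 \<omega>1 \<omega>2 \<sigma> B c" "2 * \<sigma>\<^sup>2 \<le> recursion_const \<omega>0 \<omega>1 \<omega>2 \<sigma> B c"
    "drift_const / 2 + 1 / 4 \<le> recursion_const \<omega>0 \<omega>1 \<omega>2 \<sigma> B c" "2 * grad_lip * \<sigma>\<^sup>2 \<le> recursion_const \<omega>0 \<omega>1 \<omega>2 \<sigma> B c"
proof -
  have "0 \<le> c * (2 * real N)" "0 \<le> 2 * B\<^sup>2 * \<sigma>\<^sup>2" "0 \<le> B\<^sup>2 * (2 + 2 * \<omega>0) * (L\<^sup>2 * residual_const)"
    "0 \<le> noise_const \<omega>1 \<omega>2" "0 \<le> 2 * \<sigma>\<^sup>2" "0 \<le> drift_const" "0 \<le> 2 * grad_lip * \<sigma>\<^sup>2"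
    using assms residual_const_ge noise_const_nonneg drift_const_nonneg grad_lip_nonneg by auto
  then show "1 \<le> recursion_const \<omega>0 \<omega>1 \<omega>2 \<sigma> B c" "c * (2 * real N) \<le> recursion_const \<omega>0 \<omega>1 \<omega>2 \<sigma> B c"
    "2 * B\<^sup>2 * \<sigma>\<^sup>2 \<le> recursion_const \<omega>0 \<omega>1 \<omega>2 \<sigma> B c"
    "B\<^sup>2 * (2 + 2 * \<omega>0) * (L\<^sup>2 * residual_const) \<le> recursion_const \<omega>0 \<omega>1 \<omega>2 \<sigma> B c"
    "noise_const \<omega>1 \<omega>2 \<le> recursion_const \<omega>0 \<omega>1 \<omega>2 \<sigma> B c" "2 * \<sigma>\<^sup>2 \<le> recursion_const \<omega>0 \<omega>1 \<omega>2 \<sigma> B c"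
    "drift_const / 2 + 1 / 4 \<le> recursion_const \<omega>0 \<omega>1 \<omega>2 \<sigma> B c" "2 * grad_lip * \<sigma>\<^sup>2 \<le> recursion_const \<omega>0 \<omega>1 \<omega>2 \<sigma> B c"
    unfolding recursion_const_def by linarith+
qed

context mssa_process
begin

lemma telescoped_bound:
  assumes absorb: "absorbing b B m L \<omega>0 c \<epsilon>0" and c: "0 \<le> c"
    and tel: "telescoping N (b * m) (recursion_const \<omega>0 \<omega>1 \<omega>2 \<sigma> B c) \<rho> C'" and \<rho>: "\<rho> \<le> 1"
    and \<epsilon>: "\<epsilon> \<le> \<epsilon>0" "\<epsilon> * (grad_lip * noise_const \<omega>1 \<omega>2) \<le> 1 / 4"
    and \<alpha>: "\<And>k. k \<le> K \<Longrightarrow> \<alpha> k \<le> \<rho> * \<epsilon>"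
    and \<beta>: "\<And>n k. n \<in> {1..N} \<Longrightarrow> k \<le> K \<Longrightarrow> b * \<epsilon> \<le> \<beta> n k \<and> \<beta> n k \<le> B * \<epsilon>"
  shows "(\<Sum>k\<le>K. \<alpha> k / 8 * second_moment (grad_at k) + \<epsilon> * error_moment k)
    \<le> (\<integral>w. \<Phi> (x 0 w) \<partial>M) - (\<integral>w. \<Phi> (x (Suc K) w) \<partial>M) + C' * error_moment 0 + C' * ((real K + 1) * \<epsilon>\<^sup>2)"
proof -
  let ?C = "recursion_const \<omega>0 \<omega>1 \<omega>2 \<sigma> B c"
  have \<omega>0: "0 \<le> \<omega>0" "0 \<le> \<omega>1" "0 \<le> \<omega>2" using \<omega>_pos by auto
  note C_ge = recursion_const_ge[OF c \<omega>0, where \<sigma> = \<sigma> and B = B]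
  have \<alpha>': "\<alpha> k \<le> \<epsilon>" if "k \<le> K" for k
    using \<alpha>[OF that] mult_right_mono[OF \<rho>, of \<epsilon>] \<epsilon>_pos by linarith
  have S0: "0 \<le> lag_moment n k" for n k by (simp add: lag_moment_def sum_nonneg add_nonneg_nonneg)
  have \<epsilon>2: "A * \<epsilon>\<^sup>2 \<le> ?C * \<epsilon>\<^sup>2" if "A \<le> ?C" for A using that by (intro mult_right_mono) auto
  have \<epsilon>1: "A * \<epsilon> * X \<le> ?C * \<epsilon> * X" if "A \<le> ?C" "0 \<le> X" for A X
    using that \<epsilon>_pos by (intro mult_right_mono) auto
  have e: "second_moment (y_err n (Suc k)) \<le> (1 - b * m * \<epsilon>) * second_moment (y_err n k) + ?C * \<epsilon> * lag_moment n k + ?C * \<epsilon>\<^sup>2"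
    if k: "k \<le> K" and n: "n \<in> {1..N}" for k n
  proof -
    have "second_moment (y_err n (Suc k)) \<le> (1 - b * m * \<epsilon>) * second_moment (y_err n k) + (c * (2 * real N)) * \<epsilon> * lag_moment n k + (2 * B\<^sup>2 * \<sigma>\<^sup>2) * \<epsilon>\<^sup>2"
      by (rule y_err_recursion[OF k n])
        (use absorb \<beta>[OF n k] \<epsilon> \<epsilon>_pos c in \<open>auto simp: absorbing_def\<close>)
    then show ?thesis using \<epsilon>1[OF C_ge(2) S0[of n k]] \<epsilon>2[OF C_ge(3)] by linarith
  qed
  have d: "second_moment (y_lag n (Suc k)) \<le> (1 - \<epsilon>) * second_moment (y_lag n k) + ?C * \<epsilon> * (second_moment (y_err n k) + lag_moment n k) + ?C * \<epsilon>\<^sup>2"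
    if k: "k \<le> K" and n: "n \<in> {1..N}" for k n
  proof -
    have "0 \<le> second_moment (y_err n k) + lag_moment n k" using S0 by simp
    from \<epsilon>1[OF C_ge(4) this] show ?thesis
      using y_lag_recursion[OF k n, of B] \<beta>[OF n k] \<epsilon>2[OF C_ge(3)] by linarith
  qed
  have D: "second_moment (x_lag (Suc k)) \<le> (1 - \<epsilon>) * second_moment (x_lag k) + ?C * ((\<alpha> k)\<^sup>2 / \<epsilon>) * (second_moment (grad_at k) + error_moment k) + ?C * \<epsilon>\<^sup>2"
    if k: "k \<le> K" for k
  proof -
    have "noise_const \<omega>1 \<omega>2 * ((\<alpha> k)\<^sup>2 / \<epsilon>) * (second_moment (grad_at k) + error_moment k) \<le> ?C * ((\<alpha> k)\<^sup>2 / \<epsilon>) * (second_moment (grad_at k) + error_moment k)"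
      using C_ge(5) \<epsilon>_pos error_moment_nonneg by (intro mult_right_mono) auto
    then show ?thesis using x_lag_recursion[OF k \<alpha>'[OF k]] \<epsilon>2[OF C_ge(6)] by linarith
  qed
  have P: "(\<integral>w. \<Phi> (x (Suc k) w) \<partial>M) \<le> (\<integral>w. \<Phi> (x k w) \<partial>M) - \<alpha> k / 4 * second_moment (grad_at k) + ?C * \<epsilon> * error_moment k + ?C * \<epsilon>\<^sup>2"
    if k: "k \<le> K" for k
    using \<Phi>_recursion[OF k \<alpha>'[OF k] \<epsilon>(2)] \<epsilon>1[OF C_ge(7) error_moment_nonneg[of k]] \<epsilon>2[OF C_ge(8)] by linarith
  show ?thesis
    unfolding error_moment_def
    by (rule tel[unfolded telescoping_def, rule_format])
      (use \<epsilon>_pos \<alpha>_pos \<alpha> e d D P in \<open>auto simp: lag_moment_def error_moment_def\<close>)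
qed

text \<open>The averages start at the iterates: all lags vanish and the target is
  \<open>ystar\<close> at the initial point. The initial error is therefore independent of
  \<open>\<epsilon>\<close>.\<close>

lemma error_moment_0: "error_moment 0 = (\<Sum>n=1..N. second_moment (y_res n 0))"
  by (simp add: error_moment_def x_lag_def y_lag_def x_smooth_def y_smooth_def y_err_def target_def y_res_def)

text \<open>\<open>real K * \<epsilon>\<^sup>2 = 1\<close> keeps the accumulated remainder below
  \<open>2 * C'\<close>, the lower bound \<open>C_F\<close> controls the final mean of \<Phi>, and
  \<open>a0\<close> turns the weights \<open>\<alpha> k\<close> of the gradient terms into multiples
  of \<open>\<epsilon>\<close>.\<close>

lemma running_sums_bound:
  assumes absorb: "absorbing b B m L \<omega>0 c \<epsilon>0" and c: "0 \<le> c"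
    and tel: "telescoping N (b * m) (recursion_const \<omega>0 \<omega>1 \<omega>2 \<sigma> B c) \<rho> C'" and \<rho>: "\<rho> \<le> 1" and C': "0 \<le> C'"
    and \<epsilon>: "\<epsilon> \<le> \<epsilon>0" "\<epsilon> * (grad_lip * noise_const \<omega>1 \<omega>2) \<le> 1 / 4" "real K * \<epsilon>\<^sup>2 = 1"
    and \<alpha>: "\<And>k. k \<le> K \<Longrightarrow> a0 * \<epsilon> \<le> \<alpha> k \<and> \<alpha> k \<le> \<rho> * \<epsilon>" and a0: "0 < a0"
    and \<beta>: "\<And>n k. n \<in> {1..N} \<Longrightarrow> k \<le> K \<Longrightarrow> b * \<epsilon> \<le> \<beta> n k \<and> \<beta> n k \<le> B * \<epsilon>"
  defines "A \<equiv> (\<integral>w. \<Phi> (x 0 w) \<partial>M) - C_F + C' * (\<Sum>n=1..N. second_moment (y_res n 0)) + 2 * C'"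
  shows "(\<Sum>k=1..K. second_moment (grad_at k)) \<le> 8 * A / a0 / \<epsilon>"
    and "(\<Sum>k=1..K. \<Sum>n=1..N. second_moment (y_res n k)) \<le> N * residual_const * A / \<epsilon>"
proof -
  have "(\<integral>w. C_F \<partial>M) \<le> (\<integral>w. \<Phi> (x (Suc K) w) \<partial>M)"
    by (rule integral_mono) (use integrable_\<Phi> \<Phi>_bound in auto)
  then have P: "C_F \<le> (\<integral>w. \<Phi> (x (Suc K) w) \<partial>M)" by (simp add: prob_space)
  have "0 < K" using \<epsilon>(3) by (cases "K = 0") auto
  then have "1 * \<epsilon>\<^sup>2 \<le> real K * \<epsilon>\<^sup>2" by (intro mult_right_mono) auto
  then have "(real K + 1) * \<epsilon>\<^sup>2 \<le> 2" using \<epsilon>(3) by (simp add: algebra_simps)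
  then have N2: "C' * ((real K + 1) * \<epsilon>\<^sup>2) \<le> C' * 2" using C' by (intro mult_left_mono) auto
  have "(\<Sum>k=1..K. a0 * \<epsilon> / 8 * second_moment (grad_at k) + \<epsilon> * error_moment k) \<le> (\<Sum>k=1..K. \<alpha> k / 8 * second_moment (grad_at k) + \<epsilon> * error_moment k)"
    by (intro sum_mono add_right_mono mult_right_mono) (use \<alpha> in auto)
  \<comment> \<open>The telescoped sum starts at \<open>k = 0\<close>, the claimed one at 1; the
    surplus term is nonnegative.\<close>
  also have "\<dots> \<le> (\<Sum>k\<le>K. \<alpha> k / 8 * second_moment (grad_at k) + \<epsilon> * error_moment k)"
  proof (rule sum_mono2)
    fix k assume "k \<in> {..K} - {1..K}"
    then have "0 \<le> \<alpha> k" using \<alpha>_pos[of k] by auto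
    then show "0 \<le> \<alpha> k / 8 * second_moment (grad_at k) + \<epsilon> * error_moment k" using \<epsilon>_pos error_moment_nonneg[of k] by simp
  qed auto
  also have "\<dots> \<le> (\<integral>w. \<Phi> (x 0 w) \<partial>M) - (\<integral>w. \<Phi> (x (Suc K) w) \<partial>M) + C' * error_moment 0 + C' * ((real K + 1) * \<epsilon>\<^sup>2)"
    by (rule telescoped_bound[OF absorb c tel \<rho> \<epsilon>(1,2)]) (use \<alpha> \<beta> in auto)
  also have "\<dots> \<le> A" using P N2 by (simp add: A_def error_moment_0)
  finally have "(\<Sum>k=1..K. a0 * \<epsilon> / 8 * second_moment (grad_at k) + \<epsilon> * error_moment k) \<le> A" .
  then have *: "a0 * \<epsilon> / 8 * (\<Sum>k=1..K. second_moment (grad_at k)) + \<epsilon> * (\<Sum>k=1..K. error_moment k) \<le> A"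
    by (simp add: sum.distrib sum_distrib_left)
  have "0 \<le> \<epsilon> * (\<Sum>k=1..K. error_moment k)" using \<epsilon>_pos error_moment_nonneg by (intro mult_nonneg_nonneg sum_nonneg) auto
  then have "a0 * \<epsilon> / 8 * (\<Sum>k=1..K. second_moment (grad_at k)) \<le> A" using * by linarith
  then show "(\<Sum>k=1..K. second_moment (grad_at k)) \<le> 8 * A / a0 / \<epsilon>" using a0 \<epsilon>_pos by (simp add: field_simps)
  have "0 \<le> a0 * \<epsilon> / 8 * (\<Sum>k=1..K. second_moment (grad_at k))" using a0 \<epsilon>_pos by (intro mult_nonneg_nonneg sum_nonneg) auto
  then have "\<epsilon> * (\<Sum>k=1..K. error_moment k) \<le> A" using * by linarith
  then have Z: "(\<Sum>k=1..K. error_moment k) \<le> A / \<epsilon>" using \<epsilon>_pos by (simp add: field_simps)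
  have "(\<Sum>n=1..N. second_moment (y_res n k)) \<le> N * residual_const * error_moment k" if k: "k \<in> {1..K}" for k
  proof -
    have "second_moment (y_res n k) \<le> residual_const * error_moment k" if n: "n \<in> {1..N}" for n
      by (rule order_trans[OF second_moment_y_res_le mult_left_mono[OF y_err_lag_moment_le]]) (use k n residual_const_ge in auto)
    then have "(\<Sum>n=1..N. second_moment (y_res n k)) \<le> (\<Sum>n=1..N. residual_const * error_moment k)" by (rule sum_mono)
    then show ?thesis by simp
  qed
  then have "(\<Sum>k=1..K. \<Sum>n=1..N. second_moment (y_res n k)) \<le> (\<Sum>k=1..K. N * residual_const * error_moment k)" by (rule sum_mono)
  also have "\<dots> = N * residual_const * (\<Sum>k=1..K. error_moment k)" by (simp add: sum_distrib_left)
  also have "\<dots> \<le> N * residual_const * (A / \<epsilon>)" using Z residual_const_ge by (intro mult_left_mono) auto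
  finally show "(\<Sum>k=1..K. \<Sum>n=1..N. second_moment (y_res n k)) \<le> N * residual_const * A / \<epsilon>" by simp
qed

end

lemma step_Theta_uniform:
  fixes \<beta> :: "nat \<Rightarrow> nat \<Rightarrow> nat \<Rightarrow> real"
  assumes N: "1 \<le> N" and \<beta>: "\<forall>n\<in>{1..N}. step_Theta (\<beta> n)"
  obtains b B where "0 < b" "0 < B"
    and "\<forall>\<^sub>F K in sequentially. \<forall>n\<in>{1..N}. \<forall>k\<le>K. b / sqrt (real K) \<le> \<beta> n K k \<and> \<beta> n K k \<le> B / sqrt (real K)"
proof -
  have "\<forall>n\<in>{1..N}. \<exists>cC :: real \<times> real. 0 < fst cC \<and>
      (\<forall>\<^sub>F K in sequentially. \<forall>k\<le>K. fst cC / sqrt (real K) \<le> \<beta> n K k \<and> \<beta> n K k \<le> snd cC / sqrt (real K))"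
    using \<beta> unfolding step_Theta_def eventually_sequentially by (metis fst_conv snd_conv)
  from bchoice[OF this] obtain cC :: "nat \<Rightarrow> real \<times> real" where cC: "\<forall>n\<in>{1..N}. 0 < fst (cC n) \<and>
      (\<forall>\<^sub>F K in sequentially. \<forall>k\<le>K. fst (cC n) / sqrt (real K) \<le> \<beta> n K k \<and> \<beta> n K k \<le> snd (cC n) / sqrt (real K))"
    by (rule exE)
  define b where "b = Min ((fst \<circ> cC) ` {1..N})"
  \<comment> \<open>The upper constants of \<open>step_Theta\<close> come without an explicit sign;
    the maximum with 1 makes \<open>B\<close> positive.\<close>
  define B where "B = max 1 (Max ((snd \<circ> cC) ` {1..N}))"
  have b: "b \<le> fst (cC n)" and B: "snd (cC n) \<le> B" if "n \<in> {1..N}" for n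
    using that by (auto simp: b_def B_def le_max_iff_disj)
  show ?thesis
  proof (rule that)
    show "0 < b" using cC N by (auto simp: b_def)
    show "0 < B" by (simp add: B_def)
    have "\<forall>\<^sub>F K in sequentially. \<forall>n\<in>{1..N}. \<forall>k\<le>K. fst (cC n) / sqrt (real K) \<le> \<beta> n K k \<and> \<beta> n K k \<le> snd (cC n) / sqrt (real K)"
      by (rule eventually_ball_finite) (use cC in auto)
    then show "\<forall>\<^sub>F K in sequentially. \<forall>n\<in>{1..N}. \<forall>k\<le>K. b / sqrt (real K) \<le> \<beta> n K k \<and> \<beta> n K k \<le> B / sqrt (real K)"
    proof eventually_elim
      case (elim K)
      have "b / sqrt (real K) \<le> fst (cC n) / sqrt (real K)" "snd (cC n) / sqrt (real K) \<le> B / sqrt (real K)"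
        if "n \<in> {1..N}" for n
        using b[OF that] B[OF that] by (auto intro: divide_right_mono)
      then show ?case using elim by (meson order_trans)
    qed
  qed
qed

section \<open>Choice of the threshold and passage to the rates\<close>

theorem theorem2:
  fixes N :: nat
    and V :: "nat \<Rightarrow> 'b::euclidean_space set"
    and v :: "'a::euclidean_space \<Rightarrow> (nat \<Rightarrow> 'b) \<Rightarrow> 'a"
    and h :: "nat \<Rightarrow> 'a \<Rightarrow> (nat \<Rightarrow> 'b) \<Rightarrow> 'b"
    and \<mu> l lA lA' lb lb' :: "nat \<Rightarrow> real"
    and l0 \<omega>0 \<omega>1 \<omega>2 \<sigma> C_F :: real
    and \<Phi> :: "'a \<Rightarrow> real"
    and \<beta> :: "nat \<Rightarrow> nat \<Rightarrow> nat \<Rightarrow> real"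
  assumes "1 \<le> N"
    and V_subspace: "\<forall>n\<in>{1..N}. subspace (V n)"
    and h_range: "\<forall>n\<in>{1..N}. \<forall>x. \<forall>u\<in>tuples V n. h n x u \<in> V n"
    and asm1: "strongly_monotone N V h \<mu>"
    and asm2: "\<forall>n\<in>{1..N}. lipschitz_each_var (l n) V n (h n) \<or>
                 affine_regular V n (h n) (lA n) (lA' n) (lb n) (lb' n)"
    and asm3: "0 < l0" "main_lipschitz N V v h l0"
    and asm4_const: "0 < \<omega>0" "0 < \<omega>1" "0 < \<omega>2" "0 < \<sigma>"
    and asm6: "\<forall>x. C_F \<le> \<Phi> x" "\<forall>x. GDERIV \<Phi> x :> v x (ydiamond V h N x)"
    and beta: "\<forall>n\<in>{1..N}. step_Theta (\<beta> n)"
  shows "\<exists>\<rho>>0. \<forall>\<alpha>. step_Theta \<alpha> \<and>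
           (\<forall>\<^sub>F K in sequentially. \<forall>k\<le>K. \<alpha> K k \<le> \<rho> / sqrt (real K)) \<longrightarrow>
         (\<forall>(M :: 'w measure) x0 y0
            (x :: nat \<Rightarrow> nat \<Rightarrow> 'w \<Rightarrow> 'a) (y :: nat \<Rightarrow> nat \<Rightarrow> nat \<Rightarrow> 'w \<Rightarrow> 'b)
            (\<xi> :: nat \<Rightarrow> nat \<Rightarrow> 'w \<Rightarrow> 'a) (\<psi> :: nat \<Rightarrow> nat \<Rightarrow> nat \<Rightarrow> 'w \<Rightarrow> 'b).
            prob_space M \<and>
            integrable M (\<lambda>w. (norm (x0 w))\<^sup>2) \<and>
            (\<forall>n\<in>{1..N}. integrable M (\<lambda>w. (norm (y0 n w))\<^sup>2)) \<and>
            (\<forall>K\<ge>1. \<forall>w\<in>space M. x K 0 w = x0 w \<and> (\<forall>n\<in>{1..N}. y K n 0 w = y0 n w)) \<and>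
            (\<forall>K\<ge>1. mssa_run M N V v h (\<alpha> K) (\<lambda>n. \<beta> n K) K (x K) (y K) (\<xi> K) (\<psi> K)) \<and>
            (\<forall>K\<ge>1. noise_bounded M N v h \<omega>0 \<omega>1 \<omega>2 \<sigma> K (x K) (y K) (\<xi> K) (\<psi> K)) \<longrightarrow>
            (\<forall>K\<ge>1. \<forall>k\<in>{1..K}.
               integrable M (\<lambda>w. (norm (v (x K k w) (ydiamond V h N (x K k w))))\<^sup>2) \<and>
               (\<forall>n\<in>{1..N}. integrable M (\<lambda>w.
                  (norm (y K n k w - ystar V h n (x K k w) (\<lambda>i\<in>{1..n - 1}. y K i k w)))\<^sup>2))) \<and>
            (\<lambda>K. 1 / real K * (\<Sum>k=1..K. prob_space.expectation M (\<lambda>w.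
                  (norm (v (x K k w) (ydiamond V h N (x K k w))))\<^sup>2)))
              \<in> O(\<lambda>K. 1 / sqrt (real K)) \<and>
            (\<lambda>K. 1 / real K * (\<Sum>k=1..K. \<Sum>n=1..N. prob_space.expectation M (\<lambda>w.
                  (norm (y K n k w - ystar V h n (x K k w) (\<lambda>i\<in>{1..n - 1}. y K i k w)))\<^sup>2)))
              \<in> O(\<lambda>K. 1 / sqrt (real K)))"
proof -
  obtain m L where "regular_operators N V h m L"
    using regular_operators_exist[OF \<open>1 \<le> N\<close> V_subspace h_range asm1 asm2] by blast
  then interpret regular_operators N V h m L .
  interpret mssa_problem N V h m L v \<Phi> l0 C_F
    by unfold_locales (use asm3 asm6 in auto)
  obtain b B where b: "0 < b" and B: "0 < B"
    and \<beta>_ev: "\<forall>\<^sub>F K in sequentially. \<forall>n\<in>{1..N}. \<forall>k\<le>K. b / sqrt (real K) \<le> \<beta> n K k \<and> \<beta> n K k \<le> B / sqrt (real K)"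
    using step_Theta_uniform[OF \<open>1 \<le> N\<close> beta] .
  have L_pos: "0 < L" using L_ge_1 by simp
  from absorbing_exists[OF b B m_pos L_pos asm4_const(1)] obtain c \<epsilon>0
    where c: "0 < c" and \<epsilon>0: "0 < \<epsilon>0" and absorb: "absorbing b B m L \<omega>0 c \<epsilon>0" by blast
  \<comment> \<open>All ingredients of \<open>\<rho>\<close> come from the problem and from the
    bounds on \<open>\<beta>\<close>; \<open>\<alpha>\<close>, the probability space and the runs
    are introduced only afterwards.\<close>
  let ?C = "recursion_const \<omega>0 \<omega>1 \<omega>2 \<sigma> B c"
  have "1 \<le> ?C" using recursion_const_ge(1) c asm4_const by simp
  moreover have "0 < b * m" using b m_pos by simp
  ultimately obtain \<rho> C' where \<rho>: "0 < \<rho>" "\<rho> \<le> 1" and C': "0 \<le> C'" and tel: "telescoping N (b * m) ?C \<rho> C'"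
    using telescoping_exists by blast
  show ?thesis
  proof (rule exI[of _ \<rho>], rule conjI, rule \<rho>(1), intro allI impI, elim conjE, goal_cases)
    case (1 \<alpha> M x0 y0 x y \<xi> \<psi>)
    note \<alpha> = 1(1) and \<alpha>_ev = 1(2) and M = 1(3) and x0 = 1(4) and y0 = 1(5) and init = 1(6)
      and runs = 1(7) and noises = 1(8)
    interpret M: prob_space M by (rule M)
    \<comment> \<open>Each horizon is a process of its own, averaged with rate
      \<open>1 / sqrt (real K)\<close>.\<close>
    have proc: "mssa_process N V h m L v \<Phi> l0 C_F M \<omega>0 \<omega>1 \<omega>2 \<sigma> (1 / sqrt (real K))
        (\<alpha> K) (\<lambda>n. \<beta> n K) K (x K) (y K) (\<xi> K) (\<psi> K)" if K: "1 \<le> K" for K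
    proof unfold_locales
      show "mssa_run M N V v h (\<alpha> K) (\<lambda>n. \<beta> n K) K (x K) (y K) (\<xi> K) (\<psi> K)" using runs K by blast
      show "noise_bounded M N v h \<omega>0 \<omega>1 \<omega>2 \<sigma> K (x K) (y K) (\<xi> K) (\<psi> K)" using noises K by blast
      show "0 < 1 / sqrt (real K)" "1 / sqrt (real K) \<le> 1" using K by auto
      show "0 < \<alpha> K k" if "k \<le> K" for k using \<alpha> K that by (auto simp: step_Theta_def)
      show "0 < \<beta> n K k" if "n \<in> {1..N}" "k \<le> K" for n k using beta K that by (auto simp: step_Theta_def)
      have "x K 0 \<in> borel_measurable M" using runs K unfolding mssa_run_def by blast
      moreover have "integrable M (\<lambda>w. (norm (x K 0 w))\<^sup>2) \<longleftrightarrow> integrable M (\<lambda>w. (norm (x0 w))\<^sup>2)"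
        using init K by (intro Bochner_Integration.integrable_cong) auto
      ultimately show "sq_integrable M (x K 0)" using x0 by (simp add: sq_integrable_def)
      fix n assume n: "n \<in> {1..N}"
      have "y K n 0 \<in> borel_measurable M" using runs K n unfolding mssa_run_def by blast
      moreover have "integrable M (\<lambda>w. (norm (y K n 0 w))\<^sup>2) \<longleftrightarrow> integrable M (\<lambda>w. (norm (y0 n w))\<^sup>2)"
        using init K n by (intro Bochner_Integration.integrable_cong) auto
      ultimately show "sq_integrable M (y K n 0)" using y0 n by (simp add: sq_integrable_def)
    qed (use asm4_const in auto)
    define G where "G K k = (\<integral>w. (norm (v (x K k w) (ydiamond V h N (x K k w))))\<^sup>2 \<partial>M)" for K k
    define E where "E K n k = (\<integral>w. (norm (y K n k w - ystar V h n (x K k w) (\<lambda>i\<in>{1..n - 1}. y K i k w)))\<^sup>2 \<partial>M)" for K n k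
    \<comment> \<open>All horizons share \<open>x0\<close> and \<open>y0\<close>, so this number
      does not depend on \<open>K\<close> and can enter the hidden constants.\<close>
    define A where "A = (\<integral>w. \<Phi> (x0 w) \<partial>M) - C_F
      + C' * (\<Sum>n=1..N. \<integral>w. (norm (y0 n w - ystar V h n (x0 w) (\<lambda>i\<in>{1..n - 1}. y0 i w)))\<^sup>2 \<partial>M) + 2 * C'"
    have integ: "integrable M (\<lambda>w. (norm (v (x K k w) (ydiamond V h N (x K k w))))\<^sup>2)"
      "\<forall>n\<in>{1..N}. integrable M (\<lambda>w. (norm (y K n k w - ystar V h n (x K k w) (\<lambda>i\<in>{1..n - 1}. y K i k w)))\<^sup>2)"
      if K: "1 \<le> K" and k: "k \<in> {1..K}" for K k
    proof -
      interpret P: mssa_process N V h m L v \<Phi> l0 C_F M \<omega>0 \<omega>1 \<omega>2 \<sigma> "1 / sqrt (real K)"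
        "\<alpha> K" "\<lambda>n. \<beta> n K" K "x K" "y K" "\<xi> K" "\<psi> K" by (rule proc[OF K])
      show "integrable M (\<lambda>w. (norm (v (x K k w) (ydiamond V h N (x K k w))))\<^sup>2)"
        using sq_integrableD(2)[OF P.sq_integrable_grad_at[of k]] k by (simp add: P.grad_at_def)
      show "\<forall>n\<in>{1..N}. integrable M (\<lambda>w. (norm (y K n k w - ystar V h n (x K k w) (\<lambda>i\<in>{1..n - 1}. y K i k w)))\<^sup>2)"
        using sq_integrableD(2)[OF P.sq_integrable_y_res[of k]] k by (auto simp: P.y_res_def)
    qed
    \<comment> \<open>\<open>a0\<close> depends on \<open>\<alpha>\<close>, but it affects only the
      constant hidden in the first rate, not \<open>\<rho>\<close>.\<close>
    obtain a0 where a0: "0 < a0" and \<alpha>_low: "\<forall>\<^sub>F K in sequentially. \<forall>k\<le>K. a0 / sqrt (real K) \<le> \<alpha> K k"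
      using \<alpha> unfolding step_Theta_def eventually_sequentially by blast
    have lim: "(\<lambda>K. 1 / sqrt (real K)) \<longlonglongrightarrow> 0" by real_asymp
    have "(\<lambda>K. 1 / sqrt (real K) * (grad_lip * noise_const \<omega>1 \<omega>2)) \<longlonglongrightarrow> 0"
      using tendsto_mult_right[OF lim, of "grad_lip * noise_const \<omega>1 \<omega>2"] by simp
    then have ev2: "\<forall>\<^sub>F K in sequentially. 1 / sqrt (real K) * (grad_lip * noise_const \<omega>1 \<omega>2) < 1 / 4"
      by (rule order_tendstoD) simp
    have bounds: "\<forall>\<^sub>F K in sequentially. 1 \<le> K \<and> (\<Sum>k=1..K. G K k) \<le> 8 * A / a0 * sqrt (real K) \<and>
        (\<Sum>k=1..K. \<Sum>n=1..N. E K n k) \<le> N * residual_const * A * sqrt (real K)"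
      using \<beta>_ev \<alpha>_low \<alpha>_ev order_tendstoD(2)[OF lim \<epsilon>0] ev2 eventually_ge_at_top[of 1]
    proof eventually_elim
      case (elim K)
      then have K: "1 \<le> K" by simp
      interpret P: mssa_process N V h m L v \<Phi> l0 C_F M \<omega>0 \<omega>1 \<omega>2 \<sigma> "1 / sqrt (real K)"
        "\<alpha> K" "\<lambda>n. \<beta> n K" K "x K" "y K" "\<xi> K" "\<psi> K" by (rule proc[OF K])
      have A: "(\<integral>w. \<Phi> (x K 0 w) \<partial>M) - C_F + C' * (\<Sum>n=1..N. \<integral>w. (norm (P.y_res n 0 w))\<^sup>2 \<partial>M) + 2 * C' = A"
      proof -
        have "(\<integral>w. \<Phi> (x K 0 w) \<partial>M) = (\<integral>w. \<Phi> (x0 w) \<partial>M)"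
          using init K by (intro Bochner_Integration.integral_cong) auto
        moreover have "(\<integral>w. (norm (P.y_res n 0 w))\<^sup>2 \<partial>M)
            = (\<integral>w. (norm (y0 n w - ystar V h n (x0 w) (\<lambda>i\<in>{1..n - 1}. y0 i w)))\<^sup>2 \<partial>M)" if n: "n \<in> {1..N}" for n
        proof (rule Bochner_Integration.integral_cong)
          fix w assume w: "w \<in> space M"
          have "(\<lambda>i\<in>{1..n - 1}. y K i 0 w) = (\<lambda>i\<in>{1..n - 1}. y0 i w)"
            using init K w n by (intro restrict_ext) auto
          then show "(norm (P.y_res n 0 w))\<^sup>2 = (norm (y0 n w - ystar V h n (x0 w) (\<lambda>i\<in>{1..n - 1}. y0 i w)))\<^sup>2"
            using init K w n by (simp add: P.y_res_def)
        qed simp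
        ultimately show ?thesis unfolding A_def by simp
      qed
      note bnd = P.running_sums_bound[OF absorb less_imp_le[OF c] tel \<rho>(2) C', where ?a0.0 = a0, unfolded A]
      have "(\<Sum>k=1..K. \<integral>w. (norm (P.grad_at k w))\<^sup>2 \<partial>M) \<le> 8 * A / a0 / (1 / sqrt (real K))"
        by (rule bnd(1)) (use elim a0 K in \<open>auto simp: power_divide\<close>)
      moreover have "(\<Sum>k=1..K. \<Sum>n=1..N. \<integral>w. (norm (P.y_res n k w))\<^sup>2 \<partial>M) \<le> N * residual_const * A / (1 / sqrt (real K))"
        by (rule bnd(2)) (use elim a0 K in \<open>auto simp: power_divide\<close>)
      ultimately show ?case using K by (simp add: G_def E_def P.grad_at_def P.y_res_def)
    qed
    have bigo: "(\<lambda>K. 1 / real K * f K) \<in> O(\<lambda>K. 1 / sqrt (real K))"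
      if "\<forall>\<^sub>F K in sequentially. 1 \<le> K \<and> 0 \<le> f K \<and> f K \<le> q * sqrt (real K)" for f :: "nat \<Rightarrow> real" and q
    proof (rule bigoI[where c = q])
      show "\<forall>\<^sub>F K in sequentially. norm (1 / real K * f K) \<le> q * norm (1 / sqrt (real K))"
        using that
      proof eventually_elim
        case (elim K)
        then have "f K / real K \<le> q * sqrt (real K) / real K" by (intro divide_right_mono) auto
        also have "\<dots> = q / sqrt (real K)" using elim by (simp add: real_div_sqrt field_simps)
        finally show ?case using elim by simp
      qed
    qed
    have "(\<lambda>K. 1 / real K * (\<Sum>k=1..K. G K k)) \<in> O(\<lambda>K. 1 / sqrt (real K))"
    proof (rule bigo)
      show "\<forall>\<^sub>F K in sequentially. 1 \<le> K \<and> 0 \<le> (\<Sum>k=1..K. G K k) \<and> (\<Sum>k=1..K. G K k) \<le> 8 * A / a0 * sqrt (real K)"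
        using bounds by eventually_elim (auto simp: G_def intro!: sum_nonneg)
    qed
    moreover have "(\<lambda>K. 1 / real K * (\<Sum>k=1..K. \<Sum>n=1..N. E K n k)) \<in> O(\<lambda>K. 1 / sqrt (real K))"
    proof (rule bigo)
      show "\<forall>\<^sub>F K in sequentially. 1 \<le> K \<and> 0 \<le> (\<Sum>k=1..K. \<Sum>n=1..N. E K n k) \<and>
          (\<Sum>k=1..K. \<Sum>n=1..N. E K n k) \<le> N * residual_const * A * sqrt (real K)"
        using bounds by eventually_elim (auto simp: E_def intro!: sum_nonneg)
    qed
    ultimately show ?case using integ unfolding G_def E_def by blast
  qed
qed

end
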